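(* For $d=1,2$ and $u\in\mathbb{C}$ let $M_d(u)$ be the difference operator acting on (meromorphic) functions $f$ on $\mathfrak{h}^*$ by $$(M_d(u)f)(\lambda):=\sum_{p\in\mathcal{P}_d}W_{d2}\left(\begin{array}{cc}\lambda&\lambda+2\hbar p\\ \lambda&\lambda+2\hbar p\end{array}\middle|\,u\right)\,T_{\widehat p}f(\lambda),\qquad T_{\widehat p}f(\lambda):=f(\lambda+2\hbar p).$$ (i) $M_d(u)M_{d'}(v)=M_{d'}(v)M_d(u)$ for all $u,v\in\mathbb{C}$ and $d,d'\in\{1,2\}$. (ii) Define the following difference operators, independent of $u$: $$\widetilde M_1:=\sum_{p\in\mathcal{P}_1}\ \prod_{q\in\mathcal{P}_1,\ q\neq\pm p}\frac{[\lambda_{p+q}-\hbar]}{[\lambda_{p+q}]}\,T_{\widehat p},$$ $$\widetilde M_2:=\sum_{p=\pm\varepsilon_1,\ q=\pm\varepsilon_2}\left(\frac{[\lambda_{p+q}-\hbar]}{[\lambda_{p+q}+\hbar]}T_{\widehat p}T_{\widehat q}+\frac{[2\hbar]}{[6\hbar]}\frac{[2\lambda_p+2\hbar]}{[2\lambda_p]}\frac{[2\lambda_q+2\hbar]}{[2\lambda_q]}\frac{[\lambda_{p+q}-5\hbar]}{[\lambda_{p+q}+\hbar]}\frac{[\lambda_{p+q}+2\hbar]}{[\lambda_{p+q}]}\right).$$ Then $M_1(u)=F(u)\widetilde M_1$ and $M_2(u)=G(u)\bigl(\widetilde M_2-H(u)\bigr)$, where $$F(u)=\frac{[u][u+2\hbar]^2[u+4\hbar]}{[-3\hbar]^2[\hbar]^2},$$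 $$G(u)=\frac{[u-\hbar][u]^2[u+\hbar][u+2\hbar][u+3\hbar]^2[u+4\hbar]}{[-3\hbar]^4[\hbar]^4},$$ $$H(u)=\frac{[u+6\hbar][u-3\hbar][2\hbar]}{[u][u+3\hbar][6\hbar]}.$$
   Context: Theta function. Fix $\tau\in\mathbb{C}$ with $\Im\tau>0$, $\mathrm{p}=e^{2\pi i\tau}$, $\mathrm{p}^{1/8}=e^{\pi i\tau/4}$, and $$[u]:=i\,\mathrm{p}^{1/8}\sin(\pi u)\prod_{m\ge1}(1-2\mathrm{p}^m\cos 2\pi u+\mathrm{p}^{2m})(1-\mathrm{p}^m).$$ $\hbar$ is a fixed generic nonzero complex number (so that $[m\hbar]\ne0$ for all nonzero integers $m$). Identities are understood as identities of meromorphic functions in $\lambda$ and the spectral parameters (i.e. for generic values). Weights. $\mathfrak{h}^*$ is the two-dimensional complex vector space with basis $\varepsilon_1,\varepsilon_2$ and symmetric bilinear form $(\varepsilon_j,\varepsilon_k)=\frac12\delta_{jk}$ (the dual of a Cartan subalgebra of $\mathfrak{sp}(4,\mathbb{C})$). $\mathcal{P}_1=\{\pm\varepsilon_1,\pm\varepsilon_2\}$, $\mathcal{P}_2=\{\pm(\varepsilon_1+\varepsilon_2),\pm(\varepsilon_1-\varepsilon_2),0\}$. For $\lambda\in\mathfrak{h}^*$ and $p\in\mathfrak{h}^*$ put $\lambda_p:=(\lambda,p)$ (so $\lambda_{p+q}=\lambda_p+\lambda_q$), and $\widehat p:=2\hbar p$. Type $(1,1)$ Boltzmann weights. Put $c:=-3\hbar$.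 For $\lambda,\mu,\nu,\kappa\in\mathfrak{h}^*$ the function $W\left(\begin{array}{cc}\lambda&\mu\\ \kappa&\nu\end{array}\middle|\,u\right)$ is $0$ unless $\mu-\lambda,\nu-\mu,\kappa-\lambda,\nu-\kappa\in 2\hbar\mathcal{P}_1$. For $p,q,s,r\in\mathcal{P}_1$ with $p+q=s+r$ write $$w_\lambda(p,q\,|\,s,r;u):=W\left(\begin{array}{cc}\lambda&\lambda+\widehat p\\ \lambda+\widehat s&\lambda+\widehat p+\widehat q\end{array}\middle|\,u\right).$$ Then (products over $r\in\mathcal{P}_1$ or $q\in\mathcal P_1$ as indicated) $$w_\lambda(p,p|p,p;u)=\frac{[c-u][u+\hbar]}{[c][\hbar]},$$ $$w_\lambda(p,q|p,q;u)=\frac{[c-u][\lambda_{p-q}-u]}{[c][\lambda_{p-q}]}\quad(p\ne\pm q),$$ $$w_\lambda(q,p|p,q;u)=\frac{[c-u][u][\lambda_{p-q}+\hbar]}{[c][\hbar][\lambda_{p-q}]}\quad(p\neq\pm q),$$ $$w_\lambda(q,-q|p,-p;u)=-\frac{[u][\lambda_{p+q}+\hbar+c-u]}{[c][\lambda_{p+q}+\hbar]}\frac{[2\lambda_p+2\hbar]}{[2\lambda_q]}\frac{\prod_{r\neq\pm p}[\lambda_{p+r}+\hbar]}{\prod_{r\ne\pm q}[\lambda_{q+r}]}\quad(p\ne q),$$ $$w_\lambda(p,-p|p,-p;u)=\frac{[c-u][2\lambda_p+\hbar-u]}{[c][2\lambda_p+\hbar]}-\frac{[u][2\lambda_p+\hbar+c-u]}{[c][2\lambda_p+\hbar]}\frac{[2\lambda_p+2\hbar]}{[2\lambda_p]}\prod_{q\neq\pm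 p}\frac{[\lambda_{p+q}+\hbar]}{[\lambda_{p+q}]}.$$ Fused Boltzmann weights. For $\lambda_j-\lambda_{j-1}\in2\hbar\mathcal{P}_1$ consider formal basis vectors (paths) $e_{\lambda_0}^{\lambda_1}\otimes e_{\lambda_1}^{\lambda_2}\otimes\cdots\otimes e_{\lambda_{k-1}}^{\lambda_k}$ of a complex vector space. Let $W^{j,j+1}(z)$ be the linear operator replacing the $j$-th and $(j+1)$-st factors by $$e_\lambda^\mu\otimes e_\mu^\nu\ \mapsto\ \sum_\kappa W\left(\begin{array}{cc}\lambda&\mu\\ \kappa&\nu\end{array}\middle|\,z\right)e_\lambda^\kappa\otimes e_\kappa^\nu .$$ Put, for $p=\pm\varepsilon_1$, $q=\pm\varepsilon_2$, $$f_\lambda^{\lambda+\widehat p+\widehat q}:=[\lambda_{p-q}+\hbar]\,e_\lambda^{\lambda+\widehat p}\otimes e_{\lambda+\widehat p}^{\lambda+\widehat p+\widehat q}+[\lambda_{q-p}+\hbar]\,e_\lambda^{\lambda+\widehat q}\otimes e_{\lambda+\widehat q}^{\lambda+\widehat p+\widehat q},$$ $$f_\lambda^\lambda:=\sum_{p\in\mathcal{P}_1}[2\lambda_p+2\hbar]\,e_\lambda^{\lambda+\widehat p}\otimes e_{\lambda+\widehat p}^\lambda .$$ The operators $W^{2,3}(u+\hbar)W^{1,2}(u)$ and $W^{2,3}(u+\hbar)W^{3,4}(u)W^{1,2}(u)W^{2,3}(u-\hbar)$ (rightmost factor acts first) map $e_\lambda^\mu\otimes f_\mu^\nu$ into the span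 of the $f_\lambda^\kappa\otimes e_\kappa^\nu$, respectively $f_\lambda^\mu\otimes f_\mu^\nu$ into the span of the $f_\lambda^\kappa\otimes f_\kappa^\nu$, and the fused weights $W_{12}$, $W_{22}$ are defined as the coefficients: $$W^{2,3}(u+\hbar)W^{1,2}(u)\,e_\lambda^\mu\otimes f_\mu^\nu=\sum_\kappa W_{12}\left(\begin{array}{cc}\lambda&\mu\\ \kappa&\nu\end{array}\middle|\,u\right)f_\lambda^\kappa\otimes e_\kappa^\nu,$$ $$W^{2,3}(u+\hbar)W^{3,4}(u)W^{1,2}(u)W^{2,3}(u-\hbar)\,f_\lambda^\mu\otimes f_\mu^\nu=\sum_\kappa W_{22}\left(\begin{array}{cc}\lambda&\mu\\ \kappa&\nu\end{array}\middle|\,u\right)f_\lambda^\kappa\otimes f_\kappa^\nu .$$ *)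

theory Defs
  imports "HOL-Analysis.Analysis" "HOL-Library.Poly_Mapping"
begin

definition theta :: "complex \<Rightarrow> complex \<Rightarrow> complex" where
  "theta \<tau> u =
     (let nome = exp (2 * of_real pi * \<i> * \<tau>) in
      \<i> * exp (of_real pi * \<i> * \<tau> / 4) * sin (of_real pi * u) *
      prodinf (\<lambda>m. (1 - 2 * nome ^ Suc m * cos (2 * of_real pi * u) + nome ^ (2 * Suc m))
            * (1 - nome ^ Suc m)))"


subsection \<open>Weights\<close>

text \<open>The two-dimensional space of weights, in coordinates with respect to the basis
  \<open>\<epsilon> 1, \<epsilon> 2\<close>.\<close>

type_synonym weight = "complex ^ 2"

definition \<epsilon> :: "2 \<Rightarrow> weight" where
  "\<epsilon> j = axis j 1"

definition form :: "weight \<Rightarrow> weight \<Rightarrow> complex" where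
  "form x y = (\<Sum>j\<in>UNIV. x $ j * y $ j) / 2"

definition P\<^sub>1 :: "weight set" where
  "P\<^sub>1 = {\<epsilon> 1, - \<epsilon> 1, \<epsilon> 2, - \<epsilon> 2}"

definition P\<^sub>2 :: "weight set" where
  "P\<^sub>2 = {\<epsilon> 1 + \<epsilon> 2, - (\<epsilon> 1 + \<epsilon> 2), \<epsilon> 1 - \<epsilon> 2, - (\<epsilon> 1 - \<epsilon> 2), 0}"


subsection \<open>The vector space of paths\<close>

text \<open>The path $e_{\lambda_0}^{\lambda_1} \otimes \cdots \otimes e_{\lambda_{k-1}}^{\lambda_k}$
  is the list $[\lambda_0, \ldots, \lambda_k]$ of the $k+1$ weights it visits. Vectors are the
  finitely supported complex-valued functions on such lists.\<close>

type_synonym pathvec = "weight list \<Rightarrow>\<^sub>0 complex"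

definition scale :: "complex \<Rightarrow> pathvec \<Rightarrow> pathvec" where
  "scale c v = Poly_Mapping.map ((*) c) v"

definition linear_extension :: "(weight list \<Rightarrow> pathvec) \<Rightarrow> pathvec \<Rightarrow> pathvec" where
  "linear_extension b v =
     (\<Sum>x\<in>Poly_Mapping.keys v. scale (Poly_Mapping.lookup v x) (b x))"

definition e :: "weight \<Rightarrow> weight \<Rightarrow> pathvec" where
  "e l \<mu> = Poly_Mapping.single [l, \<mu>] 1"

text \<open>Bilinear extension of concatenation of paths. It is only meaningful when the paths in the
  left argument end where those in the right argument start; the common weight is kept once.\<close>

definition tensor :: "pathvec \<Rightarrow> pathvec \<Rightarrow> pathvec" (infixr \<open>\<odot>\<close> 75) where
  "v \<odot> w = linear_extension (\<lambda>x. linear_extension (\<lambda>y. Poly_Mapping.single (x @ tl y) 1) w) v"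


text \<open>The locale only fixes the modular parameter and the step \<open>h\<close> (the paper's
  $\hbar$); all assumptions on them are made explicitly where needed.\<close>

locale C2_face =
  fixes \<tau> h :: complex
begin

abbreviation \<theta> :: "complex \<Rightarrow> complex" where
  "\<theta> \<equiv> theta \<tau>"

definition hat :: "weight \<Rightarrow> weight" where
  "hat p = (2 * h) *s p"

definition c :: complex where
  "c = - 3 * h"


subsection \<open>Boltzmann weights of type (1,1)\<close>

text \<open>\<open>bw l p q s r u\<close> is $w_\lambda(p,q\,|\,s,r;u)$, for \<open>p, q, s, r\<close> in \<open>P\<^sub>1\<close> with
  \<open>p + q = s + r\<close>. In the third and fourth case the upper steps are \<open>p, q\<close>, so the pair
  called $(q,p)$, respectively $(q,-q)$, in the usual notation
  $w_\lambda(q,p\,|\,p,q;u)$, $w_\lambda(q,-q\,|\,p,-p;u)$ is \<open>(p, q)\<close> here, and the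
  usual $p$ is \<open>s\<close>.\<close>

definition bw :: "weight \<Rightarrow> weight \<Rightarrow> weight \<Rightarrow> weight \<Rightarrow> weight \<Rightarrow> complex \<Rightarrow> complex" where
  "bw l p q s r u =
    (if q = p \<and> s = p \<and> r = p then
       \<theta> (c - u) * \<theta> (u + h) / (\<theta> c * \<theta> h)
     else if q \<noteq> p \<and> q \<noteq> - p \<and> s = p \<and> r = q then
       \<theta> (c - u) * \<theta> (form l (p - q) - u) / (\<theta> c * \<theta> (form l (p - q)))
     else if q \<noteq> p \<and> q \<noteq> - p \<and> s = q \<and> r = p then
       \<theta> (c - u) * \<theta> u * \<theta> (form l (s - r) + h) / (\<theta> c * \<theta> h * \<theta> (form l (s - r)))
     else if q = - p \<and> r = - s \<and> s \<noteq> p then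
       - (\<theta> u * \<theta> (form l (s + p) + h + c - u) / (\<theta> c * \<theta> (form l (s + p) + h)))
       * (\<theta> (2 * form l s + 2 * h) / \<theta> (2 * form l p))
       * ((\<Prod>t\<in>P\<^sub>1 - {s, - s}. \<theta> (form l (s + t) + h)) / (\<Prod>t\<in>P\<^sub>1 - {p, - p}. \<theta> (form l (p + t))))
     else if q = - p \<and> s = p \<and> r = - p then
       \<theta> (c - u) * \<theta> (2 * form l p + h - u) / (\<theta> c * \<theta> (2 * form l p + h))
       - \<theta> u * \<theta> (2 * form l p + h + c - u) / (\<theta> c * \<theta> (2 * form l p + h))
         * (\<theta> (2 * form l p + 2 * h) / \<theta> (2 * form l p))
         * (\<Prod>t\<in>P\<^sub>1 - {p, - p}. \<theta> (form l (p + t) + h) / \<theta> (form l (p + t)))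
     else 0)"

definition unhat :: "weight \<Rightarrow> weight" where
  "unhat x = (1 / (2 * h)) *s x"

text \<open>\<open>W l \<mu> \<kappa> \<nu> u\<close> is the weight of the face with upper row \<open>l, \<mu>\<close> and lower row \<open>\<kappa>, \<nu>\<close>;
  the same argument order is used for \<open>W12\<close> and \<open>W22\<close> below.\<close>

definition W :: "weight \<Rightarrow> weight \<Rightarrow> weight \<Rightarrow> weight \<Rightarrow> complex \<Rightarrow> complex" where
  "W l \<mu> \<kappa> \<nu> u =
    (if {\<mu> - l, \<nu> - \<mu>, \<kappa> - l, \<nu> - \<kappa>} \<subseteq> hat ` P\<^sub>1
     then bw l (unhat (\<mu> - l)) (unhat (\<nu> - \<mu>)) (unhat (\<kappa> - l)) (unhat (\<nu> - \<kappa>)) u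
     else 0)"


subsection \<open>Fused Boltzmann weights\<close>

text \<open>\<open>Wop j z\<close> is $W^{j,j+1}(z)$. Factors are numbered from 1, so the \<open>j\<close>-th and
  \<open>(j+1)\<close>-st factors of a path \<open>x\<close> run through \<open>x ! (j - 1)\<close>, \<open>x ! j\<close>, \<open>x ! (j + 1)\<close>.\<close>

definition Wop :: "nat \<Rightarrow> complex \<Rightarrow> pathvec \<Rightarrow> pathvec" where
  "Wop j z = linear_extension (\<lambda>x.
     \<Sum>\<kappa>\<in>(\<lambda>s. x ! (j - 1) + hat s) ` P\<^sub>1.
       scale (W (x ! (j - 1)) (x ! j) \<kappa> (x ! (j + 1)) z) (Poly_Mapping.single (x[j := \<kappa>]) 1))"

text \<open>\<open>f l \<nu>\<close> is $f_\lambda^\nu$ if \<open>\<nu> - l \<in> hat ` P\<^sub>2\<close>, and zero otherwise.\<close>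

definition f :: "weight \<Rightarrow> weight \<Rightarrow> pathvec" where
  "f l \<nu> =
    (if \<nu> = l then
       \<Sum>p\<in>P\<^sub>1. scale (\<theta> (2 * form l p + 2 * h)) (e l (l + hat p) \<odot> e (l + hat p) l)
     else
       \<Sum>p\<in>{\<epsilon> 1, - \<epsilon> 1}. \<Sum>q\<in>{\<epsilon> 2, - \<epsilon> 2}.
         if \<nu> = l + hat p + hat q
         then scale (\<theta> (form l (p - q) + h)) (e l (l + hat p) \<odot> e (l + hat p) \<nu>)
            + scale (\<theta> (form l (q - p) + h)) (e l (l + hat q) \<odot> e (l + hat q) \<nu>)
         else 0)"

text \<open>The fused weights are the coefficients of the expansion in the vectors
  $f_\lambda^\kappa \otimes e_\kappa^\nu$, respectively
  $f_\lambda^\kappa \otimes f_\kappa^\nu$; coefficients for which this vector does not exist are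
  set to zero. The description operator presupposes that the expansion exists.\<close>

definition mid12 :: "weight \<Rightarrow> weight \<Rightarrow> weight set" where
  "mid12 l \<nu> = {\<kappa>. \<kappa> - l \<in> hat ` P\<^sub>2 \<and> \<nu> - \<kappa> \<in> hat ` P\<^sub>1}"

definition mid22 :: "weight \<Rightarrow> weight \<Rightarrow> weight set" where
  "mid22 l \<nu> = {\<kappa>. \<kappa> - l \<in> hat ` P\<^sub>2 \<and> \<nu> - \<kappa> \<in> hat ` P\<^sub>2}"

definition W12 :: "weight \<Rightarrow> weight \<Rightarrow> weight \<Rightarrow> weight \<Rightarrow> complex \<Rightarrow> complex" where
  "W12 l \<mu> \<kappa> \<nu> u =
    (THE a. (\<forall>\<rho>. \<rho> \<notin> mid12 l \<nu> \<longrightarrow> a \<rho> = 0) \<and>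
       Wop 2 (u + h) (Wop 1 u (e l \<mu> \<odot> f \<mu> \<nu>))
         = (\<Sum>\<rho>\<in>mid12 l \<nu>. scale (a \<rho>) (f l \<rho> \<odot> e \<rho> \<nu>))) \<kappa>"

definition W22 :: "weight \<Rightarrow> weight \<Rightarrow> weight \<Rightarrow> weight \<Rightarrow> complex \<Rightarrow> complex" where
  "W22 l \<mu> \<kappa> \<nu> u =
    (THE a. (\<forall>\<rho>. \<rho> \<notin> mid22 l \<nu> \<longrightarrow> a \<rho> = 0) \<and>
       Wop 2 (u + h) (Wop 3 u (Wop 1 u (Wop 2 (u - h) (f l \<mu> \<odot> f \<mu> \<nu>))))
         = (\<Sum>\<rho>\<in>mid22 l \<nu>. scale (a \<rho>) (f l \<rho> \<odot> f \<rho> \<nu>))) \<kappa>"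


subsection \<open>Difference operators\<close>

text \<open>Difference operators act on arbitrary functions of the weight. Identities between them are
  asserted at the points of \<open>generic\<close>: there no denominator of a coefficient vanishes, and the
  set is stable under all shifts by \<open>hat p\<close>.\<close>

definition generic :: "weight set" where
  "generic = {l. \<forall>p\<in>P\<^sub>1. \<forall>q\<in>P\<^sub>1. p + q \<noteq> 0 \<longrightarrow>
                  (\<forall>k::int. \<theta> (form l (p + q) + of_int k * h) \<noteq> 0)}"

definition T :: "weight \<Rightarrow> (weight \<Rightarrow> complex) \<Rightarrow> weight \<Rightarrow> complex" where
  "T x \<phi> l = \<phi> (l + x)"

definition M1 :: "complex \<Rightarrow> (weight \<Rightarrow> complex) \<Rightarrow> weight \<Rightarrow> complex" where
  "M1 u \<phi> l = (\<Sum>p\<in>P\<^sub>1. W12 l (l + hat p) l (l + hat p) u * T (hat p) \<phi> l)"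

definition M2 :: "complex \<Rightarrow> (weight \<Rightarrow> complex) \<Rightarrow> weight \<Rightarrow> complex" where
  "M2 u \<phi> l = (\<Sum>p\<in>P\<^sub>2. W22 l (l + hat p) l (l + hat p) u * T (hat p) \<phi> l)"

text \<open>Used for \<open>d = 1, 2\<close> only.\<close>

definition M :: "nat \<Rightarrow> complex \<Rightarrow> (weight \<Rightarrow> complex) \<Rightarrow> weight \<Rightarrow> complex" where
  "M d = (if d = 1 then M1 else M2)"

definition Mt1 :: "(weight \<Rightarrow> complex) \<Rightarrow> weight \<Rightarrow> complex" where
  "Mt1 \<phi> l =
    (\<Sum>p\<in>P\<^sub>1. (\<Prod>q\<in>P\<^sub>1 - {p, - p}. \<theta> (form l (p + q) - h) / \<theta> (form l (p + q)))
             * T (hat p) \<phi> l)"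

definition Mt2 :: "(weight \<Rightarrow> complex) \<Rightarrow> weight \<Rightarrow> complex" where
  "Mt2 \<phi> l =
    (\<Sum>p\<in>{\<epsilon> 1, - \<epsilon> 1}. \<Sum>q\<in>{\<epsilon> 2, - \<epsilon> 2}.
       \<theta> (form l (p + q) - h) / \<theta> (form l (p + q) + h) * T (hat p) (T (hat q) \<phi>) l
       + \<theta> (2 * h) / \<theta> (6 * h)
         * (\<theta> (2 * form l p + 2 * h) / \<theta> (2 * form l p))
         * (\<theta> (2 * form l q + 2 * h) / \<theta> (2 * form l q))
         * (\<theta> (form l (p + q) - 5 * h) / \<theta> (form l (p + q) + h))
         * (\<theta> (form l (p + q) + 2 * h) / \<theta> (form l (p + q)))
         * \<phi> l)"

definition F :: "complex \<Rightarrow> complex" where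
  "F u = \<theta> u * \<theta> (u + 2 * h) ^ 2 * \<theta> (u + 4 * h) / (\<theta> (- 3 * h) ^ 2 * \<theta> h ^ 2)"

definition G :: "complex \<Rightarrow> complex" where
  "G u = \<theta> (u - h) * \<theta> u ^ 2 * \<theta> (u + h) * \<theta> (u + 2 * h) * \<theta> (u + 3 * h) ^ 2 * \<theta> (u + 4 * h)
         / (\<theta> (- 3 * h) ^ 4 * \<theta> h ^ 4)"

definition H :: "complex \<Rightarrow> complex" where
  "H u = \<theta> (u + 6 * h) * \<theta> (u - 3 * h) * \<theta> (2 * h) / (\<theta> u * \<theta> (u + 3 * h) * \<theta> (6 * h))"

end

end

theory Submission
  imports Defs "HOL-Complex_Analysis.Complex_Analysis"
begin

text \<open>The theta function satisfies the three-term relation, because the quotient of two of its sides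
  is an elliptic function without poles. For orthogonal \<open>p\<close>, \<open>q\<close> in \<open>P\<^sub>1\<close> put $x = \lambda_p$ and
  $y = \lambda_q$. The operator $W^{2,3}(u+\hbar)W^{1,2}(u)$ is computed on $e \otimes f$ path by path: the
  coefficient of each path is a sum of products of theta values in \<open>x\<close>, \<open>y\<close>, \<open>u\<close>, which the three-term
  relation turns into a single product. Since $W^{3,4}$ and $W^{1,2}$ commute, two such steps give the
  diagonal weights $W_{22}$ as well. The outcome is that $M_1(u)$ is a multiple of $\widetilde M_1$, and
  $M_2(u)$ a combination of $\widetilde M_2$ and the identity, with coefficients depending only on \<open>u\<close>.
  Hence all commutation relations follow from $[\widetilde M_1, \widetilde M_2] = 0$, which is again a
  finite list of theta identities.\<close>

subsection \<open>The theta function\<close>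

text \<open>The fused weights are values of a description operator, so each diagonal weight needs a
  complete expansion together with its uniqueness. Completeness is what multiplies the identities: a
  path such as p, p, -p occurs in no f-vector, and its contributions must cancel. The symmetry of
  \<open>P\<^sub>1\<close> keeps the cases few: for every orthogonal pair this set is p, -p, q, -q,
  so sign changes and the exchange of p and q become substitutions in x and y. Each longer theta
  identity has an explicit certificate, a combination of three-term relations with theta products as
  cofactors, which \<open>algebra\<close> checks once all quotients share a common factor. The
  weight that fixes \<lambda> first appears as \<open>V3 u\<close> minus \<open>VQ u\<close> times
  two terms \<open>RR\<close>, which do not resemble the constant term of \<open>Mt2\<close>. The
  bridge is \<open>sum_TT\<close>: the four terms \<open>TT\<close> of that constant term and the
  two \<open>RR\<close> add up to a constant \<open>K0\<close>. This constant is the source of H,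
  because \<open>VQ u * K0 - V3 u\<close> is the product of G and H, and it drops out of the
  commutator.\<close>

definition nome :: "complex \<Rightarrow> complex" where
  "nome \<tau> = exp (2 * of_real pi * \<i> * \<tau>)"

definition theta_factor :: "complex \<Rightarrow> nat \<Rightarrow> complex \<Rightarrow> complex" where
  "theta_factor \<tau> m u = (1 - 2 * nome \<tau> ^ Suc m * cos (2 * of_real pi * u) + nome \<tau> ^ (2 * Suc m))
     * (1 - nome \<tau> ^ Suc m)"

definition theta_product :: "complex \<Rightarrow> complex \<Rightarrow> complex" where
  "theta_product \<tau> u = prodinf (\<lambda>m. theta_factor \<tau> m u)"

lemma theta_eq:
  "theta \<tau> u = \<i> * exp (of_real pi * \<i> * \<tau> / 4) * sin (of_real pi * u) * theta_product \<tau> u"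
  by (simp add: theta_def Let_def theta_product_def theta_factor_def nome_def)

lemma theta_minus [simp]: "theta \<tau> (- u) = - theta \<tau> u"
  by (simp add: theta_eq theta_product_def theta_factor_def)

lemma theta_0 [simp]: "theta \<tau> 0 = 0"
  by (simp add: theta_eq)

lemma theta_minus_commute: "theta \<tau> (a - b) = - theta \<tau> (b - a)"
  using theta_minus [of \<tau> "b - a"] by simp

lemma theta_add_1: "theta \<tau> (u + 1) = - theta \<tau> u"
proof -
  have "cos (2 * of_real pi * (u + 1)) = cos (2 * of_real pi * u)"
    by (simp add: distrib_left cos_add sin_of_real cos_of_real)
  moreover have "sin (of_real pi * (u + 1)) = - sin (of_real pi * u)"
    by (simp add: distrib_left sin_add sin_of_real cos_of_real)
  ultimately show ?thesis
    by (simp add: theta_eq theta_product_def theta_factor_def)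
qed

section \<open>Convergence and holomorphy of the theta product\<close>

locale nome_disc =
  fixes \<tau> :: complex
  assumes Im_pos: "Im \<tau> > 0"
begin

abbreviation "nm \<equiv> nome \<tau>"

lemma norm_nome: "norm nm < 1"
  using Im_pos by (simp add: nome_def norm_exp)

lemma nome_nonzero [simp]: "nm \<noteq> 0"
  by (simp add: nome_def)

lemma one_minus_nome_power: "1 - nm ^ Suc m \<noteq> 0"
proof
  assume "1 - nm ^ Suc m = 0"
  then have "norm nm ^ Suc m = 1"
    by (metis eq_iff_diff_eq_0 norm_one norm_power)
  moreover have "norm nm ^ Suc m < 1"
    using norm_nome power_Suc_less_one by (metis norm_ge_zero norm_power power_less_one_iff zero_less_Suc)
  ultimately show False by simp
qed

text \<open>The majorant is uniform wherever the cosine is bounded, which serves both the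
  convergence at a point and the Weierstrass test on a disc. After one power of the nome is split
  off, five terms remain; their norms add up to 4M + 3.\<close>

lemma theta_factor_bound:
  assumes "norm (cos (2 * of_real pi * u)) \<le> M"
  shows "norm (theta_factor \<tau> m u - 1) \<le> norm nm ^ m * (4 * M + 3)"
proof -
  define k where "k = nm ^ Suc m"
  define c where "c = cos (2 * of_real pi * u)"
  have k1: "norm k \<le> 1" "norm k \<le> norm nm ^ m"
    using norm_nome by (auto simp: k_def norm_power power_le_one norm_mult mult_left_le_one_le
        intro!: mult_le_one)
  have "theta_factor \<tau> m u - 1 = k * ((- 2 * c + k - 1) + (2 * (k * c) - k * k))"
    unfolding theta_factor_def power_mult
    by (simp add: k_def c_def power2_eq_square power_mult_distrib algebra_simps flip: power_add)
  also have "norm \<dots> = norm k * norm ((- 2 * c + k - 1) + (2 * (k * c) - k * k))"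
    by (rule norm_mult)
  also have "\<dots> \<le> norm nm ^ m * (4 * M + 3)"
  proof (rule mult_mono)
    have "norm ((- 2 * c + k - 1) + (2 * (k * c) - k * k)) \<le> norm (- 2 * c + k - 1) + norm (2 * (k * c) - k * k)"
      by (rule norm_triangle_ineq)
    also have "norm (- 2 * c + k - 1) \<le> norm (- 2 * c + k) + norm (1 :: complex)"
      by (rule norm_triangle_ineq4)
    also have "norm (- 2 * c + k) \<le> norm (- 2 * c) + norm k"
      by (rule norm_triangle_ineq)
    also have "norm (2 * (k * c) - k * k) \<le> norm (2 * (k * c)) + norm (k * k)"
      by (rule norm_triangle_ineq4)
    also have "norm (2 * (k * c)) = 2 * norm (k * c)"
      by (simp add: norm_mult)
    also have "norm (- 2 * c) = 2 * norm c"
      by (simp add: norm_mult)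
    also have "norm (k * c) \<le> norm c"
      using k1 by (simp add: norm_mult mult_left_le_one_le)
    also have "norm (k * k) \<le> 1"
      using k1 by (simp add: norm_mult mult_le_one)
    finally show "norm ((- 2 * c + k - 1) + (2 * (k * c) - k * k)) \<le> 4 * M + 3"
      using k1 assms by (simp add: c_def)
  qed (use k1 in auto)
  finally show ?thesis .
qed

lemma summable_nome: "summable (\<lambda>m. norm nm ^ m * C)"
  using norm_nome by (intro summable_mult2 summable_geometric) auto

lemma convergent_theta_factor: "convergent_prod (\<lambda>m. theta_factor \<tau> m u)"
proof -
  have "summable (\<lambda>m. norm (theta_factor \<tau> m u - 1))"
    using theta_factor_bound [OF order.refl, of _ u]
    by (intro summable_comparison_test' [OF summable_nome, of 0]) auto
  then show ?thesis
    by (intro abs_convergent_prod_imp_convergent_prod summable_imp_abs_convergent_prod)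
qed

lemma theta_product_LIMSEQ: "(\<lambda>N. \<Prod>m<N. theta_factor \<tau> m u) \<longlonglongrightarrow> theta_product \<tau> u"
  unfolding theta_product_def using convergent_prod_LIMSEQ [OF convergent_theta_factor [of u]] LIMSEQ_lessThan_iff_atMost by blast

text \<open>The partial products are entire and converge uniformly on every disc of radius 1, so the
  limit is holomorphic.\<close>

lemma holomorphic_theta_product: "theta_product \<tau> holomorphic_on UNIV"
proof (rule holomorphic_uniform_sequence)
  show "(\<lambda>u. \<Prod>m<N. theta_factor \<tau> m u) holomorphic_on UNIV" for N
    unfolding theta_factor_def by (intro holomorphic_on_prod holomorphic_on_mult holomorphic_on_add holomorphic_on_diff holomorphic_on_cos' holomorphic_on_const holomorphic_on_ident)
  fix x :: complex
  define A where "A = cball x 1"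
  have cont: "continuous_on A (\<lambda>u. theta_factor \<tau> m u)" for m
    unfolding theta_factor_def
    by (intro holomorphic_on_imp_continuous_on holomorphic_on_mult holomorphic_on_add holomorphic_on_diff holomorphic_on_cos' holomorphic_on_const holomorphic_on_ident)
  have "compact ((\<lambda>u. cos (2 * of_real pi * u)) ` A)"
    unfolding A_def
    by (intro compact_continuous_image holomorphic_on_imp_continuous_on holomorphic_on_cos' holomorphic_on_mult holomorphic_on_const holomorphic_on_ident compact_cball)
  then have "bounded ((\<lambda>u. cos (2 * of_real pi * u)) ` A)"
    by (rule compact_imp_bounded)
  then obtain M where M: "norm (cos (2 * of_real pi * u)) \<le> M" if "u \<in> A" for u
    unfolding bounded_iff by (force simp del: of_real_mult)
  have "uniformly_convergent_on A (\<lambda>N u. \<Sum>m<N. norm (theta_factor \<tau> m u - 1))"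
    using theta_factor_bound [OF M]
    by (intro Weierstrass_m_test' [OF _ summable_nome [of "4 * M + 3"]]) auto
  then have "uniformly_convergent_on A (\<lambda>N u. \<Prod>m<N. theta_factor \<tau> m u)"
    by (intro uniformly_convergent_on_prod' cont) (auto simp: A_def)
  then have "uniform_limit A (\<lambda>N u. \<Prod>m<N. theta_factor \<tau> m u) (\<lambda>u. lim (\<lambda>N. \<Prod>m<N. theta_factor \<tau> m u)) sequentially"
    using uniformly_convergent_uniform_limit_iff by blast
  then have "uniform_limit A (\<lambda>N u. \<Prod>m<N. theta_factor \<tau> m u) (theta_product \<tau>) sequentially"
    by (simp add: limI [OF theta_product_LIMSEQ])
  then show "\<exists>d>0. cball x d \<subseteq> UNIV \<and> uniform_limit (cball x d) (\<lambda>N u. \<Prod>m<N. theta_factor \<tau> m u) (theta_product \<tau>) sequentially"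
    unfolding A_def by (meson subset_UNIV zero_less_one)
qed (rule open_UNIV)

lemma holomorphic_theta: "theta \<tau> holomorphic_on UNIV"
  unfolding theta_eq [abs_def]
  by (intro holomorphic_intros holomorphic_theta_product)

lemma holomorphic_theta_compose [holomorphic_intros]:
  "f holomorphic_on A \<Longrightarrow> (\<lambda>x. theta \<tau> (f x)) holomorphic_on A"
  using holomorphic_on_compose_gen [OF _ holomorphic_theta, of f A] by (simp add: o_def)

lemma continuous_theta_compose [continuous_intros]:
  "continuous_on A f \<Longrightarrow> continuous_on A (\<lambda>x. theta \<tau> (f x))"
  using continuous_on_compose2 [OF holomorphic_on_imp_continuous_on [OF holomorphic_theta]] by blast

section \<open>Quasi-periodicity\<close>

lemma theta_factor_exp:
  defines "a \<equiv> \<lambda>u. exp (2 * of_real pi * \<i> * u)"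
  shows "theta_factor \<tau> m u = (1 - nm ^ Suc m * a u) * (1 - nm ^ Suc m / a u) * (1 - nm ^ Suc m)"
proof -
  define k where "k = nm ^ Suc m"
  have a0: "a u \<noteq> 0"
    by (simp add: a_def)
  have "2 * cos (2 * of_real pi * u) = a u + 1 / a u"
    by (simp add: cos_exp_eq a_def exp_minus field_simps)
  then have "2 * k * cos (2 * of_real pi * u) = k * (a u + 1 / a u)"
    by (metis mult.assoc mult.commute)
  moreover have "1 - k * (a u + 1 / a u) + k * k = (1 - k * a u) * (1 - k / a u)"
    using a0 by (simp add: field_simps)
  moreover have "nm ^ (2 * Suc m) = k * k"
    by (simp only: k_def mult_2 power_add)
  ultimately have "1 - 2 * k * cos (2 * of_real pi * u) + nm ^ (2 * Suc m) = (1 - k * a u) * (1 - k / a u)"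
    by metis
  then show ?thesis
    unfolding theta_factor_def k_def by metis
qed

text \<open>The shift by \<tau> replaces a by \<open>nm * a\<close>. It moves the linear factors in
  a up by one index and those in 1/a down by one, so that only end factors survive. The relation is
  kept free of division because \<open>1 - nm * a\<close> may vanish.\<close>

lemma theta_product_shift:
  fixes u :: complex
  defines "a \<equiv> exp (2 * of_real pi * \<i> * u)"
  shows "theta_product \<tau> (u + \<tau>) * (1 - nm * a) = theta_product \<tau> u * (1 - 1 / a)"
proof -
  have a0: "a \<noteq> 0" by (simp add: a_def)
  have aq: "exp (2 * of_real pi * \<i> * (u + \<tau>)) = nm * a"
    by (simp add: a_def nome_def exp_add [symmetric] algebra_simps)
  \<comment> \<open>For finite N the end factors \<open>1 - nm ^ N / a\<close> and
    \<open>1 - nm ^ Suc N * a\<close> also remain; both tend to 1.\<close>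
  have fin: "(\<Prod>m<N. theta_factor \<tau> m (u + \<tau>)) * ((1 - nm * a) * (1 - nm ^ N / a))
      = (\<Prod>m<N. theta_factor \<tau> m u) * ((1 - nm ^ Suc N * a) * (1 - 1 / a))" for N
  proof (induction N)
    case (Suc N)
    have 1: "theta_factor \<tau> N (u + \<tau>) = (1 - nm ^ Suc (Suc N) * a) * (1 - nm ^ N / a) * (1 - nm ^ Suc N)"
      unfolding theta_factor_exp aq by (simp add: mult_ac)
    have 2: "theta_factor \<tau> N u = (1 - nm ^ Suc N * a) * (1 - nm ^ Suc N / a) * (1 - nm ^ Suc N)"
      by (simp add: theta_factor_exp a_def)
    have "(\<Prod>m<Suc N. theta_factor \<tau> m (u + \<tau>)) * ((1 - nm * a) * (1 - nm ^ Suc N / a))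
        = ((\<Prod>m<N. theta_factor \<tau> m (u + \<tau>)) * ((1 - nm * a) * (1 - nm ^ N / a)))
          * ((1 - nm ^ Suc (Suc N) * a) * (1 - nm ^ Suc N / a) * (1 - nm ^ Suc N))"
      unfolding prod.lessThan_Suc 1 by (simp only: ac_simps)
    also have "\<dots> = ((\<Prod>m<N. theta_factor \<tau> m u) * ((1 - nm ^ Suc N * a) * (1 - 1 / a)))
          * ((1 - nm ^ Suc (Suc N) * a) * (1 - nm ^ Suc N / a) * (1 - nm ^ Suc N))"
      by (simp only: Suc)
    also have "\<dots> = (\<Prod>m<Suc N. theta_factor \<tau> m u) * ((1 - nm ^ Suc (Suc N) * a) * (1 - 1 / a))"
      unfolding prod.lessThan_Suc 2 by (simp only: ac_simps)
    finally show ?case .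
  qed auto
  have q0: "(\<lambda>N. nm ^ N) \<longlonglongrightarrow> 0"
    using norm_nome by (rule LIMSEQ_power_zero)
  have "(\<lambda>N. (\<Prod>m<N. theta_factor \<tau> m (u + \<tau>)) * ((1 - nm * a) * (1 - nm ^ N / a)))
      \<longlonglongrightarrow> theta_product \<tau> (u + \<tau>) * ((1 - nm * a) * (1 - 0 / a))"
    by (intro tendsto_intros theta_product_LIMSEQ q0 a0)
  moreover have "(\<lambda>N. (\<Prod>m<N. theta_factor \<tau> m u) * ((1 - nm ^ Suc N * a) * (1 - 1 / a)))
      \<longlonglongrightarrow> theta_product \<tau> u * ((1 - 0 * a) * (1 - 1 / a))"
    by (intro tendsto_intros theta_product_LIMSEQ LIMSEQ_Suc [OF q0])
  ultimately show ?thesis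
    unfolding fin by (auto dest: LIMSEQ_unique)
qed

lemma theta_add_tau: "theta \<tau> (u + \<tau>) = - exp (- (of_real pi * \<i> * (2 * u + \<tau>))) * theta \<tau> u"
proof -
  define a where "a = exp (2 * of_real pi * \<i> * u)"
  \<comment> \<open>The square roots b of a and r of the nome turn the sine into (b - 1/b)/(2i). The
    sines at u + \<tau> and at u then contain exactly the factors \<open>1 - nm * a\<close> and
    \<open>1 - 1 / a\<close> of \<open>theta_product_shift\<close>.\<close>
  define b where "b = exp (of_real pi * \<i> * u)"
  define r where "r = exp (of_real pi * \<i> * \<tau>)"
  have nz: "b \<noteq> 0" "r \<noteq> 0" by (auto simp: b_def r_def)
  have ab: "a = b * b" "nm = r * r"
    using exp_add [of "of_real pi * \<i> * u" "of_real pi * \<i> * u"] exp_add [of "of_real pi * \<i> * \<tau>" "of_real pi * \<i> * \<tau>"]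
    by (simp_all add: a_def b_def r_def nome_def mult_ac)
  have e: "exp (- (of_real pi * \<i> * (2 * u + \<tau>))) = 1 / (b * b * r)"
    by (simp add: b_def r_def exp_minus inverse_eq_divide flip: exp_add) (simp add: algebra_simps)
  have s: "sin (of_real pi * u) = (b - 1 / b) / (2 * \<i>)"
    by (simp add: sin_exp_eq b_def exp_minus inverse_eq_divide mult_ac)
  have "exp (\<i> * (of_real pi * (u + \<tau>))) = b * r"
    by (simp add: b_def r_def algebra_simps flip: exp_add)
  then have s': "sin (of_real pi * (u + \<tau>)) = (b * r - 1 / (b * r)) / (2 * \<i>)"
    by (simp add: sin_exp_eq exp_minus inverse_eq_divide)
  have 1: "sin (of_real pi * (u + \<tau>)) = - (1 / (b * r)) / (2 * \<i>) * (1 - nm * a)"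
    using nz unfolding s' ab by (simp add: field_simps)
  have 2: "sin (of_real pi * u) = b / (2 * \<i>) * (1 - 1 / a)"
    using nz unfolding s ab by (simp add: field_simps)
  have "theta \<tau> (u + \<tau>) = \<i> * exp (of_real pi * \<i> * \<tau> / 4) * (- (1 / (b * r)) / (2 * \<i>))
     * (theta_product \<tau> (u + \<tau>) * (1 - nm * a))"
    unfolding theta_eq 1 by (simp only: ac_simps)
  also have "\<dots> = \<i> * exp (of_real pi * \<i> * \<tau> / 4) * (- (1 / (b * r)) / (2 * \<i>))
     * (theta_product \<tau> u * (1 - 1 / a))"
    unfolding a_def theta_product_shift ..
  also have "\<dots> = - (1 / (b * b * r)) * (\<i> * exp (of_real pi * \<i> * \<tau> / 4) * (b / (2 * \<i>) * (1 - 1 / a))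
     * theta_product \<tau> u)"
    using nz by (simp add: field_simps)
  finally show ?thesis
    unfolding e theta_eq [of \<tau> u] 2 .
qed

section \<open>Zeros of theta\<close>

lemma theta_product_0_nonzero: "theta_product \<tau> 0 \<noteq> 0"
  unfolding theta_product_def
proof (rule prodinf_nonzero [OF convergent_theta_factor])
  show "theta_factor \<tau> m 0 \<noteq> 0" for m
    using one_minus_nome_power [of m] by (simp add: theta_factor_exp)
qed

text \<open>Theta is sin(pi u) times a factor that does not vanish at 0, so its zero at 0 is simple.
  Translation by the periods later transfers this to every zero.\<close>

lemma deriv_theta_0: "deriv (theta \<tau>) 0 \<noteq> 0"
proof -
  define Q where "Q = (\<lambda>u. \<i> * exp (of_real pi * \<i> * \<tau> / 4) * theta_product \<tau> u)"
  have "Q holomorphic_on UNIV"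
    unfolding Q_def by (intro holomorphic_intros holomorphic_theta_product)
  then have Q: "(Q has_field_derivative deriv Q 0) (at 0)"
    using holomorphic_derivI by blast
  have "((\<lambda>u. sin (of_real pi * u) * Q u) has_field_derivative (cos (of_real pi * 0) * of_real pi * Q 0 + deriv Q 0 * sin (of_real pi * 0))) (at 0)"
    by (rule derivative_eq_intros Q refl | simp)+
  moreover have "theta \<tau> = (\<lambda>u. sin (of_real pi * u) * Q u)"
    by (auto simp: theta_eq Q_def)
  ultimately have "deriv (theta \<tau>) 0 = of_real pi * Q 0"
    by (simp add: DERIV_imp_deriv)
  then show ?thesis
    using theta_product_0_nonzero by (simp add: Q_def)
qed

definition lattice :: "complex set" where
  "lattice = {of_int m + of_int n * \<tau> |m n. True}"

lemma countable_lattice: "countable lattice"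
proof -
  have "lattice = (\<lambda>(m, n). of_int m + of_int n * \<tau>) ` (UNIV :: (int \<times> int) set)"
    by (auto simp: lattice_def)
  then show ?thesis by simp
qed

text \<open>A convergent infinite product vanishes only if one of its factors does. The sine yields
  the integers, and factor number m the points where e^(2 pi i u) is \<open>nm ^ Suc m\<close> or
  its inverse.\<close>

lemma theta_zero_imp_lattice:
  assumes "theta \<tau> u = 0"
  shows "u \<in> lattice"
proof -
  consider "sin (of_real pi * u) = 0" | m where "theta_factor \<tau> m u = 0"
    using assms prodinf_nonzero [OF convergent_theta_factor, of u] by (auto simp: theta_eq theta_product_def)
  then show ?thesis
  proof cases
    case 1
    then obtain n :: int where "of_real pi * u = of_real (of_int n * pi)"
      unfolding sin_eq_0 by (auto simp: mult.commute)
    then have "u = of_int n + of_int 0 * \<tau>" by simp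
    then show ?thesis unfolding lattice_def by blast
  next
    case (2 m)
    have e: "nm ^ Suc m = exp (2 * of_real pi * \<i> * (of_nat (Suc m) * \<tau>))"
      by (simp only: nome_def exp_of_nat_mult [symmetric] ac_simps)
    have "(1 - k * a) * (1 - k / a) = 0 \<Longrightarrow> k * a = 1 \<or> a = k" if "a \<noteq> 0" for k a :: complex
      using that unfolding mult_eq_0_iff by auto
    then have "nm ^ Suc m * exp (2 * of_real pi * \<i> * u) = 1 \<or> exp (2 * of_real pi * \<i> * u) = nm ^ Suc m"
      using 2 one_minus_nome_power [of m] unfolding theta_factor_exp by (metis exp_not_eq_zero mult_eq_0_iff)
    then consider "exp (2 * of_real pi * \<i> * (of_nat (Suc m) * \<tau> + u)) = exp 0"
      | "exp (2 * of_real pi * \<i> * u) = exp (2 * of_real pi * \<i> * (of_nat (Suc m) * \<tau>))"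
      unfolding e by (auto simp: ring_distribs exp_add)
    then obtain n k :: int where "2 * of_real pi * \<i> * u = 2 * of_real pi * \<i> * (of_int k * \<tau> + of_int n)"
    proof cases
      case 1
      then obtain n :: int where "2 * of_real pi * \<i> * (of_nat (Suc m) * \<tau> + u) = (of_int (2 * n) * pi) * \<i>"
        unfolding exp_eq by auto
      then show ?thesis
        by (intro that [of "- int (Suc m)" n]) (simp add: algebra_simps)
    next
      case 2
      then obtain n :: int where "2 * of_real pi * \<i> * u = 2 * of_real pi * \<i> * (of_nat (Suc m) * \<tau>) + (of_int (2 * n) * pi) * \<i>"
        unfolding exp_eq by auto
      then show ?thesis
        by (intro that [of "int (Suc m)" n]) (simp add: algebra_simps)
    qed
    then have "u = of_int n + of_int k * \<tau>" by simp
    then show ?thesis unfolding lattice_def by blast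
  qed
qed

end

text \<open>Where D vanishes, so does L, and the zero of D is simple; hence the singularity is
  removable, with the value given by l'Hospital's rule. Near such a point L/D is the quotient of the
  two difference quotients, which are entire by \<open>pole_lemma\<close>.\<close>

lemma removable_quotient:
  assumes L: "L holomorphic_on UNIV" and D: "D holomorphic_on UNIV"
    and zeros: "\<And>x. D x = 0 \<Longrightarrow> L x = 0 \<and> deriv D x \<noteq> 0"
  shows "(\<lambda>x. if D x = 0 then deriv L x / deriv D x else L x / D x) holomorphic_on UNIV"
    (is "?Q holomorphic_on UNIV")
proof -
  have "\<exists>S. open S \<and> a \<in> S \<and> ?Q holomorphic_on S" for a
  proof (cases "D a = 0")
    case False
    define S where "S = {x. D x \<noteq> 0}"
    have "open S"
      unfolding S_def using holomorphic_on_imp_continuous_on [OF D]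
      by (intro open_Collect_neq) (auto simp: continuous_on_const)
    moreover have "(\<lambda>x. L x / D x) holomorphic_on S"
      by (intro holomorphic_on_divide holomorphic_on_subset [OF L] holomorphic_on_subset [OF D]) (auto simp: S_def)
    then have "?Q holomorphic_on S"
      by (rule holomorphic_transform) (auto simp: S_def)
    ultimately show ?thesis
      using False by (auto simp: S_def)
  next
    case True
    define slope where "slope = (\<lambda>f x. if x = a then deriv f a else (f x - f a) / (x - a) :: complex)"
    have slope: "slope f holomorphic_on UNIV" if "f holomorphic_on UNIV" for f
      using pole_lemma [OF that, of a] by (simp add: slope_def [abs_def])
    define S where "S = {x. slope D x \<noteq> 0}"
    have "open S"
      unfolding S_def using holomorphic_on_imp_continuous_on [OF slope [OF D]]
      by (intro open_Collect_neq) (auto simp: continuous_on_const)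
    moreover have "(\<lambda>x. slope L x / slope D x) holomorphic_on S"
      by (intro holomorphic_on_divide holomorphic_on_subset [OF slope [OF L]] holomorphic_on_subset [OF slope [OF D]])
        (auto simp: S_def)
    then have "?Q holomorphic_on S"
      by (rule holomorphic_transform) (use True zeros [OF True] in \<open>auto simp: S_def slope_def\<close>)
    moreover have "a \<in> S"
      using zeros [OF True] by (simp add: S_def slope_def)
    ultimately show ?thesis by blast
  qed
  then show ?thesis
    unfolding holomorphic_on_def by (meson UNIV_I field_differentiable_within_open field_differentiable_at_within holomorphic_on_def)
qed

section \<open>The period lattice and quotients of functions with equal multipliers\<close>

context nome_disc
begin

text \<open>Stated for predicates rather than functions: vanishing of theta, simplicity of a zero
  and the value of a quotient are invariant under both periods, although the functions themselves
  acquire multipliers.\<close>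

lemma shift_lattice:
  assumes "\<And>x. P (x + 1) \<longleftrightarrow> P x" and "\<And>x. P (x + \<tau>) \<longleftrightarrow> P x" and "w \<in> lattice"
  shows "P (x + w) \<longleftrightarrow> P x"
proof -
  have int_shift: "R (x + of_int k * a) \<longleftrightarrow> R x" if "\<And>x. R (x + a) \<longleftrightarrow> R x" for R and a x :: complex and k
  proof (induction k)
    case (nonneg n)
    then show ?case
    proof (induction n)
      case (Suc n)
      have "x + of_int (int (Suc n)) * a = (x + of_int (int n) * a) + a"
        by (simp add: algebra_simps)
      then show ?case using Suc that by metis
    qed simp
  next
    case (neg n)
    have "R (x + of_int (- int n) * a) \<longleftrightarrow> R x" for n
    proof (induction n)
      case (Suc n)
      have "(x + of_int (- int (Suc n)) * a) + a = x + of_int (- int n) * a"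
        by (simp add: algebra_simps)
      then show ?case using Suc that by metis
    qed simp
    from this [of "Suc n"] show ?case by simp
  qed
  obtain m n where w: "w = of_int m + of_int n * \<tau>"
    using assms(3) by (auto simp: lattice_def)
  have "P (x + w) \<longleftrightarrow> P ((x + of_int m * 1) + of_int n * \<tau>)"
    by (simp add: w add.assoc)
  also have "\<dots> \<longleftrightarrow> P x"
    using int_shift [of P 1] int_shift [of P \<tau>] assms(1,2) by blast
  finally show ?thesis .
qed

lemma period_representative:
  obtains w s t where "w \<in> lattice" "x + w = of_real s + of_real t * \<tau>" "s \<in> {0..1}" "t \<in> {0..1}"
proof -
  define t where "t = Im x / Im \<tau>"
  define s where "s = Re x - t * Re \<tau>"
  have "x = of_real s + of_real t * \<tau>"
    using Im_pos by (simp add: complex_eq_iff s_def t_def)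
  then have "x + (of_int (- \<lfloor>s\<rfloor>) + of_int (- \<lfloor>t\<rfloor>) * \<tau>) = of_real (frac s) + of_real (frac t) * \<tau>"
    by (simp add: frac_def algebra_simps)
  moreover have "frac s \<in> {0..1}" "frac t \<in> {0..1}"
    using frac_lt_1 [THEN less_imp_le] by auto
  ultimately show ?thesis
    using that unfolding lattice_def by blast
qed

text \<open>Two entire functions with the same multipliers along both periods have an elliptic quotient,
  which is constant as soon as it has no poles.\<close>

lemma quotient_constant:
  assumes L: "L holomorphic_on UNIV" and D: "D holomorphic_on UNIV"
    and zeros: "\<And>x. D x = 0 \<Longrightarrow> L x = 0 \<and> deriv D x \<noteq> 0"
    and L1: "\<And>x. L (x + 1) = L x" and D1: "\<And>x. D (x + 1) = D x"
    and L\<tau>: "\<And>x. L (x + \<tau>) = E x * L x" and D\<tau>: "\<And>x. D (x + \<tau>) = E x * D x"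
    and E: "\<And>x. E x \<noteq> 0"
  obtains k where "\<And>x. L x = k * D x"
proof -
  define Q where "Q = (\<lambda>x. if D x = 0 then deriv L x / deriv D x else L x / D x)"
  have hol: "Q holomorphic_on UNIV"
    unfolding Q_def by (rule removable_quotient [OF L D zeros])
  define K where "K = (\<lambda>(s, t). of_real s + of_real t * \<tau>) ` ({0..1::real} \<times> {0..1::real})"
  have "compact K"
    unfolding K_def case_prod_unfold by (intro compact_continuous_image continuous_intros compact_Times compact_Icc)
  then have "bounded (Q ` K)"
    using compact_imp_bounded compact_continuous_image holomorphic_on_imp_continuous_on [OF hol]
    by (metis continuous_on_subset subset_UNIV)
  then obtain B where B: "norm (Q x) \<le> B" if "x \<in> K" for x
    unfolding bounded_iff by blast
  \<comment> \<open>The invariant predicate says that D does not vanish and L/D has a given value,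
    so this bound covers only points off the zeros of D. It reaches the zeros by continuity of Q,
    since they are isolated.\<close>
  have generic_bound: "norm (Q x) \<le> B" if "D x \<noteq> 0" for x
  proof -
    obtain w s t where w: "w \<in> lattice" "x + w = of_real s + of_real t * \<tau>" "s \<in> {0..1}" "t \<in> {0..1}"
      by (rule period_representative)
    have "D (y + 1) \<noteq> 0 \<and> L (y + 1) / D (y + 1) = L x / D x \<longleftrightarrow> D y \<noteq> 0 \<and> L y / D y = L x / D x"
      "D (y + \<tau>) \<noteq> 0 \<and> L (y + \<tau>) / D (y + \<tau>) = L x / D x \<longleftrightarrow> D y \<noteq> 0 \<and> L y / D y = L x / D x" for y
      using E by (auto simp: L1 D1 L\<tau> D\<tau>)
    from shift_lattice [OF this w(1)] that have "Q (x + w) = Q x"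
      by (auto simp: Q_def)
    moreover have "x + w \<in> K"
      using w unfolding K_def by (auto intro!: image_eqI [of _ _ "(s, t)"])
    ultimately show ?thesis
      using B by metis
  qed
  have bound: "norm (Q a) \<le> B" for a
  proof (cases "D a = 0")
    case True
    have "(D has_field_derivative deriv D a) (at a)"
      using D holomorphic_derivI by blast
    then have "((\<lambda>x. D x / (x - a)) \<longlongrightarrow> deriv D a) (at a)"
      using True by (simp add: has_field_derivative_iff)
    then have "eventually (\<lambda>x. D x / (x - a) \<noteq> 0) (at a)"
      using zeros [OF True] by (intro tendsto_imp_eventually_ne) auto
    then have "eventually (\<lambda>x. norm (Q x) \<le> B) (at a)"
      by (rule eventually_mono) (auto intro: generic_bound)
    moreover have "(Q \<longlongrightarrow> Q a) (at a)"
      using holomorphic_on_imp_continuous_on [OF hol] by (simp add: continuous_on_eq_continuous_at isCont_def)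
    ultimately show ?thesis
      using tendsto_upperbound [OF tendsto_norm] by (metis at_neq_bot)
  qed (rule generic_bound)
  then have "bounded (range Q)"
    by (auto simp: bounded_iff)
  then obtain k where k: "Q x = k" for x
    using Liouville_theorem [OF hol] by (auto simp: constant_on_def)
  have "L x = k * D x" for x
    using k [of x] zeros [of x] by (cases "D x = 0") (auto simp: Q_def)
  then show ?thesis by (rule that)
qed

section \<open>Simple zeros and the three-term relation\<close>

lemma theta_zero_iff_shift: "w \<in> lattice \<Longrightarrow> theta \<tau> (x + w) = 0 \<longleftrightarrow> theta \<tau> x = 0"
  by (rule shift_lattice) (auto simp: theta_add_1 theta_add_tau)

lemma theta_has_derivative: "(theta \<tau> has_field_derivative deriv (theta \<tau>) x) (at x)"
  using holomorphic_theta holomorphic_derivI by blast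

text \<open>Being a simple zero is invariant under both periods: when the relation for \<tau> is
  differentiated, the derivative of the multiplier comes with a factor theta, which vanishes at a
  zero. All zeros lie in the lattice, and the one at 0 is simple.\<close>

lemma deriv_theta_nonzero:
  assumes "theta \<tau> x = 0"
  shows "deriv (theta \<tau>) x \<noteq> 0"
proof -
  let ?P = "\<lambda>x. theta \<tau> x = 0 \<and> deriv (theta \<tau>) x \<noteq> 0"
  have "deriv (theta \<tau>) (x + 1) = - deriv (theta \<tau>) x" for x
  proof -
    have "((\<lambda>x. theta \<tau> (x + 1)) has_field_derivative deriv (theta \<tau>) (x + 1)) (at x)"
      using DERIV_shift theta_has_derivative by blast
    moreover have "((\<lambda>x. theta \<tau> (x + 1)) has_field_derivative - deriv (theta \<tau>) x) (at x)"
      unfolding theta_add_1 by (intro DERIV_minus theta_has_derivative)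
    ultimately show ?thesis by (rule DERIV_unique)
  qed
  then have 1: "?P (x + 1) \<longleftrightarrow> ?P x" for x
    by (simp add: theta_add_1)
  have 2: "?P (x + \<tau>) \<longleftrightarrow> ?P x" for x
  proof -
    define g where "g = (\<lambda>x. - exp (- (of_real pi * \<i> * (2 * x + \<tau>))))"
    have g: "(g has_field_derivative (2 * of_real pi * \<i> * exp (- (of_real pi * \<i> * (2 * x + \<tau>))))) (at x)" for x
      unfolding g_def by (rule derivative_eq_intros refl | simp)+
    have "((\<lambda>x. theta \<tau> (x + \<tau>)) has_field_derivative deriv (theta \<tau>) (x + \<tau>)) (at x)"
      using DERIV_shift theta_has_derivative by blast
    moreover have "((\<lambda>x. g x * theta \<tau> x) has_field_derivative
        (2 * of_real pi * \<i> * exp (- (of_real pi * \<i> * (2 * x + \<tau>))) * theta \<tau> x + deriv (theta \<tau>) x * g x)) (at x)"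
      by (intro DERIV_mult g theta_has_derivative)
    ultimately have "deriv (theta \<tau>) (x + \<tau>) = 2 * of_real pi * \<i> * exp (- (of_real pi * \<i> * (2 * x + \<tau>))) * theta \<tau> x + deriv (theta \<tau>) x * g x"
      unfolding theta_add_tau g_def by (rule DERIV_unique)
    then show ?thesis
      by (auto simp: theta_add_tau g_def)
  qed
  have "?P (0 + x) \<longleftrightarrow> ?P 0"
    using 1 2 theta_zero_imp_lattice [OF assms] by (rule shift_lattice)
  then show ?thesis
    using deriv_theta_0 by simp
qed

text \<open>As functions of x, the factor D = \<theta>(x + y) \<theta>(x - y) of the first term and
  the sum L of the other two terms have the same multipliers. D vanishes only at y and -y modulo the
  lattice, with simple zeros because \<theta>(2y) is nonzero, and L vanishes there too. So L/D is
  constant; its value is found at x = z, where one term of L is zero.\<close>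

lemma three_term_generic:
  assumes "theta \<tau> (2 * y) \<noteq> 0" "theta \<tau> (z + y) \<noteq> 0" "theta \<tau> (z - y) \<noteq> 0"
  shows "theta \<tau> (x + y) * theta \<tau> (x - y) * theta \<tau> (z + w) * theta \<tau> (z - w)
    + theta \<tau> (x + z) * theta \<tau> (x - z) * theta \<tau> (w + y) * theta \<tau> (w - y)
    + theta \<tau> (x + w) * theta \<tau> (x - w) * theta \<tau> (y + z) * theta \<tau> (y - z) = 0"
proof -
  define D where "D = (\<lambda>x. theta \<tau> (x + y) * theta \<tau> (x - y))"
  define L where "L = (\<lambda>x. theta \<tau> (x + z) * theta \<tau> (x - z) * (theta \<tau> (w + y) * theta \<tau> (w - y))
    + theta \<tau> (x + w) * theta \<tau> (x - w) * (theta \<tau> (y + z) * theta \<tau> (y - z)))"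
  define E where "E = (\<lambda>x. exp (- (2 * (of_real pi * \<i> * (2 * x + \<tau>)))))"
  have shift1: "theta \<tau> (x + 1 + a) * theta \<tau> (x + 1 - a) = theta \<tau> (x + a) * theta \<tau> (x - a)" for x a
    using theta_add_1 [of \<tau> "x + a"] theta_add_1 [of \<tau> "x - a"] by (simp add: algebra_simps)
  have shift\<tau>: "theta \<tau> (x + \<tau> + a) * theta \<tau> (x + \<tau> - a) = E x * (theta \<tau> (x + a) * theta \<tau> (x - a))" for x a
  proof -
    have "exp (- (of_real pi * \<i> * (2 * (x + a) + \<tau>))) * exp (- (of_real pi * \<i> * (2 * (x - a) + \<tau>))) = E x"
      by (simp add: E_def algebra_simps flip: exp_add)
    moreover have e: "x + \<tau> + a = x + a + \<tau>" "x + \<tau> - a = x - a + \<tau>" by auto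
    ultimately show ?thesis
      unfolding e theta_add_tau by (metis (no_types, lifting) minus_mult_minus mult.assoc mult.left_commute mult_minus_left)
  qed
  have sym: "theta \<tau> (- y + a) * theta \<tau> (- y - a) = theta \<tau> (y + a) * theta \<tau> (y - a)" for a
    using theta_minus [of \<tau> "y - a"] theta_minus [of \<tau> "y + a"] by simp
  have anti: "theta \<tau> (w + y) * theta \<tau> (w - y) = - (theta \<tau> (y + w) * theta \<tau> (y - w))"
    using theta_minus_commute [of \<tau> w y] by (simp add: add.commute)
  have L0: "L y = 0" "L (- y) = 0"
    by (simp_all only: L_def sym anti) (simp_all add: mult_ac)
  have L1: "L (x + 1) = L x" and D1: "D (x + 1) = D x" for x
    unfolding L_def D_def by (simp_all add: shift1)
  have L\<tau>: "L (x + \<tau>) = E x * L x" and D\<tau>: "D (x + \<tau>) = E x * D x" for x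
    unfolding L_def D_def by (simp_all only: shift\<tau>) (simp_all add: algebra_simps)
  have L_lattice: "L (x + v) = 0 \<longleftrightarrow> L x = 0" if "v \<in> lattice" for v x
    by (rule shift_lattice [OF _ _ that]) (auto simp: L1 L\<tau> E_def)
  have zeros: "L x = 0 \<and> deriv D x \<noteq> 0" if D0: "D x = 0" for x
  proof -
    have "((\<lambda>x. theta \<tau> (x + a)) has_field_derivative deriv (theta \<tau>) (x + a)) (at x)" for a
      using DERIV_shift theta_has_derivative by blast
    from this [of y] this [of "- y"]
    have "(D has_field_derivative deriv (theta \<tau>) (x + y) * theta \<tau> (x - y) + deriv (theta \<tau>) (x - y) * theta \<tau> (x + y)) (at x)"
      unfolding D_def by (intro DERIV_mult) simp_all
    then have deriv: "deriv D x = deriv (theta \<tau>) (x + y) * theta \<tau> (x - y) + deriv (theta \<tau>) (x - y) * theta \<tau> (x + y)"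
      by (rule DERIV_imp_deriv)
    consider "theta \<tau> (x + y) = 0" | "theta \<tau> (x - y) = 0"
      using D0 by (auto simp: D_def)
    then show ?thesis
    proof cases
      case 1
      have "theta \<tau> (- (2 * y) + (x + y)) = 0 \<longleftrightarrow> theta \<tau> (- (2 * y)) = 0"
        by (intro theta_zero_iff_shift theta_zero_imp_lattice 1)
      then have "theta \<tau> (x - y) \<noteq> 0"
        using assms(1) by (simp add: algebra_simps)
      moreover have "L (- y + (x + y)) = 0"
        using L_lattice L0 theta_zero_imp_lattice [OF 1] by blast
      ultimately show ?thesis
        using deriv deriv_theta_nonzero [OF 1] 1 by simp
    next
      case 2
      have "theta \<tau> (2 * y + (x - y)) = 0 \<longleftrightarrow> theta \<tau> (2 * y) = 0"
        by (intro theta_zero_iff_shift theta_zero_imp_lattice 2)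
      then have "theta \<tau> (x + y) \<noteq> 0"
        using assms(1) by (simp add: algebra_simps)
      moreover have "L (y + (x - y)) = 0"
        using L_lattice L0 theta_zero_imp_lattice [OF 2] by blast
      ultimately show ?thesis
        using deriv deriv_theta_nonzero [OF 2] 2 by simp
    qed
  qed
  have "L holomorphic_on UNIV" "D holomorphic_on UNIV"
    unfolding L_def D_def by (intro holomorphic_intros)+
  then obtain k where k: "L x = k * D x" for x
    using quotient_constant [OF _ _ zeros L1 D1 L\<tau> D\<tau>] by (metis E_def exp_not_eq_zero)
  have "theta \<tau> (y + z) * theta \<tau> (y - z) = - (theta \<tau> (z + y) * theta \<tau> (z - y))"
    using theta_minus_commute [of \<tau> y z] by (simp add: add.commute)
  then have "D z * (k + theta \<tau> (z + w) * theta \<tau> (z - w)) = 0"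
    using k [of z] by (simp add: L_def D_def algebra_simps) (metis ab_left_minus)
  moreover have "D z \<noteq> 0"
    using assms by (simp add: D_def)
  ultimately have "k = - (theta \<tau> (z + w) * theta \<tau> (z - w))"
    by (simp add: add_eq_0_iff2)
  then have "L x + theta \<tau> (z + w) * theta \<tau> (z - w) * D x = 0"
    using k [of x] by simp
  then show ?thesis
    by (simp add: L_def D_def mult_ac add_ac)
qed

text \<open>The left-hand side is continuous in y. If it were nonzero at some point, it would be
  nonzero on a disc, whereas the excluded values of y come from halves, translates and reflections
  of lattice points and are countable.\<close>

lemma three_term:
  "theta \<tau> (x + y) * theta \<tau> (x - y) * theta \<tau> (z + w) * theta \<tau> (z - w)
    + theta \<tau> (x + z) * theta \<tau> (x - z) * theta \<tau> (w + y) * theta \<tau> (w - y)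
    + theta \<tau> (x + w) * theta \<tau> (x - w) * theta \<tau> (y + z) * theta \<tau> (y - z) = 0"
    (is "?N y = 0")
proof (rule ccontr)
  assume "?N y \<noteq> 0"
  have "open {y. ?N y \<noteq> 0}"
    by (intro open_Collect_neq continuous_intros)
  then obtain r where r: "r > 0" "ball y r \<subseteq> {y. ?N y \<noteq> 0}"
    using \<open>?N y \<noteq> 0\<close> open_contains_ball by blast
  have "{y. ?N y \<noteq> 0} \<subseteq> (\<lambda>v. v / 2) ` lattice \<union> (\<lambda>v. v - z) ` lattice \<union> (\<lambda>v. z - v) ` lattice"
  proof
    fix y assume "y \<in> {y. ?N y \<noteq> 0}"
    then have "theta \<tau> (2 * y) = 0 \<or> theta \<tau> (z + y) = 0 \<or> theta \<tau> (z - y) = 0"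
      using three_term_generic by blast
    then show "y \<in> (\<lambda>v. v / 2) ` lattice \<union> (\<lambda>v. v - z) ` lattice \<union> (\<lambda>v. z - v) ` lattice"
      by (auto dest!: theta_zero_imp_lattice intro: image_eqI [of _ _ "2 * y"] image_eqI [of _ _ "z + y"] image_eqI [of _ _ "z - y"])
  qed
  moreover have "countable ((\<lambda>v. v / 2) ` lattice \<union> (\<lambda>v. v - z) ` lattice \<union> (\<lambda>v. z - v) ` lattice)"
    by (intro countable_Un countable_image countable_lattice)
  ultimately have "countable (ball y r)"
    using r(2) countable_subset by (meson subset_trans)
  then show False
    using uncountable_ball r(1) by blast
qed

text \<open>A linear change of variables that makes the arguments of the first product free and
  expresses all others through half their sum s. With s as a separate argument no halves occur, and
  an instance is five linear forms in u, x, y, h.\<close>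

lemma three_term_half_sum:
  assumes "2 * s = a + b + c + d"
  shows "theta \<tau> a * theta \<tau> b * theta \<tau> c * theta \<tau> d
    + theta \<tau> s * theta \<tau> (a + b - s) * theta \<tau> (a + c - s) * theta \<tau> (b + c - s)
    - theta \<tau> (s - a) * theta \<tau> (s - b) * theta \<tau> (s - c) * theta \<tau> (s - d) = 0"
proof -
  define x y z w where "x = (a + b) / 2" and "y = (a - b) / 2" and "z = (c + d) / 2" and "w = (c - d) / 2"
  have s: "s = (a + b + c + d) / 2"
    using assms by (simp add: field_simps)
  have "x + y = a" "x - y = b" "z + w = c" "z - w = d" "x + z = s" "x - z = a + b - s"
    "w + y = a + c - s" "w - y = - (a + d - s)" "x + w = s - d" "x - w = s - c" "y + z = s - b" "y - z = - (s - a)"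
    "a + d - s = - (b + c - s)"
    by (simp_all add: x_def y_def z_def w_def s field_simps)
  then show ?thesis
    using three_term [of x y z w] theta_minus_commute [of \<tau> a s] by (simp add: mult_ac)
qed

end

locale generic_face = nome_disc \<tau> + C2_face \<tau> h for \<tau> h :: complex +
  assumes h_nonzero: "h \<noteq> 0"
    and theta_of_int_h: "\<And>m::int. m \<noteq> 0 \<Longrightarrow> theta \<tau> (of_int m * h) \<noteq> 0"
begin

lemma theta_eq_minus: "a = - b \<Longrightarrow> \<theta> a = - \<theta> b"
  by simp

lemma theta_h_nonzero: "\<theta> h \<noteq> 0" "\<theta> (2 * h) \<noteq> 0" "\<theta> (3 * h) \<noteq> 0"
   "\<theta> (4 * h) \<noteq> 0" "\<theta> (5 * h) \<noteq> 0" "\<theta> (6 * h) \<noteq> 0"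
  using theta_of_int_h [of 1] theta_of_int_h [of 2] theta_of_int_h [of 3] theta_of_int_h [of 4]
    theta_of_int_h [of 5] theta_of_int_h [of 6] by simp_all

text \<open>These rules collect a side into one fraction, after which \<open>frac_eq_eq\<close>
  turns an equation of quotients into a polynomial identity.\<close>

lemmas single_fraction = times_divide_times_eq times_divide_eq_right times_divide_eq_left
  divide_divide_eq_left minus_divide_left

subsection \<open>Boltzmann weights in coordinates\<close>

text \<open>Entries for orthogonal p, q with x = \<lambda>_p and y = \<lambda>_q. The steps p, p
  receive \<open>wpp\<close>; p, q stay with \<open>wpq\<close> at d = x - y and become q, p with
  \<open>wqp\<close> at d = y - x. The steps p, -p go to themselves with \<open>wdiag\<close>, to
  -p, p with \<open>wneg\<close> and to q, -q with \<open>wex\<close>, where a factor \<theta>(x + y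
  + h) has been cancelled.\<close>

definition wpp :: "complex \<Rightarrow> complex" where
  "wpp u = \<theta> (c - u) * \<theta> (u + h) / (\<theta> c * \<theta> h)"

definition wpq :: "complex \<Rightarrow> complex \<Rightarrow> complex" where
  "wpq d u = \<theta> (c - u) * \<theta> (d - u) / (\<theta> c * \<theta> d)"

definition wqp :: "complex \<Rightarrow> complex \<Rightarrow> complex" where
  "wqp d u = \<theta> (c - u) * \<theta> u * \<theta> (d + h) / (\<theta> c * \<theta> h * \<theta> d)"

definition wex :: "complex \<Rightarrow> complex \<Rightarrow> complex \<Rightarrow> complex" where
  "wex x y u = - \<theta> u * \<theta> (x + y + h + c - u) * \<theta> (2 * y + 2 * h) * \<theta> (y - x + h)
     / (\<theta> c * \<theta> (2 * x) * \<theta> (x + y) * \<theta> (x - y))"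

definition wneg :: "complex \<Rightarrow> complex \<Rightarrow> complex \<Rightarrow> complex" where
  "wneg x y u = - \<theta> u * \<theta> (h + c - u) * \<theta> (2 * h - 2 * x) * \<theta> (y - x + h) * \<theta> (h - x - y)
     / (\<theta> c * \<theta> h * \<theta> (2 * x) * \<theta> (x + y) * \<theta> (x - y))"

definition wdiag :: "complex \<Rightarrow> complex \<Rightarrow> complex \<Rightarrow> complex" where
  "wdiag x y u = (\<theta> (c - u) * \<theta> (2 * x + h - u) * \<theta> (2 * x) * \<theta> (x + y) * \<theta> (x - y)
       - \<theta> u * \<theta> (2 * x + h + c - u) * \<theta> (2 * x + 2 * h) * \<theta> (x + y + h) * \<theta> (x - y + h))
     / (\<theta> c * \<theta> (2 * x + h) * \<theta> (2 * x) * \<theta> (x + y) * \<theta> (x - y))"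

subsection \<open>Fused weights in coordinates\<close>

text \<open>The u-dependent factor common to the fused weights of type (1,2). \<open>F u\<close> is
  \<open>gg u\<close> times \<theta>(u + 2h), and \<open>G u\<close> is
  \<open>gg u * gg (u - h)\<close> times \<theta>(u) \<theta>(u + 3h).\<close>

definition gg :: "complex \<Rightarrow> complex" where
  "gg u = \<theta> u * \<theta> (u + 2 * h) * \<theta> (u + 4 * h) / (\<theta> c ^ 2 * \<theta> h ^ 2)"

text \<open>Fused weights whose upper row starts with p. The letters A, B, C say that the second
  upper step is p + q, -p + q or 0; the endings 0, p, m say that the first lower step is 0, p + q or
  -p + q, and in case A it is p + q. The lower step p - q in case C is obtained by negating
  y.\<close>

definition WA :: "complex \<Rightarrow> complex" where
  "WA u = gg u * \<theta> (u + 3 * h)"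

definition WB0 :: "complex \<Rightarrow> complex \<Rightarrow> complex \<Rightarrow> complex" where
  "WB0 x y u = - gg u * \<theta> h * \<theta> (x + y - h) * \<theta> (u + y - x + 2 * h) / (\<theta> (x - y) * \<theta> (2 * x))"

definition WBp :: "complex \<Rightarrow> complex \<Rightarrow> complex \<Rightarrow> complex" where
  "WBp x y u = gg u * \<theta> (2 * h) * \<theta> (x + y + 2 * h) * \<theta> (u + h - 2 * x) / (\<theta> (x - y) * \<theta> (2 * x))"

definition WBm :: "complex \<Rightarrow> complex \<Rightarrow> complex \<Rightarrow> complex" where
  "WBm x y u = gg u * \<theta> (u + h) * \<theta> (x - y - 2 * h) * \<theta> (2 * x - 2 * h) / (\<theta> (x - y) * \<theta> (2 * x))"

definition WC0 :: "complex \<Rightarrow> complex \<Rightarrow> complex \<Rightarrow> complex" where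
  "WC0 x y u = gg u * \<theta> (u + 2 * h) * \<theta> (x + y - h) * \<theta> (x - y - h) / (\<theta> (x + y) * \<theta> (x - y))"

definition WCp :: "complex \<Rightarrow> complex \<Rightarrow> complex \<Rightarrow> complex" where
  "WCp x y u = gg u * \<theta> (2 * h) * \<theta> (2 * y + 2 * h) * \<theta> (u + h - x - y) / (\<theta> (x + y) * \<theta> (x - y))"

text \<open>For \<nu> = l + hat p + hat q the fused operator sends
  \<open>f l \<nu> \<odot> f \<nu> \<nu>\<close> to \<open>V0\<close> times
  \<open>f l l \<odot> f l \<nu>\<close> plus \<open>V1\<close> times itself. \<open>VQ\<close> is
  the G of the theorem, and \<open>V3\<close> is the part without \<lambda> in the weight of
  \<open>f l l \<odot> f l l\<close> on itself.\<close>

definition V0 :: "complex \<Rightarrow> complex \<Rightarrow> complex \<Rightarrow> complex" where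
  "V0 x y u = gg u * gg (u - h) * \<theta> u * \<theta> (u + 3 * h) * \<theta> (x + y - h) / \<theta> (x + y + h)"

definition V1 :: "complex \<Rightarrow> complex \<Rightarrow> complex \<Rightarrow> complex" where
  "V1 x y u = - gg u * gg (u - h) * \<theta> (2 * h) * \<theta> (u - x - y - h) * \<theta> (u + 3 * h) / \<theta> (x + y + h)"

definition V3 :: "complex \<Rightarrow> complex" where
  "V3 u = gg u * gg (u - h) * \<theta> (3 * h) * \<theta> (u + h) * \<theta> (u + 2 * h) / \<theta> h"

definition VQ :: "complex \<Rightarrow> complex" where
  "VQ u = gg u * gg (u - h) * \<theta> u * \<theta> (u + 3 * h)"

text \<open>The \<lambda>-dependence of the fixed weight in the form in which
  \<open>zero_step_0\<close> produces it. The sum \<open>RR x y + RR x (- y)\<close> is not visibly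
  symmetric in x and y; \<open>sum_TT\<close> shows that it is.\<close>

definition RR :: "complex \<Rightarrow> complex \<Rightarrow> complex" where
  "RR x y = \<theta> (2 * y + 2 * h) * \<theta> (x - y + h) * \<theta> (x + y - h)
     / (\<theta> (2 * y) * \<theta> (x - y - h) * \<theta> (x + y + h))"

text \<open>\<open>TT\<close> is the summand of the constant term of \<open>Mt2\<close> for one
  choice of signs; \<open>AA\<close> and \<open>BB\<close> are the shift coefficients of
  \<open>Mt1\<close> and \<open>Mt2\<close>.\<close>

definition TT :: "complex \<Rightarrow> complex \<Rightarrow> complex" where
  "TT x y = \<theta> (2 * h) * \<theta> (2 * x + 2 * h) * \<theta> (2 * y + 2 * h) * \<theta> (x + y - 5 * h) * \<theta> (x + y + 2 * h)
     / (\<theta> (6 * h) * \<theta> (2 * x) * \<theta> (2 * y) * \<theta> (x + y + h) * \<theta> (x + y))"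

definition AA :: "complex \<Rightarrow> complex \<Rightarrow> complex" where
  "AA x y = \<theta> (x + y - h) * \<theta> (x - y - h) / (\<theta> (x + y) * \<theta> (x - y))"

definition BB :: "complex \<Rightarrow> complex \<Rightarrow> complex" where
  "BB x y = \<theta> (x + y - h) / \<theta> (x + y + h)"

definition K0 :: complex where
  "K0 = \<theta> (4 * h) * \<theta> (5 * h) / (\<theta> h * \<theta> (6 * h))"

text \<open>Genericity in coordinates. Admitting all integer multiples of h makes it stable under
  the shifts caused by steps, besides sign changes and the exchange of x and y.\<close>

definition generic_pair :: "complex \<Rightarrow> complex \<Rightarrow> bool" where
  "generic_pair x y \<longleftrightarrow> (\<forall>k::int. \<theta> (x + y + of_int k * h) \<noteq> 0 \<and> \<theta> (x - y + of_int k * h) \<noteq> 0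
     \<and> \<theta> (2 * x + of_int k * h) \<noteq> 0 \<and> \<theta> (2 * y + of_int k * h) \<noteq> 0)"

lemma generic_pairD:
  assumes "generic_pair x y"
  shows "\<theta> (x + y) \<noteq> 0" "\<theta> (x + y + h) \<noteq> 0" "\<theta> (x + y + 2 * h) \<noteq> 0" "\<theta> (x + y - h) \<noteq> 0" "\<theta> (x + y - 2 * h) \<noteq> 0"
    "\<theta> (x - y) \<noteq> 0" "\<theta> (x - y + h) \<noteq> 0" "\<theta> (x - y + 2 * h) \<noteq> 0" "\<theta> (x - y - h) \<noteq> 0" "\<theta> (x - y - 2 * h) \<noteq> 0"
    "\<theta> (2 * x) \<noteq> 0" "\<theta> (2 * x + h) \<noteq> 0" "\<theta> (2 * x + 2 * h) \<noteq> 0" "\<theta> (2 * x + 3 * h) \<noteq> 0" "\<theta> (2 * x - h) \<noteq> 0" "\<theta> (2 * x - 2 * h) \<noteq> 0"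
    "\<theta> (2 * y) \<noteq> 0" "\<theta> (2 * y + h) \<noteq> 0" "\<theta> (2 * y + 2 * h) \<noteq> 0" "\<theta> (2 * y + 3 * h) \<noteq> 0" "\<theta> (2 * y - h) \<noteq> 0" "\<theta> (2 * y - 2 * h) \<noteq> 0"
proof -
  note g = assms [unfolded generic_pair_def, rule_format]
  show "\<theta> (x + y) \<noteq> 0" "\<theta> (x + y + h) \<noteq> 0" "\<theta> (x + y + 2 * h) \<noteq> 0" "\<theta> (x + y - h) \<noteq> 0" "\<theta> (x + y - 2 * h) \<noteq> 0"
    "\<theta> (x - y) \<noteq> 0" "\<theta> (x - y + h) \<noteq> 0" "\<theta> (x - y + 2 * h) \<noteq> 0" "\<theta> (x - y - h) \<noteq> 0" "\<theta> (x - y - 2 * h) \<noteq> 0"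
    "\<theta> (2 * x) \<noteq> 0" "\<theta> (2 * x + h) \<noteq> 0" "\<theta> (2 * x + 2 * h) \<noteq> 0" "\<theta> (2 * x + 3 * h) \<noteq> 0" "\<theta> (2 * x - h) \<noteq> 0" "\<theta> (2 * x - 2 * h) \<noteq> 0"
    "\<theta> (2 * y) \<noteq> 0" "\<theta> (2 * y + h) \<noteq> 0" "\<theta> (2 * y + 2 * h) \<noteq> 0" "\<theta> (2 * y + 3 * h) \<noteq> 0" "\<theta> (2 * y - h) \<noteq> 0" "\<theta> (2 * y - 2 * h) \<noteq> 0"
    using g [of 0] g [of 1] g [of 2] g [of 3] g [of "- 1"] g [of "- 2"] by simp_all
qed

subsection \<open>Theta identities\<close>

context
  fixes x y u :: complex
  assumes gen: "generic_pair x y"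
begin

lemmas theta_nonzero = generic_pairD [OF gen] theta_h_nonzero

text \<open>The theta values occurring in the identities below. In their names, \<open>D, S, X, Y\<close> stand for
  $x - y$, $x + y$, $2x$, $2y$, respectively; in names without these letters a small \<open>x\<close> or \<open>y\<close>
  is added and a capital one subtracted. The trailing number is the multiple of \<open>h\<close>, with \<open>m\<close> for a minus sign.\<close>

abbreviation (input) "tD0 \<equiv> \<theta> (x - y)"
abbreviation (input) "tD1 \<equiv> \<theta> (x - y + h)"
abbreviation (input) "tD2 \<equiv> \<theta> (x - y + 2 * h)"
abbreviation (input) "tD3 \<equiv> \<theta> (x - y + 3 * h)"
abbreviation (input) "tD4 \<equiv> \<theta> (x - y + 4 * h)"
abbreviation (input) "tD5 \<equiv> \<theta> (x - y + 5 * h)"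
abbreviation (input) "tDm1 \<equiv> \<theta> (x - y - h)"
abbreviation (input) "tDm2 \<equiv> \<theta> (x - y - 2 * h)"
abbreviation (input) "tDm4 \<equiv> \<theta> (x - y - 4 * h)"
abbreviation (input) "tDm5 \<equiv> \<theta> (x - y - 5 * h)"
abbreviation (input) "tH1 \<equiv> \<theta> h"
abbreviation (input) "tH2 \<equiv> \<theta> (2 * h)"
abbreviation (input) "tH3 \<equiv> \<theta> (3 * h)"
abbreviation (input) "tH4 \<equiv> \<theta> (4 * h)"
abbreviation (input) "tH5 \<equiv> \<theta> (5 * h)"
abbreviation (input) "tH6 \<equiv> \<theta> (6 * h)"
abbreviation (input) "tS0 \<equiv> \<theta> (x + y)"
abbreviation (input) "tS1 \<equiv> \<theta> (x + y + h)"
abbreviation (input) "tS2 \<equiv> \<theta> (x + y + 2 * h)"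
abbreviation (input) "tS3 \<equiv> \<theta> (x + y + 3 * h)"
abbreviation (input) "tS4 \<equiv> \<theta> (x + y + 4 * h)"
abbreviation (input) "tS5 \<equiv> \<theta> (x + y + 5 * h)"
abbreviation (input) "tSm1 \<equiv> \<theta> (x + y - h)"
abbreviation (input) "tSm2 \<equiv> \<theta> (x + y - 2 * h)"
abbreviation (input) "tSm4 \<equiv> \<theta> (x + y - 4 * h)"
abbreviation (input) "tSm5 \<equiv> \<theta> (x + y - 5 * h)"
abbreviation (input) "tX0 \<equiv> \<theta> (2 * x)"
abbreviation (input) "tX1 \<equiv> \<theta> (2 * x + h)"
abbreviation (input) "tX2 \<equiv> \<theta> (2 * x + 2 * h)"
abbreviation (input) "tX3 \<equiv> \<theta> (2 * x + 3 * h)"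
abbreviation (input) "tX4 \<equiv> \<theta> (2 * x + 4 * h)"
abbreviation (input) "tX5 \<equiv> \<theta> (2 * x + 5 * h)"
abbreviation (input) "tXm1 \<equiv> \<theta> (2 * x - h)"
abbreviation (input) "tXm2 \<equiv> \<theta> (2 * x - 2 * h)"
abbreviation (input) "tXm3 \<equiv> \<theta> (2 * x - 3 * h)"
abbreviation (input) "tY0 \<equiv> \<theta> (2 * y)"
abbreviation (input) "tY1 \<equiv> \<theta> (2 * y + h)"
abbreviation (input) "tY2 \<equiv> \<theta> (2 * y + 2 * h)"
abbreviation (input) "tY3 \<equiv> \<theta> (2 * y + 3 * h)"
abbreviation (input) "tY4 \<equiv> \<theta> (2 * y + 4 * h)"
abbreviation (input) "tYm1 \<equiv> \<theta> (2 * y - h)"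
abbreviation (input) "tYm2 \<equiv> \<theta> (2 * y - 2 * h)"
abbreviation (input) "txxYY2 \<equiv> \<theta> (2 * x - 2 * y + 2 * h)"
abbreviation (input) "txxxY1 \<equiv> \<theta> (3 * x - y + h)"
abbreviation (input) "txxyy1 \<equiv> \<theta> (2 * x + 2 * y + h)"
abbreviation (input) "txxyy2 \<equiv> \<theta> (2 * x + 2 * y + 2 * h)"
abbreviation (input) "tu0 \<equiv> \<theta> u"
abbreviation (input) "tu1 \<equiv> \<theta> (u + h)"
abbreviation (input) "tu2 \<equiv> \<theta> (u + 2 * h)"
abbreviation (input) "tu3 \<equiv> \<theta> (u + 3 * h)"
abbreviation (input) "tu4 \<equiv> \<theta> (u + 4 * h)"
abbreviation (input) "tuXX0 \<equiv> \<theta> (u - 2 * x)"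
abbreviation (input) "tuXX1 \<equiv> \<theta> (u - 2 * x + h)"
abbreviation (input) "tuXX2 \<equiv> \<theta> (u - 2 * x + 2 * h)"
abbreviation (input) "tuXX3 \<equiv> \<theta> (u - 2 * x + 3 * h)"
abbreviation (input) "tuXXm1 \<equiv> \<theta> (u - 2 * x - h)"
abbreviation (input) "tuXXm2 \<equiv> \<theta> (u - 2 * x - 2 * h)"
abbreviation (input) "tuXY0 \<equiv> \<theta> (u - x - y)"
abbreviation (input) "tuXY1 \<equiv> \<theta> (u - x - y + h)"
abbreviation (input) "tuXY2 \<equiv> \<theta> (u - x - y + 2 * h)"
abbreviation (input) "tuXYm1 \<equiv> \<theta> (u - x - y - h)"
abbreviation (input) "tuXy0 \<equiv> \<theta> (u - x + y)"
abbreviation (input) "tuXy1 \<equiv> \<theta> (u - x + y + h)"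
abbreviation (input) "tuXy2 \<equiv> \<theta> (u - x + y + 2 * h)"
abbreviation (input) "tuXy3 \<equiv> \<theta> (u - x + y + 3 * h)"
abbreviation (input) "tuXy4 \<equiv> \<theta> (u - x + y + 4 * h)"
abbreviation (input) "tuYY0 \<equiv> \<theta> (u - 2 * y)"
abbreviation (input) "tuYY1 \<equiv> \<theta> (u - 2 * y + h)"
abbreviation (input) "tuYY3 \<equiv> \<theta> (u - 2 * y + 3 * h)"
abbreviation (input) "tum1 \<equiv> \<theta> (u - h)"
abbreviation (input) "tuxY1 \<equiv> \<theta> (u + x - y + h)"
abbreviation (input) "tuxY2 \<equiv> \<theta> (u + x - y + 2 * h)"
abbreviation (input) "tuxY3 \<equiv> \<theta> (u + x - y + 3 * h)"
abbreviation (input) "tuxY4 \<equiv> \<theta> (u + x - y + 4 * h)"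
abbreviation (input) "tuxx2 \<equiv> \<theta> (u + 2 * x + 2 * h)"
abbreviation (input) "tuxx3 \<equiv> \<theta> (u + 2 * x + 3 * h)"
abbreviation (input) "tuxx4 \<equiv> \<theta> (u + 2 * x + 4 * h)"
abbreviation (input) "tuxx5 \<equiv> \<theta> (u + 2 * x + 5 * h)"
abbreviation (input) "tuxy2 \<equiv> \<theta> (u + x + y + 2 * h)"
abbreviation (input) "tuxy3 \<equiv> \<theta> (u + x + y + 3 * h)"
abbreviation (input) "tuxy4 \<equiv> \<theta> (u + x + y + 4 * h)"
abbreviation (input) "tuyy2 \<equiv> \<theta> (u + 2 * y + 2 * h)"
abbreviation (input) "tuyy5 \<equiv> \<theta> (u + 2 * y + 5 * h)"

text \<open>Together with \<open>theta_sign\<close> this brings every argument to one normal form.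
  Equal theta values become equal terms, which \<open>algebra\<close> can treat as
  indeterminates.\<close>

lemma theta_shift:
  "\<theta> (x + h - y + h) = \<theta> (x - y + 2 * h)" "\<theta> (x + h - y) = \<theta> (x - y + h)"
  "\<theta> (u + h + h) = \<theta> (u + 2 * h)" "\<theta> (y + (x + h) + h) = \<theta> (x + y + 2 * h)"
  "\<theta> (u + y - x + 2 * h) = \<theta> (u - x + y + 2 * h)" "\<theta> (y + (x + h)) = \<theta> (x + y + h)"
  "\<theta> (u + h - 2 * x) = \<theta> (u - 2 * x + h)" "\<theta> (x - h - y) = \<theta> (x - y - h)"
  "\<theta> (- (y + h) + x + h) = \<theta> (x - y)" "\<theta> (- (y + h) + x) = \<theta> (x - y - h)"
  "\<theta> (x + (- (y + h))) = \<theta> (x - y - h)" "\<theta> (x - (- (y + h))) = \<theta> (x + y + h)"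
  "\<theta> (2 * h - 2 * (- (y + h))) = \<theta> (2 * y + 4 * h)"
  "\<theta> (x - (- (y + h)) + h) = \<theta> (x + y + 2 * h)"
  "\<theta> (2 * (y + h) + 2 * h) = \<theta> (2 * y + 4 * h)" "\<theta> (x + (y + h)) = \<theta> (x + y + h)"
  "\<theta> (x - (y + h)) = \<theta> (x - y - h)" "\<theta> (x + (y + h) + h) = \<theta> (x + y + 2 * h)"
  "\<theta> (x - (y + h) + h) = \<theta> (x - y)" "\<theta> (- (y + h) - (- x)) = \<theta> (x - y - h)"
  "\<theta> (y + x + h) = \<theta> (x + y + h)" "\<theta> (x + (- y)) = \<theta> (x - y)"
  "\<theta> (x - (- y)) = \<theta> (x + y)" "\<theta> (u + h - x - y) = \<theta> (u - x - y + h)"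
  "\<theta> (2 * (x + h) + 2 * h) = \<theta> (2 * x + 4 * h)" "\<theta> (x + h + y + h) = \<theta> (x + y + 2 * h)"
  "\<theta> (2 * (x + h) + h) = \<theta> (2 * x + 3 * h)" "\<theta> (2 * (x + h)) = \<theta> (2 * x + 2 * h)"
  "\<theta> (x + h + y) = \<theta> (x + y + h)" "\<theta> (2 * h - 2 * (- (x + h))) = \<theta> (2 * x + 4 * h)"
  "\<theta> (y - (- (x + h)) + h) = \<theta> (x + y + 2 * h)"
  "\<theta> (h - (- (x + h)) - y) = \<theta> (x - y + 2 * h)"
  "\<theta> (x + h - (- y) + h) = \<theta> (x + y + 2 * h)" "\<theta> (- y + (x + h)) = \<theta> (x - y + h)"
  "\<theta> (y - (- (x + h))) = \<theta> (x + y + h)" "\<theta> (- y - (- (x + h))) = \<theta> (x - y + h)"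
  "\<theta> (2 * h - 2 * (- y)) = \<theta> (2 * y + 2 * h)" "\<theta> (u - h + 2 * h) = \<theta> (u + h)"
  "\<theta> (u - h + 4 * h) = \<theta> (u + 3 * h)" "\<theta> (y + (x + h) - h) = \<theta> (x + y)"
  "\<theta> (u - h + h - x - (- (y + h))) = \<theta> (u - x + y + h)" "\<theta> (y + x - h) = \<theta> (x + y - h)"
  "\<theta> (y + x + 2 * h) = \<theta> (x + y + 2 * h)" "\<theta> (u + h - 2 * y) = \<theta> (u - 2 * y + h)"
  "\<theta> (u + h - x - (- y)) = \<theta> (u - x + y + h)"
  "\<theta> (u - h + h - y - (x + h)) = \<theta> (u - x - y - h)"
  "\<theta> (u - h + h - (- (y + h)) - x) = \<theta> (u - x + y + h)"
  "\<theta> (u - h + h - (- (- y + h)) - x) = \<theta> (u - x - y + h)"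
  "\<theta> (- (- y + h) + x) = \<theta> (x + y - h)" "\<theta> (- y + x - h) = \<theta> (x - y - h)"
  "\<theta> (u + x - (- y) + 2 * h) = \<theta> (u + x + y + 2 * h)" "\<theta> (x - (- y) + h) = \<theta> (x + y + h)"
  "\<theta> (x + (- y) - h) = \<theta> (x - y - h)" "\<theta> (x - (- y) - h) = \<theta> (x + y - h)"
  "\<theta> (x + (- y) + h) = \<theta> (x - y + h)" "\<theta> (- (y + h) + x - h) = \<theta> (x - y - 2 * h)"
  "\<theta> (u + h - y - x) = \<theta> (u - x - y + h)" "\<theta> (y + x) = \<theta> (x + y)"
  "\<theta> (u - h + h - (- (x + h)) - y) = \<theta> (u + x - y + h)"
  "\<theta> (u - h + h - (- (- x + h)) - y) = \<theta> (u - x - y + h)"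
  "\<theta> (- (- x + h) + y) = \<theta> (x + y - h)" "\<theta> (- (- x + h) - y) = \<theta> (x - y - h)"
  "\<theta> (x + (- y) - 5 * h) = \<theta> (x - y - 5 * h)" "\<theta> (x + (- y) + 2 * h) = \<theta> (x - y + 2 * h)"
  "\<theta> (- y + x) = \<theta> (x - y)" "\<theta> (x + (y - h) - h) = \<theta> (x + y - 2 * h)"
  "\<theta> (x + (y - h) + h) = \<theta> (x + y)" "\<theta> (x + (- (y + h)) - h) = \<theta> (x - y - 2 * h)"
  "\<theta> (x + (- (y + h)) + h) = \<theta> (x - y)" "\<theta> (- (y + h) + (x + h) - h) = \<theta> (x - y - h)"
  "\<theta> (- (y + h) + (x + h)) = \<theta> (x - y)" "\<theta> (y - h + (x + h) - h) = \<theta> (x + y - h)"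
  "\<theta> (y - h + (x + h)) = \<theta> (x + y)" "\<theta> (x + h + y - h) = \<theta> (x + y)"
  "\<theta> (x + h - y - h) = \<theta> (x - y)" "\<theta> (x + h + (- y) - h) = \<theta> (x - y)"
  "\<theta> (x + h - (- y) - h) = \<theta> (x + y)" "\<theta> (x + h + (- y) + h) = \<theta> (x - y + 2 * h)"
  "\<theta> (x + h + (y + h) - h) = \<theta> (x + y + h)" "\<theta> (x + h - (y + h) - h) = \<theta> (x - y - h)"
  "\<theta> (x + h + (y + h)) = \<theta> (x + y + 2 * h)" "\<theta> (x + h - (y + h)) = \<theta> (x - y)"
  by (rule arg_cong [of _ _ \<theta>]; simp add: c_def algebra_simps)+

lemma theta_sign:
  "\<theta> (c - u) = - \<theta> (u + 3 * h)" "\<theta> c = - \<theta> (3 * h)"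
  "\<theta> (c - (u + h)) = - \<theta> (u + 4 * h)" "\<theta> (x + h - y - (u + h)) = - \<theta> (u - x + y)"
  "\<theta> (y - (x + h) + h) = - \<theta> (x - y)" "\<theta> (x - y - u) = - \<theta> (u - x + y)"
  "\<theta> (y - (x + h)) = - \<theta> (x - y + h)"
  "\<theta> (y - (x + h) - (u + h)) = - \<theta> (u + x - y + 2 * h)" "\<theta> (y - x + h) = - \<theta> (x - y - h)"
  "\<theta> (y - x) = - \<theta> (x - y)" "\<theta> (- (x + h) - y + h) = - \<theta> (x + y)"
  "\<theta> (2 * x + h + c - u) = - \<theta> (u - 2 * x + 2 * h)"
  "\<theta> (2 * x + h - u) = - \<theta> (u - 2 * x - h)"
  "\<theta> (- (x + h) - y - (u + h)) = - \<theta> (u + x + y + 2 * h)"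
  "\<theta> (- (x + h) - y) = - \<theta> (x + y + h)" "\<theta> (y + (x + h) - (u + h)) = - \<theta> (u - x - y)"
  "\<theta> (h + c - u) = - \<theta> (u + 2 * h)" "\<theta> (2 * h - 2 * x) = - \<theta> (2 * x - 2 * h)"
  "\<theta> (h - x - y) = - \<theta> (x + y - h)" "\<theta> (x - h - y - (u + h)) = - \<theta> (u - x + y + 2 * h)"
  "\<theta> (2 * (- x) + 2 * h) = - \<theta> (2 * x - 2 * h)"
  "\<theta> (y - (x - h) + h) = - \<theta> (x - y - 2 * h)" "\<theta> (y - (x - h)) = - \<theta> (x - y - h)"
  "\<theta> (- x - y + h) = - \<theta> (x + y - h)" "\<theta> (x + y + h + c - u) = - \<theta> (u - x - y + 2 * h)"
  "\<theta> (2 * (- (y + h)) + h + c - (u + h)) = - \<theta> (u + 2 * y + 5 * h)"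
  "\<theta> (2 * (- (y + h)) + 2 * h) = - \<theta> (2 * y)" "\<theta> (- (y + h) - x + h) = - \<theta> (x + y)"
  "\<theta> (2 * (- (y + h)) + h - (u + h)) = - \<theta> (u + 2 * y + 2 * h)"
  "\<theta> (2 * (- (y + h)) + h) = - \<theta> (2 * y + h)" "\<theta> (2 * (- (y + h))) = - \<theta> (2 * y + 2 * h)"
  "\<theta> (- (y + h) - x) = - \<theta> (x + y + h)"
  "\<theta> (x + (- (y + h)) + h + c - (u + h)) = - \<theta> (u - x + y + 4 * h)"
  "\<theta> (h + c - (u + h)) = - \<theta> (u + 3 * h)" "\<theta> (h - (- (y + h)) - x) = - \<theta> (x - y - 2 * h)"
  "\<theta> (x + (y + h) + h + c - (u + h)) = - \<theta> (u - x - y + 2 * h)"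
  "\<theta> (y + h - x + h) = - \<theta> (x - y - 2 * h)"
  "\<theta> (- (y + h) + x + h + c - (u + h)) = - \<theta> (u - x + y + 4 * h)"
  "\<theta> (2 * x + h + c - (u + h)) = - \<theta> (u - 2 * x + 3 * h)"
  "\<theta> (2 * x + h - (u + h)) = - \<theta> (u - 2 * x)"
  "\<theta> (- (y + h) + (- x) + h + c - (u + h)) = - \<theta> (u + x + y + 4 * h)"
  "\<theta> (- x - (- (y + h)) + h) = - \<theta> (x - y - 2 * h)"
  "\<theta> (- (y + h) + (- x)) = - \<theta> (x + y + h)" "\<theta> (h - x - (y + h)) = - \<theta> (x + y)"
  "\<theta> (x + (- y) + h + c - u) = - \<theta> (u - x + y + 2 * h)"
  "\<theta> (2 * (- y) + 2 * h) = - \<theta> (2 * y - 2 * h)" "\<theta> (- y - x + h) = - \<theta> (x + y - h)"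
  "\<theta> (2 * (- (x + h)) + 2 * h) = - \<theta> (2 * x)"
  "\<theta> (x + (y + h) - (u + h)) = - \<theta> (u - x - y)"
  "\<theta> (- (y + h) - x - (u + h)) = - \<theta> (u + x + y + 2 * h)"
  "\<theta> (2 * (x + h) + h + c - (u + h)) = - \<theta> (u - 2 * x + h)"
  "\<theta> (2 * (x + h) + h - (u + h)) = - \<theta> (u - 2 * x - 2 * h)"
  "\<theta> (2 * (- (x + h))) = - \<theta> (2 * x + 2 * h)" "\<theta> (- (x + h) + y) = - \<theta> (x - y + h)"
  "\<theta> (y + (x + h) + h + c - (u + h)) = - \<theta> (u - x - y + 2 * h)"
  "\<theta> (x + y - u) = - \<theta> (u - x - y)"
  "\<theta> (- y + (x + h) + h + c - (u + h)) = - \<theta> (u - x + y + 2 * h)"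
  "\<theta> (2 * (- y)) = - \<theta> (2 * y)" "\<theta> (- y - (x + h)) = - \<theta> (x + y + h)"
  "\<theta> (2 * h - 2 * (x + h)) = - \<theta> (2 * x)" "\<theta> (h - (x + h) - y) = - \<theta> (x + y)"
  "\<theta> (2 * (- (x + h)) + h + c - (u + h)) = - \<theta> (u + 2 * x + 5 * h)"
  "\<theta> (- (x + h) + y + h) = - \<theta> (x - y)"
  "\<theta> (2 * (- (x + h)) + h - (u + h)) = - \<theta> (u + 2 * x + 2 * h)"
  "\<theta> (2 * (- (x + h)) + h) = - \<theta> (2 * x + h)"
  "\<theta> (y + (- (x + h)) + h + c - (u + h)) = - \<theta> (u + x - y + 4 * h)"
  "\<theta> (y + (- (x + h))) = - \<theta> (x - y + h)"
  "\<theta> (- y + (- (x + h)) + h + c - (u + h)) = - \<theta> (u + x + y + 4 * h)"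
  "\<theta> (- (x + h) - (- y) + h) = - \<theta> (x - y)" "\<theta> (- y + (- (x + h))) = - \<theta> (x + y + h)"
  "\<theta> (x + h + y + h + c - (u + h)) = - \<theta> (u - x - y + 2 * h)"
  "\<theta> (- (x + h) + y + h + c - (u + h)) = - \<theta> (u + x - y + 4 * h)"
  "\<theta> (2 * y + h + c - (u + h)) = - \<theta> (u - 2 * y + 3 * h)"
  "\<theta> (2 * y + h - (u + h)) = - \<theta> (u - 2 * y)" "\<theta> (h - (- y) - (x + h)) = - \<theta> (x - y)"
  "\<theta> (y - (x + h) - h) = - \<theta> (x - y + 2 * h)" "\<theta> (y - x - 2 * h) = - \<theta> (x - y + 2 * h)"
  "\<theta> (- (x + h) + y - h) = - \<theta> (x - y + 2 * h)"
  "\<theta> (- (x + h) - y - h) = - \<theta> (x + y + 2 * h)" "\<theta> (- (- y + h) - x) = - \<theta> (x - y + h)"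
  "\<theta> (- y - x) = - \<theta> (x + y)" "\<theta> (- y - x - 2 * h) = - \<theta> (x + y + 2 * h)"
  "\<theta> (2 * (- y) - 2 * h) = - \<theta> (2 * y + 2 * h)"
  "\<theta> (- (y + h) - x - h) = - \<theta> (x + y + 2 * h)"
  "\<theta> (- x - y - 2 * h) = - \<theta> (x + y + 2 * h)"
  "\<theta> (2 * (- x) - 2 * h) = - \<theta> (2 * x + 2 * h)" "\<theta> (- x - y) = - \<theta> (x + y)"
  "\<theta> (2 * (- x)) = - \<theta> (2 * x)" "\<theta> (- x + y - 5 * h) = - \<theta> (x - y + 5 * h)"
  "\<theta> (- x + y + 2 * h) = - \<theta> (x - y - 2 * h)" "\<theta> (- x + y + h) = - \<theta> (x - y - h)"
  "\<theta> (- x + y) = - \<theta> (x - y)" "\<theta> (- x + (- y) - 5 * h) = - \<theta> (x + y + 5 * h)"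
  "\<theta> (- x + (- y) + 2 * h) = - \<theta> (x + y - 2 * h)" "\<theta> (- x + (- y) + h) = - \<theta> (x + y - h)"
  "\<theta> (- x + (- y)) = - \<theta> (x + y)" "\<theta> (- y - x - h) = - \<theta> (x + y + h)"
  "\<theta> (y - x - h) = - \<theta> (x - y + h)" "\<theta> (- (y + h) - (x + h) - h) = - \<theta> (x + y + 3 * h)"
  "\<theta> (- (y + h) - (x + h)) = - \<theta> (x + y + 2 * h)"
  "\<theta> (y - h - (x + h) - h) = - \<theta> (x - y + 3 * h)"
  "\<theta> (y - h - (x + h)) = - \<theta> (x - y + 2 * h)"
  by (rule theta_eq_minus; simp add: c_def algebra_simps)+

text \<open>In \<open>path_A_ppq\<close> and its companions the last three letters are the steps of a path, capitals
  standing for opposite steps; the lemma gives the coefficient of that path in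
  $W^{2,3}(u+\hbar)W^{1,2}(u)\,e_\lambda^\mu \otimes f_\mu^\nu$ with $\mu = \lambda + \widehat p$. The second
  factor moves by $\widehat p + \widehat q$ in case \<open>A\<close>, by $-\widehat p + \widehat q$ in case \<open>B\<close>, and
  stays at \<open>\<mu>\<close> in case \<open>C\<close>.\<close>

lemma path_A_ppq:
  "\<theta> (x + h - y + h) * wpp u * wpq (x + h - y) (u + h)
    + \<theta> (y - (x + h) + h) * wpq (x - y) u * wqp (x + h - y) (u + h) = 0" (is "?lhs = 0")
proof -
  \<comment> \<open>The path p, p, q passes through \<lambda> + 2 hat p, where no f-vector starting
    at \<lambda> ends, so its two contributions have to cancel. The same holds for q, q, -q in case
    B and p, p, -p in case C.\<close>
  define k where "k = tD2 * tuXy0 * tu1 * tu3 * tu4 / (tH1 * tH3 * tH3 * tD1)"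
  have t: "\<theta> (x + h - y + h) * wpp u * wpq (x + h - y) (u + h) = (- 1) * k"
    "\<theta> (y - (x + h) + h) * wpq (x - y) u * wqp (x + h - y) (u + h) = (1) * k"
    unfolding k_def wpp_def wpq_def wqp_def
    by (simp only: theta_shift theta_sign single_fraction, subst frac_eq_eq, simp add: theta_nonzero, simp add: theta_nonzero, algebra)+
  have "?lhs = 0"
    unfolding t by algebra
  then show ?thesis .
qed

lemma path_A_pqp:
  "\<theta> (x + h - y + h) * wpp u * wqp (y - (x + h)) (u + h)
    + \<theta> (y - (x + h) + h) * wpq (x - y) u * wpq (y - (x + h)) (u + h) = WA u * \<theta> (x - y + h)" (is "?lhs = ?rhs")
proof -
  \<comment> \<open>The pattern of the identities that follow: \<open>r1\<close>, \<open>r2\<close>,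
    ... are instances of the three-term relation, k is a factor common to all terms, and the
    displayed combination of the relations is the certificate.\<close>
  have r1: "tH1 * tH1 * tuXy0 * tuxY2 - tD1 * tD1 * tu0 * tu2 + tD0 * tD2 * tu1 * tu1 = 0" (is "?r1 = 0")
    using three_term_half_sum [of "u + 2 * h" "h" "h" "u - x + y" "u + x - y + 2 * h"]
      theta_minus [of \<tau> "x - y"] theta_minus [of \<tau> "x - y + h"] theta_minus [of \<tau> "u"]
    by (simp add: algebra_simps)
  define k where "k = tu3 * tu4 / (tH1 * tH1 * tH3 * tH3 * tD1)"
  have t: "\<theta> (x + h - y + h) * wpp u * wqp (y - (x + h)) (u + h) = (tD0 * tD2 * tu1 * tu1) * k"
    "\<theta> (y - (x + h) + h) * wpq (x - y) u * wpq (y - (x + h)) (u + h) = (tH1 * tH1 * tuXy0 * tuxY2) * k"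
    "WA u * \<theta> (x - y + h) = (tD1 * tD1 * tu0 * tu2) * k"
    unfolding k_def wpp_def wpq_def wqp_def WA_def gg_def
    by (simp only: theta_shift theta_sign single_fraction, subst frac_eq_eq, simp add: theta_nonzero, simp add: theta_nonzero, algebra)+
  have "?lhs - ?rhs = (?r1) * k"
    unfolding t by algebra
  also have "\<dots> = 0"
    by (simp only: r1 mult_zero_right mult_zero_left add_0 diff_0 minus_zero)
  finally show ?thesis
    by (simp only: right_minus_eq)
qed

text \<open>The paths p, q and q, p make up one f-vector. That p, q, p and q, p, p lead to the same
  \<open>WA\<close> is what makes the image a multiple of that vector.\<close>

lemma path_A_qpp:
  "\<theta> (y - (x + h) + h) * wqp (y - x) u * wpp (u + h) = WA u * \<theta> (y - x + h)"
  unfolding wpp_def wqp_def WA_def gg_def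
  by (simp only: theta_shift theta_sign single_fraction, subst frac_eq_eq, simp add: theta_nonzero, simp add: theta_nonzero, algebra)

text \<open>The last factor on the right is the coefficient of p, -p in \<open>f l l\<close>. All
  four paths of \<open>f l l\<close> followed by q have to yield the same \<open>WB0\<close>;
  likewise two paths each have to agree on \<open>WBp\<close> and on \<open>WBm\<close>.\<close>

lemma path_B_pPq:
  "\<theta> (- (x + h) - y + h) * wdiag x y u * wpq (- (x + h) - y) (u + h)
    + \<theta> (y + (x + h) + h) * wpq (x - y) u * wqp (- (x + h) - y) (u + h) = WB0 x y u * \<theta> (2 * x + 2 * h)" (is "?lhs = ?rhs")
proof -
  have r1: "tH1 * tD0 * tuXXm1 * tuxy2 - tS2 * tX1 * tuXy0 * tu1 + tS1 * tX2 * tuXy1 * tu0 = 0" (is "?r1 = 0")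
    using three_term_half_sum [of "u + h" "h" "x - y" "u - 2 * x - h" "u + x + y + 2 * h"]
      theta_minus [of \<tau> "x + y + h"] theta_minus [of \<tau> "x + y + 2 * h"] theta_minus [of \<tau> "2 * x + h"] theta_minus [of \<tau> "u - x + y"]
    by (simp add: algebra_simps)
  have r2: "tSm1 * tX1 * tuXy2 * tu2 + tH1 * tD1 * tuXX2 * tuxy2 - tS0 * tX0 * tuXy1 * tu3 = 0" (is "?r2 = 0")
    using three_term_half_sum [of "u + x + y + 2 * h" "x + y - h" "2 * x + h" "u - x + y + 2 * h" "u + 2 * h"]
      theta_minus [of \<tau> "x - y + h"] theta_minus [of \<tau> "u - 2 * x + 2 * h"]
    by (simp add: algebra_simps)
  define k where "k = tu4 / (tH1 * tH3 * tH3 * tD0 * tS1 * tX0 * tX1)"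
  have t: "\<theta> (- (x + h) - y + h) * wdiag x y u * wpq (- (x + h) - y) (u + h) = (tH1 * tD0 * tS0 * tX0 * tuXXm1 * tu3 * tuxy2 + tH1 * tD1 * tS1 * tX2 * tuXX2 * tu0 * tuxy2) * k"
    "\<theta> (y + (x + h) + h) * wpq (x - y) u * wqp (- (x + h) - y) (u + h) = (- tS0 * tS2 * tX0 * tX1 * tuXy0 * tu1 * tu3) * k"
    "WB0 x y u * \<theta> (2 * x + 2 * h) = (- tSm1 * tS1 * tX1 * tX2 * tuXy2 * tu0 * tu2) * k"
    unfolding k_def wpq_def wqp_def wdiag_def WB0_def gg_def
    by (simp only: theta_shift theta_sign single_fraction, subst frac_eq_eq, simp add: theta_nonzero, simp add: theta_nonzero, algebra)+
  have "?lhs - ?rhs = (tS0 * tX0 * tu3 * ?r1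
      + tS1 * tX2 * tu0 * ?r2) * k"
    unfolding t by algebra
  also have "\<dots> = 0"
    by (simp only: r1 r2 mult_zero_right mult_zero_left add_0 diff_0 minus_zero)
  finally show ?thesis
    by (simp only: right_minus_eq)
qed

lemma path_B_pqP:
  "\<theta> (- (x + h) - y + h) * wdiag x y u * wqp (y + (x + h)) (u + h)
    + \<theta> (y + (x + h) + h) * wpq (x - y) u * wpq (y + (x + h)) (u + h) = WBp x y u * \<theta> (x - y + h)" (is "?lhs = ?rhs")
proof -
  have r1: "tH2 * tX1 * tuXX1 * tu2 - tH1 * tX0 * tuXX0 * tu3 - tH1 * tX2 * tuXX2 * tu1 = 0" (is "?r1 = 0")
    using three_term_half_sum [of "u + 3 * h" "2 * h" "2 * x + h" "u - 2 * x + h" "u + 2 * h"]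
      theta_minus [of \<tau> "h"] theta_minus [of \<tau> "2 * x"] theta_minus [of \<tau> "u - 2 * x"]
    by (simp add: algebra_simps)
  have r2: "tH1 * tX1 * tuXY0 * tuXy0 + tD0 * tS0 * tuXXm1 * tu1 - tD1 * tS1 * tuXX0 * tu0 = 0" (is "?r2 = 0")
    using three_term_half_sum [of "u + h" "h" "2 * x + h" "u - x - y" "u - x + y"]
      theta_minus [of \<tau> "x + y"] theta_minus [of \<tau> "u - 2 * x - h"]
    by (simp add: algebra_simps)
  define k where "k = tS2 * tu4 / (tH1 * tH1 * tH3 * tH3 * tD0 * tS1 * tX0 * tX1)"
  have t: "\<theta> (- (x + h) - y + h) * wdiag x y u * wqp (y + (x + h)) (u + h) = (tH1 * tD0 * tS0 * tX0 * tuXXm1 * tu1 * tu3 + tH1 * tD1 * tS1 * tX2 * tuXX2 * tu0 * tu1) * k"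
    "\<theta> (y + (x + h) + h) * wpq (x - y) u * wpq (y + (x + h)) (u + h) = (tH1 * tH1 * tX0 * tX1 * tuXY0 * tuXy0 * tu3) * k"
    "WBp x y u * \<theta> (x - y + h) = (tH2 * tD1 * tS1 * tX1 * tuXX1 * tu0 * tu2) * k"
    unfolding k_def wpq_def wqp_def wdiag_def WBp_def gg_def
    by (simp only: theta_shift theta_sign single_fraction, subst frac_eq_eq, simp add: theta_nonzero, simp add: theta_nonzero, algebra)+
  have "?lhs - ?rhs = (- tD1 * tS1 * tu0 * ?r1
      + tH1 * tX0 * tu3 * ?r2) * k"
    unfolding t by algebra
  also have "\<dots> = 0"
    by (simp only: r1 r2 mult_zero_right mult_zero_left add_0 diff_0 minus_zero)
  finally show ?thesis
    by (simp only: right_minus_eq)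
qed

lemma path_B_Ppq:
  "\<theta> (- (x + h) - y + h) * wneg x y u * wpq (x - h - y) (u + h) = WB0 x y u * \<theta> (2 * (- x) + 2 * h)"
  unfolding wpq_def wneg_def WB0_def gg_def
  by (simp only: theta_shift theta_sign single_fraction, subst frac_eq_eq, simp add: theta_nonzero, simp add: theta_nonzero, algebra)

lemma path_B_Pqp:
  "\<theta> (- (x + h) - y + h) * wneg x y u * wqp (y - (x - h)) (u + h) = WBm x y u * \<theta> (- x - y + h)"
  unfolding wqp_def wneg_def WBm_def gg_def
  by (simp only: theta_sign single_fraction, subst frac_eq_eq, simp add: theta_nonzero, simp add: theta_nonzero, algebra)

lemma path_B_qQq:
  "\<theta> (- (x + h) - y + h) * wex x y u * wdiag (- (y + h)) x (u + h)
    + \<theta> (y + (x + h) + h) * wqp (y - x) u * wex x (- (y + h)) (u + h) = WB0 x y u * \<theta> (2 * y + 2 * h)" (is "?lhs = ?rhs")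
proof -
  have r1: "tY1 * tS2 * tuXy4 * tu3 + tH1 * tD0 * tuXY2 * tuyy5 - tY2 * tS1 * tuXy3 * tu4 = 0" (is "?r1 = 0")
    using three_term_half_sum [of "u + 2 * y + 5 * h" "2 * y + h" "x + y + 2 * h" "u - x + y + 4 * h" "u + 3 * h"]
      theta_minus [of \<tau> "x - y"] theta_minus [of \<tau> "u - x - y + 2 * h"]
    by (simp add: algebra_simps)
  have r2: "tY1 * tSm1 * tuXy2 * tu2 - tH1 * tDm1 * tuXY2 * tuyy2 - tY0 * tS0 * tuXy3 * tu1 = 0" (is "?r2 = 0")
    using three_term_half_sum [of "u + 2 * y + 2 * h" "2 * y + h" "x + y - h" "u - x + y + 2 * h" "u + 2 * h"]
      theta_minus [of \<tau> "h"] theta_minus [of \<tau> "x - y - h"] theta_minus [of \<tau> "u - x - y + 2 * h"]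
    by (simp add: algebra_simps)
  define k where "k = tu0 / (tH1 * tH3 * tH3 * tY1 * tD0 * tS1 * tX0)"
  have t: "\<theta> (- (x + h) - y + h) * wex x y u * wdiag (- (y + h)) x (u + h) = (- tH1 * tY2 * tDm1 * tS1 * tuXY2 * tu4 * tuyy2 - tH1 * tY0 * tD0 * tS0 * tuXY2 * tu1 * tuyy5) * k"
    "\<theta> (y + (x + h) + h) * wqp (y - x) u * wex x (- (y + h)) (u + h) = (- tY0 * tY1 * tS0 * tS2 * tuXy4 * tu1 * tu3) * k"
    "WB0 x y u * \<theta> (2 * y + 2 * h) = (- tY1 * tY2 * tSm1 * tS1 * tuXy2 * tu2 * tu4) * k"
    unfolding k_def wqp_def wex_def wdiag_def WB0_def gg_def
    by (simp only: theta_shift theta_sign single_fraction, subst frac_eq_eq, simp add: theta_nonzero, simp add: theta_nonzero, algebra)+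
  have "?lhs - ?rhs = (- tY0 * tS0 * tu1 * ?r1
      + tY2 * tS1 * tu4 * ?r2) * k"
    unfolding t by algebra
  also have "\<dots> = 0"
    by (simp only: r1 r2 mult_zero_right mult_zero_left add_0 diff_0 minus_zero)
  finally show ?thesis
    by (simp only: right_minus_eq)
qed

lemma path_B_qqQ:
  "\<theta> (- (x + h) - y + h) * wex x y u * wneg (- (y + h)) x (u + h)
    + \<theta> (y + (x + h) + h) * wqp (y - x) u * wex x (y + h) (u + h) = 0" (is "?lhs = 0")
proof -
  define k where "k = tY4 * tDm2 * tS2 * tuXY2 * tu0 * tu1 * tu3 / (tH1 * tH3 * tH3 * tD0 * tS1 * tX0)"
  have t: "\<theta> (- (x + h) - y + h) * wex x y u * wneg (- (y + h)) x (u + h) = (- 1) * k"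
    "\<theta> (y + (x + h) + h) * wqp (y - x) u * wex x (y + h) (u + h) = (1) * k"
    unfolding k_def wqp_def wex_def wneg_def
    by (simp only: theta_shift theta_sign single_fraction, subst frac_eq_eq, simp add: theta_nonzero, simp add: theta_nonzero, algebra)+
  have "?lhs = 0"
    unfolding t by algebra
  then show ?thesis .
qed

lemma path_B_qpP:
  "\<theta> (- (x + h) - y + h) * wex x y u * wex (- (y + h)) x (u + h)
    + \<theta> (y + (x + h) + h) * wqp (y - x) u * wdiag x (y + h) (u + h) = WBp x y u * \<theta> (y - x + h)" (is "?lhs = ?rhs")
proof -
  have r1: "tH1 * tX1 * tuXY2 * tuXy4 + tDm1 * tS1 * tuXX2 * tu4 - tD0 * tS2 * tuXX3 * tu3 = 0" (is "?r1 = 0")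
    using three_term_half_sum [of "u + 4 * h" "h" "2 * x + h" "u - x - y + 2 * h" "u - x + y + 4 * h"]
      theta_minus [of \<tau> "x + y + h"] theta_minus [of \<tau> "u - 2 * x + 2 * h"]
    by (simp add: algebra_simps)
  have r2: "tH1 * tX0 * tuXX0 * tu3 - tH2 * tX1 * tuXX1 * tu2 + tH1 * tX2 * tuXX2 * tu1 = 0" (is "?r2 = 0")
    using three_term_half_sum [of "u + 2 * h" "h" "2 * x" "u - 2 * x" "u + 3 * h"]
      theta_minus [of \<tau> "h"] theta_minus [of \<tau> "2 * h"] theta_minus [of \<tau> "2 * x + h"] theta_minus [of \<tau> "u - 2 * x + h"]
    by (simp add: algebra_simps)
  define k where "k = tS2 * tu0 / (tH1 * tH1 * tH3 * tH3 * tD0 * tS1 * tX0 * tX1)"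
  have t: "\<theta> (- (x + h) - y + h) * wex x y u * wex (- (y + h)) x (u + h) = (tH1 * tH1 * tX1 * tX2 * tuXY2 * tuXy4 * tu1) * k"
    "\<theta> (y + (x + h) + h) * wqp (y - x) u * wdiag x (y + h) (u + h) = (- tH1 * tDm1 * tS1 * tX0 * tuXX0 * tu3 * tu4 - tH1 * tD0 * tS2 * tX2 * tuXX3 * tu1 * tu3) * k"
    "WBp x y u * \<theta> (y - x + h) = (- tH2 * tDm1 * tS1 * tX1 * tuXX1 * tu2 * tu4) * k"
    unfolding k_def wqp_def wex_def wdiag_def WBp_def gg_def
    by (simp only: theta_shift theta_sign single_fraction, subst frac_eq_eq, simp add: theta_nonzero, simp add: theta_nonzero, algebra)+
  have "?lhs - ?rhs = (tH1 * tX2 * tu1 * ?r1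
      - tDm1 * tS1 * tu4 * ?r2) * k"
    unfolding t by algebra
  also have "\<dots> = 0"
    by (simp only: r1 r2 mult_zero_right mult_zero_left add_0 diff_0 minus_zero)
  finally show ?thesis
    by (simp only: right_minus_eq)
qed

lemma path_B_qPp:
  "\<theta> (- (x + h) - y + h) * wex x y u * wex (- (y + h)) (- x) (u + h)
    + \<theta> (y + (x + h) + h) * wqp (y - x) u * wneg x (y + h) (u + h) = WBm x y u * \<theta> (y + x + h)" (is "?lhs = ?rhs")
proof -
  have r1: "tS0 * tS2 * tu3 * tu3 + tH1 * tH1 * tuXY2 * tuxy4 - tS1 * tS1 * tu2 * tu4 = 0" (is "?r1 = 0")
    using three_term_half_sum [of "u + x + y + 4 * h" "x + y" "x + y + 2 * h" "u + 3 * h" "u + 3 * h"]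
      theta_minus [of \<tau> "h"] theta_minus [of \<tau> "u - x - y + 2 * h"]
    by (simp add: algebra_simps)
  define k where "k = tDm2 * tXm2 * tu0 * tu1 / (tH1 * tH1 * tH3 * tH3 * tD0 * tS1 * tX0)"
  have t: "\<theta> (- (x + h) - y + h) * wex x y u * wex (- (y + h)) (- x) (u + h) = (tH1 * tH1 * tuXY2 * tuxy4) * k"
    "\<theta> (y + (x + h) + h) * wqp (y - x) u * wneg x (y + h) (u + h) = (tS0 * tS2 * tu3 * tu3) * k"
    "WBm x y u * \<theta> (y + x + h) = (tS1 * tS1 * tu2 * tu4) * k"
    unfolding k_def wqp_def wex_def wneg_def WBm_def gg_def
    by (simp only: theta_shift theta_sign single_fraction, subst frac_eq_eq, simp add: theta_nonzero, simp add: theta_nonzero, algebra)+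
  have "?lhs - ?rhs = (?r1) * k"
    unfolding t by algebra
  also have "\<dots> = 0"
    by (simp only: r1 mult_zero_right mult_zero_left add_0 diff_0 minus_zero)
  finally show ?thesis
    by (simp only: right_minus_eq)
qed

lemma path_B_Qqq:
  "\<theta> (- (x + h) - y + h) * wex x (- y) u * wpp (u + h) = WB0 x y u * \<theta> (2 * (- y) + 2 * h)"
  unfolding wpp_def wex_def WB0_def gg_def
  by (simp only: theta_shift theta_sign single_fraction, subst frac_eq_eq, simp add: theta_nonzero, simp add: theta_nonzero, algebra)

lemma path_C_Ppp:
  "\<theta> (2 * (- (x + h)) + 2 * h) * wneg x y u * wpp (u + h) = WC0 x y u * \<theta> (2 * (- x) + 2 * h)"
  unfolding wpp_def wneg_def WC0_def gg_def
  by (simp only: theta_shift theta_sign single_fraction, subst frac_eq_eq, simp add: theta_nonzero, simp add: theta_nonzero, algebra)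

lemma path_C_qpQ:
  "\<theta> (2 * (- (x + h)) + 2 * h) * wex x y u * wqp (x + (y + h)) (u + h)
    + \<theta> (2 * y + 2 * h) * wqp (y - x) u * wpq (x + (y + h)) (u + h) = WCp x y u * \<theta> (y - x + h)" (is "?lhs = ?rhs")
proof -
  have r1: "tH1 * tS0 * tuXY0 * tu3 - tH2 * tS1 * tuXY1 * tu2 + tH1 * tS2 * tuXY2 * tu1 = 0" (is "?r1 = 0")
    using three_term_half_sum [of "u + 2 * h" "h" "x + y" "u - x - y" "u + 3 * h"]
      theta_minus [of \<tau> "h"] theta_minus [of \<tau> "2 * h"] theta_minus [of \<tau> "x + y + h"] theta_minus [of \<tau> "u - x - y + h"]
    by (simp add: algebra_simps)
  define k where "k = tY2 * tDm1 * tu0 * tu4 / (tH1 * tH1 * tH3 * tH3 * tD0 * tS0 * tS1)"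
  have t: "\<theta> (2 * (- (x + h)) + 2 * h) * wex x y u * wqp (x + (y + h)) (u + h) = (- tH1 * tS2 * tuXY2 * tu1) * k"
    "\<theta> (2 * y + 2 * h) * wqp (y - x) u * wpq (x + (y + h)) (u + h) = (- tH1 * tS0 * tuXY0 * tu3) * k"
    "WCp x y u * \<theta> (y - x + h) = (- tH2 * tS1 * tuXY1 * tu2) * k"
    unfolding k_def wpq_def wqp_def wex_def WCp_def gg_def
    by (simp only: theta_shift theta_sign single_fraction, subst frac_eq_eq, simp add: theta_nonzero, simp add: theta_nonzero, algebra)+
  have "?lhs - ?rhs = (- ?r1) * k"
    unfolding t by algebra
  also have "\<dots> = 0"
    by (simp only: r1 mult_zero_right mult_zero_left add_0 diff_0 minus_zero)
  finally show ?thesis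
    by (simp only: right_minus_eq)
qed

lemma path_C_qQp:
  "\<theta> (2 * (- (x + h)) + 2 * h) * wex x y u * wpq (- (y + h) - x) (u + h)
    + \<theta> (2 * y + 2 * h) * wqp (y - x) u * wqp (- (y + h) - x) (u + h) = WC0 x y u * \<theta> (2 * y + 2 * h)" (is "?lhs = ?rhs")
proof -
  have r1: "tH1 * tH1 * tuXY2 * tuxy2 - tS0 * tS0 * tu1 * tu3 + tSm1 * tS1 * tu2 * tu2 = 0" (is "?r1 = 0")
    using three_term_half_sum [of "u + 3 * h" "h" "h" "u - x - y + 2 * h" "u + x + y + 2 * h"]
      theta_minus [of \<tau> "x + y - h"] theta_minus [of \<tau> "x + y"] theta_minus [of \<tau> "u + h"]
    by (simp add: algebra_simps)
  define k where "k = tY2 * tDm1 * tu0 * tu4 / (tH1 * tH1 * tH3 * tH3 * tD0 * tS0 * tS1)"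
  have t: "\<theta> (2 * (- (x + h)) + 2 * h) * wex x y u * wpq (- (y + h) - x) (u + h) = (- tH1 * tH1 * tuXY2 * tuxy2) * k"
    "\<theta> (2 * y + 2 * h) * wqp (y - x) u * wqp (- (y + h) - x) (u + h) = (tS0 * tS0 * tu1 * tu3) * k"
    "WC0 x y u * \<theta> (2 * y + 2 * h) = (tSm1 * tS1 * tu2 * tu2) * k"
    unfolding k_def wpq_def wqp_def wex_def WC0_def gg_def
    by (simp only: theta_shift theta_sign single_fraction, subst frac_eq_eq, simp add: theta_nonzero, simp add: theta_nonzero, algebra)+
  have "?lhs - ?rhs = (- ?r1) * k"
    unfolding t by algebra
  also have "\<dots> = 0"
    by (simp only: r1 mult_zero_right mult_zero_left add_0 diff_0 minus_zero)
  finally show ?thesis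
    by (simp only: right_minus_eq)
qed

lemma path_C_ppP:
  "\<theta> (2 * (x + h) + 2 * h) * wpp u * wdiag (x + h) y (u + h)
    + \<theta> (2 * (- (x + h)) + 2 * h) * wdiag x y u * wneg (- (x + h)) y (u + h)
    + \<theta> (2 * y + 2 * h) * wpq (x - y) u * wex y (x + h) (u + h)
    + \<theta> (2 * (- y) + 2 * h) * wpq (x + y) u * wex (- y) (x + h) (u + h) = 0" (is "?lhs = 0")
proof -
  have r1: "tH1 * tYm2 * tD0 * tS3 - tH3 * tY0 * tD2 * tS1 + tH2 * tY1 * tD3 * tS0 = 0" (is "?r1 = 0")
    using three_term_half_sum [of "x + y + h" "h" "2 * y - 2 * h" "x - y" "x + y + 3 * h"]
      theta_minus [of \<tau> "2 * h"] theta_minus [of \<tau> "3 * h"] theta_minus [of \<tau> "2 * y"] theta_minus [of \<tau> "x - y + 2 * h"]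
    by (simp add: algebra_simps)
  have r2: "tH1 * tYm2 * tDm1 * tS2 - tH3 * tY0 * tD1 * tS0 + tH2 * tY1 * tD2 * tSm1 = 0" (is "?r2 = 0")
    using three_term_half_sum [of "x + y" "h" "2 * y - 2 * h" "x - y - h" "x + y + 2 * h"]
      theta_minus [of \<tau> "2 * h"] theta_minus [of \<tau> "3 * h"] theta_minus [of \<tau> "2 * y"] theta_minus [of \<tau> "x - y + h"]
    by (simp add: algebra_simps)
  have r3: "tH2 * tX2 * tuXY0 * tuXy2 + tDm1 * tS1 * tuXXm1 * tu3 - tD1 * tS3 * tuXX1 * tu1 = 0" (is "?r3 = 0")
    using three_term_half_sum [of "u + 3 * h" "2 * h" "2 * x + 2 * h" "u - x - y" "u - x + y + 2 * h"]
      theta_minus [of \<tau> "x + y + h"] theta_minus [of \<tau> "u - 2 * x - h"]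
    by (simp add: algebra_simps)
  have r4: "tH2 * tX2 * tuXXm2 * tu4 - tH3 * tX3 * tuXXm1 * tu3 + tH1 * tX5 * tuXX1 * tu1 = 0" (is "?r4 = 0")
    using three_term_half_sum [of "u + 3 * h" "2 * h" "2 * x + 2 * h" "u - 2 * x - 2 * h" "u + 4 * h"]
      theta_minus [of \<tau> "h"] theta_minus [of \<tau> "3 * h"] theta_minus [of \<tau> "2 * x + 3 * h"] theta_minus [of \<tau> "u - 2 * x - h"]
    by (simp add: algebra_simps)
  have r5: "tH2 * tD2 * tS2 * tX4 - tH1 * tD1 * tS1 * tX5 - tH1 * tD3 * tS3 * tX3 = 0" (is "?r5 = 0")
    using three_term_half_sum [of "2 * x + 5 * h" "2 * h" "x - y + 2 * h" "x + y + 2 * h" "2 * x + 4 * h"]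
      theta_minus [of \<tau> "h"] theta_minus [of \<tau> "x - y + h"] theta_minus [of \<tau> "x + y + h"]
    by (simp add: algebra_simps)
  have r6: "tY0 * tS1 * tS2 * tXm1 + tH2 * tDm1 * tD0 * txxyy1 - tY2 * tSm1 * tS0 * tX1 = 0" (is "?r6 = 0")
    using three_term_half_sum [of "2 * x + 2 * y + h" "2 * y" "x + y + h" "x + y + 2 * h" "2 * x - h"]
      theta_minus [of \<tau> "x - y - h"] theta_minus [of \<tau> "x - y"]
    by (simp add: algebra_simps)
  have r7: "tY0 * tS0 * tS2 * tX0 + tH1 * tDm1 * tD1 * txxyy1 - tY1 * tSm1 * tS1 * tX1 = 0" (is "?r7 = 0")
    using three_term_half_sum [of "2 * x + 2 * y + h" "2 * y" "x + y" "x + y + 2 * h" "2 * x"]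
      theta_minus [of \<tau> "x - y - h"] theta_minus [of \<tau> "x - y + h"]
    by (simp add: algebra_simps)
  have r8: "tH2 * tX2 * tuXY2 * tuXy0 + tD1 * tSm1 * tuXXm1 * tu3 - tD3 * tS1 * tuXX1 * tu1 = 0" (is "?r8 = 0")
    using three_term_half_sum [of "u + 3 * h" "2 * h" "2 * x + 2 * h" "u - x - y + 2 * h" "u - x + y"]
      theta_minus [of \<tau> "x + y - h"] theta_minus [of \<tau> "u - 2 * x - h"]
    by (simp add: algebra_simps)
  have r9: "tH1 * tY2 * tD2 * tS1 + tH1 * tY0 * tD0 * tS3 - tH2 * tY1 * tD1 * tS2 = 0" (is "?r9 = 0")
    using three_term_half_sum [of "x + y + 3 * h" "h" "2 * y + 2 * h" "x - y + 2 * h" "x + y + h"]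
      theta_minus [of \<tau> "2 * y"] theta_minus [of \<tau> "x - y"]
    by (simp add: algebra_simps)
  have r10: "tH2 * tX2 * tuXX2 * tu0 + tH1 * tXm1 * tuXXm1 * tu3 - tH3 * tX1 * tuXX1 * tu1 = 0" (is "?r10 = 0")
    using three_term_half_sum [of "u + 3 * h" "2 * h" "2 * x + 2 * h" "u - 2 * x + 2 * h" "u"]
      theta_minus [of \<tau> "2 * x - h"] theta_minus [of \<tau> "u - 2 * x - h"]
    by (simp add: algebra_simps)
  define k where "k = tX4 * tu1 * tu3 / (tH1 * tH3 * tH3 * tY0 * tD0 * tD1 * tS0 * tS1 * tX1 * tX2 * tX3)"
  have t: "\<theta> (2 * (x + h) + 2 * h) * wpp u * wdiag (x + h) y (u + h) = (- tY0 * tD0 * tD1 * tS0 * tS1 * tX1 * tX2 * tuXXm2 * tu4 - tY0 * tD0 * tD2 * tS0 * tS2 * tX1 * tX4 * tuXX1 * tu1) * k"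
    "\<theta> (2 * (- (x + h)) + 2 * h) * wdiag x y u * wneg (- (x + h)) y (u + h) = (tY0 * tD0 * tD2 * tS0 * tS2 * tX0 * tX3 * tuXXm1 * tu3 + tY0 * tD1 * tD2 * tS1 * tS2 * tX2 * tX3 * tuXX2 * tu0) * k"
    "\<theta> (2 * y + 2 * h) * wpq (x - y) u * wex y (x + h) (u + h) = (- tH1 * tY2 * tD2 * tS0 * tX1 * tX2 * tX3 * tuXY2 * tuXy0) * k"
    "\<theta> (2 * (- y) + 2 * h) * wpq (x + y) u * wex (- y) (x + h) (u + h) = (- tH1 * tYm2 * tD0 * tS2 * tX1 * tX2 * tX3 * tuXY0 * tuXy2) * k"
    unfolding k_def wpp_def wpq_def wex_def wneg_def wdiag_def
    by (simp only: theta_shift theta_sign single_fraction, subst frac_eq_eq, simp add: theta_nonzero, simp add: theta_nonzero, algebra)+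
  \<comment> \<open>The certificate yields \<theta>(2h) times the sum; this factor is nonzero and is
    cancelled at the end.\<close>
  have "tH2 * (?lhs) = (- tD1 * tS2 * tX1 * tX3 * tuXX1 * tu1 * ?r1
      + tD0 * tS1 * tX1 * tX3 * tuXXm1 * tu3 * ?r2
      - tH1 * tYm2 * tD0 * tS2 * tX1 * tX3 * ?r3
      - tY0 * tD0 * tD1 * tS0 * tS1 * tX1 * ?r4
      - tY0 * tD0 * tS0 * tX1 * tuXX1 * tu1 * ?r5
      - tH1 * tD1 * tD2 * tX3 * tuXXm1 * tu3 * ?r6
      + tH2 * tD0 * tD2 * tX3 * tuXXm1 * tu3 * ?r7
      - tH1 * tY2 * tD2 * tS0 * tX1 * tX3 * ?r8
      - tD3 * tS0 * tX1 * tX3 * tuXX1 * tu1 * ?r9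
      + tY0 * tD1 * tD2 * tS1 * tS2 * tX3 * ?r10) * k"
    unfolding t by algebra
  also have "\<dots> = 0"
    by (simp only: r1 r2 r3 r4 r5 r6 r7 r8 r9 r10 mult_zero_right mult_zero_left add_0 diff_0 minus_zero)
  finally show ?thesis
    using theta_nonzero by (simp only: mult_eq_0_iff right_minus_eq simp_thms)
qed

text \<open>This path is reached from all four paths of the f-vector at \<mu>. One contribution is a
  product of two \<open>wdiag\<close>, each a difference of two products, and therefore splits into
  four terms, which accounts for the length of the certificate.\<close>

lemma path_C_pPp:
  "\<theta> (2 * (x + h) + 2 * h) * wpp u * wneg (x + h) y (u + h)
    + \<theta> (2 * (- (x + h)) + 2 * h) * wdiag x y u * wdiag (- (x + h)) y (u + h)
    + \<theta> (2 * y + 2 * h) * wpq (x - y) u * wex y (- (x + h)) (u + h)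
    + \<theta> (2 * (- y) + 2 * h) * wpq (x + y) u * wex (- y) (- (x + h)) (u + h) = WC0 x y u * \<theta> (2 * x + 2 * h)" (is "?lhs = ?rhs")
proof -
  have r1: "tS2 * tX1 * tuXy0 * tu1 - tH1 * tD0 * tuXXm1 * tuxy2 - tS1 * tX2 * tuXy1 * tu0 = 0" (is "?r1 = 0")
    using three_term_half_sum [of "u + x + y + 2 * h" "x + y + 2 * h" "2 * x + h" "u - x + y" "u + h"]
      theta_minus [of \<tau> "h"] theta_minus [of \<tau> "x - y"] theta_minus [of \<tau> "u - 2 * x - h"]
    by (simp add: algebra_simps)
  have r2: "tYm2 * tX2 * tuXY0 * tuxy4 - tY0 * tX4 * tuXY2 * tuxy2 + tH2 * txxyy2 * tuXy0 * tuxY4 = 0" (is "?r2 = 0")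
    using three_term_half_sum [of "u + x + y + 2 * h" "2 * y - 2 * h" "2 * x + 2 * h" "u - x - y" "u + x + y + 4 * h"]
      theta_minus [of \<tau> "2 * h"] theta_minus [of \<tau> "2 * y"] theta_minus [of \<tau> "2 * x + 4 * h"] theta_minus [of \<tau> "u - x - y + 2 * h"]
    by (simp add: algebra_simps)
  have r3: "tY2 * tS0 * tS0 * tX2 - tH2 * tD0 * tD0 * txxyy2 - tY0 * tS2 * tS2 * tX0 = 0" (is "?r3 = 0")
    using three_term_half_sum [of "2 * x + 2 * y + 2 * h" "2 * y + 2 * h" "x + y" "x + y" "2 * x + 2 * h"]
      theta_minus [of \<tau> "2 * h"] theta_minus [of \<tau> "x - y"]
    by (simp add: algebra_simps)
  have r4: "tS1 * tX2 * tu4 * tuxY3 + tH1 * tD0 * tuXY2 * tuxx5 - tS2 * tX1 * tu3 * tuxY4 = 0" (is "?r4 = 0")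
    using three_term_half_sum [of "u + 2 * x + 5 * h" "x + y + h" "2 * x + 2 * h" "u + 4 * h" "u + x - y + 3 * h"]
      theta_minus [of \<tau> "x - y"] theta_minus [of \<tau> "u - x - y + 2 * h"]
    by (simp add: algebra_simps)
  have r5: "tS0 * tS0 * tu1 * tu3 - tH1 * tH1 * tuXY2 * tuxy2 - tSm1 * tS1 * tu2 * tu2 = 0" (is "?r5 = 0")
    using three_term_half_sum [of "u + x + y + 2 * h" "x + y" "x + y" "u + h" "u + 3 * h"]
      theta_minus [of \<tau> "h"] theta_minus [of \<tau> "u - x - y + 2 * h"]
    by (simp add: algebra_simps)
  have r6: "tS1 * tX2 * tu4 * tuxY3 + tH1 * tD0 * tuXY2 * tuxx5 - tS2 * tX1 * tu3 * tuxY4 = 0" (is "?r6 = 0")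
    using three_term_half_sum [of "u + 2 * x + 5 * h" "x + y + h" "2 * x + 2 * h" "u + 4 * h" "u + x - y + 3 * h"]
      theta_minus [of \<tau> "x - y"] theta_minus [of \<tau> "u - x - y + 2 * h"]
    by (simp add: algebra_simps)
  have r7: "tD1 * tD1 * tuXX2 * tuxx2 - tX0 * tX0 * tuXy1 * tuxY3 + tSm1 * txxxY1 * tu2 * tu2 = 0" (is "?r7 = 0")
    using three_term_half_sum [of "u + x - y + 3 * h" "x - y + h" "x - y + h" "u - 2 * x + 2 * h" "u + 2 * x + 2 * h"]
      theta_minus [of \<tau> "x + y - h"] theta_minus [of \<tau> "2 * x"] theta_minus [of \<tau> "u - x + y + h"]
    by (simp add: algebra_simps)
  have r8: "tD1 * tS0 * tu3 * tuxx2 - tD0 * tSm1 * tu2 * tuxx3 - tH1 * tX0 * tuxY3 * tuxy2 = 0" (is "?r8 = 0")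
    using three_term_half_sum [of "u + 2 * x + 3 * h" "x - y + h" "x + y" "u + 3 * h" "u + 2 * x + 2 * h"]
      theta_minus [of \<tau> "x - y"] theta_minus [of \<tau> "x + y - h"] theta_minus [of \<tau> "u + 2 * h"]
    by (simp add: algebra_simps)
  have r9: "tX2 * tX2 * tu2 * tu4 - tH1 * tH1 * tuXX1 * tuxx5 - tX1 * tX3 * tu3 * tu3 = 0" (is "?r9 = 0")
    using three_term_half_sum [of "u + 2 * x + 5 * h" "2 * x + 2 * h" "2 * x + 2 * h" "u + 2 * h" "u + 4 * h"]
      theta_minus [of \<tau> "h"] theta_minus [of \<tau> "u - 2 * x + h"]
    by (simp add: algebra_simps)
  have r10: "tD1 * tS0 * tuXX2 * tu1 - tD0 * tSm1 * tuXX1 * tu2 - tH1 * tX0 * tuXY2 * tuXy1 = 0" (is "?r10 = 0")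
    using three_term_half_sum [of "u + 2 * h" "x - y + h" "x + y" "u - 2 * x + 2 * h" "u + h"]
      theta_minus [of \<tau> "x - y"] theta_minus [of \<tau> "x + y - h"] theta_minus [of \<tau> "u - 2 * x + h"]
    by (simp add: algebra_simps)
  have r11: "tX2 * tX2 * tu2 * tu4 - tH1 * tH1 * tuXX1 * tuxx5 - tX1 * tX3 * tu3 * tu3 = 0" (is "?r11 = 0")
    using three_term_half_sum [of "u + 2 * x + 5 * h" "2 * x + 2 * h" "2 * x + 2 * h" "u + 2 * h" "u + 4 * h"]
      theta_minus [of \<tau> "h"] theta_minus [of \<tau> "u - 2 * x + h"]
    by (simp add: algebra_simps)
  have r12: "tDm1 * tD1 * tX1 * tX1 + tH1 * tH1 * tS1 * txxxY1 - tD0 * tD0 * tX0 * tX2 = 0" (is "?r12 = 0")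
    using three_term_half_sum [of "3 * x - y + h" "x - y - h" "x - y + h" "2 * x + h" "2 * x + h"]
      theta_minus [of \<tau> "h"] theta_minus [of \<tau> "x + y + h"]
    by (simp add: algebra_simps)
  have r13: "tDm1 * tD1 * tX1 * tX1 + tH1 * tH1 * tS1 * txxxY1 - tD0 * tD0 * tX0 * tX2 = 0" (is "?r13 = 0")
    using three_term_half_sum [of "3 * x - y + h" "x - y - h" "x - y + h" "2 * x + h" "2 * x + h"]
      theta_minus [of \<tau> "h"] theta_minus [of \<tau> "x + y + h"]
    by (simp add: algebra_simps)
  have r14: "tX1 * tX4 * tu1 * tu2 + tH1 * tH2 * tuXXm1 * tuxx4 - tX2 * tX3 * tu0 * tu3 = 0" (is "?r14 = 0")
    using three_term_half_sum [of "u + 2 * x + 4 * h" "2 * x + h" "2 * x + 4 * h" "u + h" "u + 2 * h"]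
      theta_minus [of \<tau> "2 * h"] theta_minus [of \<tau> "u - 2 * x - h"]
    by (simp add: algebra_simps)
  have r15: "tS0 * tS0 * tu1 * tu3 - tH1 * tH1 * tuXY2 * tuxy2 - tSm1 * tS1 * tu2 * tu2 = 0" (is "?r15 = 0")
    using three_term_half_sum [of "u + x + y + 2 * h" "x + y" "x + y" "u + h" "u + 3 * h"]
      theta_minus [of \<tau> "h"] theta_minus [of \<tau> "u - x - y + 2 * h"]
    by (simp add: algebra_simps)
  have r16: "tH1 * tX2 * tu4 * tuxx3 + tH1 * tX0 * tu2 * tuxx5 - tH2 * tX1 * tu3 * tuxx4 = 0" (is "?r16 = 0")
    using three_term_half_sum [of "u + 2 * x + 5 * h" "h" "2 * x + 2 * h" "u + 4 * h" "u + 2 * x + 3 * h"]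
      theta_minus [of \<tau> "2 * x"] theta_minus [of \<tau> "u + 2 * h"]
    by (simp add: algebra_simps)
  define k where "k = 1 / (tH1 * tH1 * tH3 * tH3 * tY0 * tD0 * tD1 * tS0 * tS1 * tX1 * tX1 * tX2)"
  have t: "\<theta> (2 * (x + h) + 2 * h) * wpp u * wneg (x + h) y (u + h) = (tY0 * tD0 * tD0 * tS0 * tS0 * tX0 * tX1 * tX1 * tX4 * tu1 * tu1 * tu3 * tu3) * k"
    "\<theta> (2 * (- (x + h)) + 2 * h) * wdiag x y u * wdiag (- (x + h)) y (u + h) = (tH1 * tH1 * tY0 * tD0 * tD1 * tS0 * tS1 * tX0 * tX2 * tuXXm1 * tu3 * tu4 * tuxx2 + tH1 * tH1 * tY0 * tD0 * tD0 * tS0 * tS0 * tX0 * tX0 * tuXXm1 * tu1 * tu3 * tuxx5 + tH1 * tH1 * tY0 * tD1 * tD1 * tS1 * tS1 * tX2 * tX2 * tuXX2 * tu0 * tu4 * tuxx2 + tH1 * tH1 * tY0 * tD0 * tD1 * tS0 * tS1 * tX0 * tX2 * tuXX2 * tu0 * tu1 * tuxx5) * k"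
    "\<theta> (2 * y + 2 * h) * wpq (x - y) u * wex y (- (x + h)) (u + h) = (- tH1 * tH1 * tY2 * tS0 * tS0 * tX0 * tX1 * tX1 * tX2 * tuXy0 * tu1 * tu3 * tuxY4) * k"
    "\<theta> (2 * (- y) + 2 * h) * wpq (x + y) u * wex (- y) (- (x + h)) (u + h) = (- tH1 * tH1 * tYm2 * tD0 * tD0 * tX0 * tX1 * tX1 * tX2 * tuXY0 * tu1 * tu3 * tuxy4) * k"
    "WC0 x y u * \<theta> (2 * x + 2 * h) = (tY0 * tDm1 * tD1 * tSm1 * tS1 * tX1 * tX1 * tX2 * tX2 * tu0 * tu2 * tu2 * tu4) * k"
    unfolding k_def wpp_def wpq_def wex_def wneg_def wdiag_def WC0_def gg_def
    by (simp only: theta_shift theta_sign single_fraction, subst frac_eq_eq, simp add: theta_nonzero, simp add: theta_nonzero, algebra)+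
  \<comment> \<open>The relations \<open>r6\<close>, \<open>r11\<close>, \<open>r13\<close>,
    \<open>r15\<close> repeat \<open>r4\<close>, \<open>r9\<close>, \<open>r12\<close>,
    \<open>r5\<close>: they enter a second time with other cofactors.\<close>
  have "?lhs - ?rhs = (- tH1 * tH1 * tY0 * tS2 * tX0 * tX0 * tX1 * tu3 * tuxY4 * ?r1
      - tH1 * tH1 * tD0 * tD0 * tX0 * tX1 * tX1 * tu1 * tu3 * ?r2
      - tH1 * tH1 * tX0 * tX1 * tX1 * tuXy0 * tu1 * tu3 * tuxY4 * ?r3
      + tH1 * tH1 * tH1 * tY0 * tD0 * tX0 * tX0 * tuXXm1 * tuxy2 * ?r4
      + tH1 * tH1 * tY0 * tD0 * tD0 * tX0 * tX0 * tuXXm1 * tuxx5 * ?r5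
      + tH1 * tH1 * tY0 * tS1 * tX0 * tX0 * tX2 * tuXy1 * tu0 * ?r6
      + tH1 * tH1 * tY0 * tS1 * tS1 * tX2 * tX2 * tu0 * tu4 * ?r7
      + tH1 * tH1 * tY0 * tD0 * tS1 * tX0 * tX2 * tuXXm1 * tu4 * ?r8
      - tY0 * tDm1 * tD1 * tSm1 * tS1 * tX1 * tX1 * tu0 * tu2 * ?r9
      + tH1 * tH1 * tY0 * tD0 * tS1 * tX0 * tX2 * tu0 * tuxx5 * ?r10
      - tH1 * tH1 * tY0 * tSm1 * tS1 * tS1 * txxxY1 * tu0 * tu2 * ?r11
      - tH1 * tH1 * tY0 * tSm1 * tS1 * tuXX1 * tu0 * tu2 * tuxx5 * ?r12
      - tY0 * tSm1 * tS1 * tX1 * tX3 * tu0 * tu2 * tu3 * tu3 * ?r13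
      + tY0 * tD0 * tD0 * tSm1 * tS1 * tX0 * tX1 * tu2 * tu3 * ?r14
      + tY0 * tD0 * tD0 * tX0 * tX1 * tX1 * tX4 * tu1 * tu3 * ?r15
      + tH1 * tY0 * tD0 * tD0 * tSm1 * tS1 * tX0 * tuXXm1 * tu2 * ?r16) * k"
    unfolding t by algebra
  also have "\<dots> = 0"
    by (simp only: r1 r2 r3 r4 r5 r6 r7 r8 r9 r10 r11 r12 r13 r14 r15 r16 mult_zero_right mult_zero_left add_0 diff_0 minus_zero)
  finally show ?thesis
    by (simp only: right_minus_eq)
qed

lemma path_C_pqQ:
  "\<theta> (2 * (x + h) + 2 * h) * wpp u * wex (x + h) y (u + h)
    + \<theta> (2 * (- (x + h)) + 2 * h) * wdiag x y u * wex (- (x + h)) y (u + h)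
    + \<theta> (2 * y + 2 * h) * wpq (x - y) u * wdiag y (x + h) (u + h)
    + \<theta> (2 * (- y) + 2 * h) * wpq (x + y) u * wneg (- y) (x + h) (u + h) = WCp x y u * \<theta> (x - y + h)" (is "?lhs = ?rhs")
proof -
  have r1: "tH1 * tY2 * tD0 * tSm1 + tH1 * tY0 * tDm2 * tS1 - tH2 * tY1 * tDm1 * tS0 = 0" (is "?r1 = 0")
    using three_term_half_sum [of "x + y + h" "h" "2 * y + 2 * h" "x - y" "x + y - h"]
      theta_minus [of \<tau> "2 * y"] theta_minus [of \<tau> "x - y - 2 * h"]
    by (simp add: algebra_simps)
  have r2: "tH2 * tX2 * tuYY3 * tu1 + tD1 * tSm1 * tuXY0 * tuxY4 - tD3 * tS1 * tuXY2 * tuxY2 = 0" (is "?r2 = 0")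
    using three_term_half_sum [of "u + x - y + 4 * h" "2 * h" "2 * x + 2 * h" "u - 2 * y + 3 * h" "u + h"]
      theta_minus [of \<tau> "x + y - h"] theta_minus [of \<tau> "u - x - y"]
    by (simp add: algebra_simps)
  have r3: "tH2 * tX2 * tuYY0 * tu4 + tDm2 * tS2 * tuXY0 * tuxY4 - tD0 * tS4 * tuXY2 * tuxY2 = 0" (is "?r3 = 0")
    using three_term_half_sum [of "u + x - y + 4 * h" "2 * h" "2 * x + 2 * h" "u - 2 * y" "u + 4 * h"]
      theta_minus [of \<tau> "x + y + 2 * h"] theta_minus [of \<tau> "u - x - y"]
    by (simp add: algebra_simps)
  have r4: "tH1 * tY2 * tD3 * tS2 + tH1 * tY0 * tD1 * tS4 - tH2 * tY1 * tD2 * tS3 = 0" (is "?r4 = 0")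
    using three_term_half_sum [of "x + y + 4 * h" "h" "2 * y + 2 * h" "x - y + 3 * h" "x + y + 2 * h"]
      theta_minus [of \<tau> "2 * y"] theta_minus [of \<tau> "x - y + h"]
    by (simp add: algebra_simps)
  have r5: "tY0 * tX3 * tu0 * tu3 + tD0 * tD3 * tuXY0 * tuxy3 - tS0 * tS3 * tuXy0 * tuxY3 = 0" (is "?r5 = 0")
    using three_term_half_sum [of "u + x + y + 3 * h" "2 * y" "2 * x + 3 * h" "u" "u + 3 * h"]
      theta_minus [of \<tau> "x - y + 3 * h"] theta_minus [of \<tau> "u - x - y"]
    by (simp add: algebra_simps)
  have r6: "tH1 * tX2 * tuXX2 * tu1 + tH1 * tX0 * tuXX0 * tu3 - tH2 * tX1 * tuXX1 * tu2 = 0" (is "?r6 = 0")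
    using three_term_half_sum [of "u + 3 * h" "h" "2 * x + 2 * h" "u - 2 * x + 2 * h" "u + h"]
      theta_minus [of \<tau> "2 * x"] theta_minus [of \<tau> "u - 2 * x"]
    by (simp add: algebra_simps)
  have r7: "tD1 * tX2 * tuXY1 * tu4 - tH1 * tS2 * tuXX1 * tuxY4 - tD0 * tX3 * tuXY2 * tu3 = 0" (is "?r7 = 0")
    using three_term_half_sum [of "u + x - y + 4 * h" "x - y + h" "2 * x + 2 * h" "u - x - y + h" "u + 4 * h"]
      theta_minus [of \<tau> "h"] theta_minus [of \<tau> "x + y + 2 * h"] theta_minus [of \<tau> "u - 2 * x + h"]
    by (simp add: algebra_simps)
  have r8: "tH1 * tS2 * tu3 * tuxy2 + tH1 * tS0 * tu1 * tuxy4 - tH2 * tS1 * tu2 * tuxy3 = 0" (is "?r8 = 0")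
    using three_term_half_sum [of "u + x + y + 4 * h" "h" "x + y + 2 * h" "u + 3 * h" "u + x + y + 2 * h"]
      theta_minus [of \<tau> "x + y"] theta_minus [of \<tau> "u + h"]
    by (simp add: algebra_simps)
  have r9: "tY0 * tX4 * tu1 * tu3 + tD1 * tD3 * tuXY0 * tuxy4 - tS1 * tS3 * tuXy0 * tuxY4 = 0" (is "?r9 = 0")
    using three_term_half_sum [of "u + x + y + 4 * h" "2 * y" "2 * x + 4 * h" "u + h" "u + 3 * h"]
      theta_minus [of \<tau> "x - y + 3 * h"] theta_minus [of \<tau> "u - x - y"]
    by (simp add: algebra_simps)
  have r10: "tH1 * tD0 * tu1 * tuxY4 - tH2 * tD1 * tu2 * tuxY3 + tH1 * tD2 * tu3 * tuxY2 = 0" (is "?r10 = 0")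
    using three_term_half_sum [of "u + x - y + 3 * h" "h" "x - y" "u + h" "u + x - y + 4 * h"]
      theta_minus [of \<tau> "h"] theta_minus [of \<tau> "2 * h"] theta_minus [of \<tau> "x - y + h"] theta_minus [of \<tau> "u + 2 * h"]
    by (simp add: algebra_simps)
  have r11: "tH2 * txxYY2 * tu1 * tu3 + tDm1 * tD1 * tuXy0 * tuxY4 - tD1 * tD3 * tuXy2 * tuxY2 = 0" (is "?r11 = 0")
    using three_term_half_sum [of "u + x - y + 4 * h" "2 * h" "2 * x - 2 * y + 2 * h" "u + h" "u + 3 * h"]
      theta_minus [of \<tau> "x - y + h"] theta_minus [of \<tau> "u - x + y"]
    by (simp add: algebra_simps)
  have r12: "tD2 * tD2 * tu1 * tu3 - tH1 * tH1 * tuXy0 * tuxY4 - tD1 * tD3 * tu2 * tu2 = 0" (is "?r12 = 0")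
    using three_term_half_sum [of "u + x - y + 4 * h" "x - y + 2 * h" "x - y + 2 * h" "u + h" "u + 3 * h"]
      theta_minus [of \<tau> "h"] theta_minus [of \<tau> "u - x + y"]
    by (simp add: algebra_simps)
  have r13: "tYm2 * tD0 * tD0 * tX2 - tY0 * tD2 * tD2 * tX0 + tH2 * tS0 * tS0 * txxYY2 = 0" (is "?r13 = 0")
    using three_term_half_sum [of "2 * x" "2 * y - 2 * h" "x - y" "x - y" "2 * x + 2 * h"]
      theta_minus [of \<tau> "2 * h"] theta_minus [of \<tau> "2 * y"] theta_minus [of \<tau> "x - y + 2 * h"]
    by (simp add: algebra_simps)
  have r14: "tD0 * tS0 * tuXXm1 * tu1 - tD1 * tS1 * tuXX0 * tu0 + tH1 * tX1 * tuXY0 * tuXy0 = 0" (is "?r14 = 0")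
    using three_term_half_sum [of "u" "x - y" "x + y" "u - 2 * x - h" "u + h"]
      theta_minus [of \<tau> "h"] theta_minus [of \<tau> "x - y + h"] theta_minus [of \<tau> "x + y + h"] theta_minus [of \<tau> "u - 2 * x"]
    by (simp add: algebra_simps)
  have r15: "tD0 * tD0 * tuXY2 * tuxy2 - tS0 * tS0 * tuXy2 * tuxY2 + tY0 * tX0 * tu2 * tu2 = 0" (is "?r15 = 0")
    using three_term_half_sum [of "u + x - y + 2 * h" "x - y" "x - y" "u - x - y + 2 * h" "u + x + y + 2 * h"]
      theta_minus [of \<tau> "2 * y"] theta_minus [of \<tau> "x + y"] theta_minus [of \<tau> "u - x + y + 2 * h"]
    by (simp add: algebra_simps)
  define k where "k = tY2 / (tH1 * tH1 * tH3 * tH3 * tY0 * tY1 * tD0 * tD1 * tS0 * tS1 * tX1 * tX2)"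
  have t: "\<theta> (2 * (x + h) + 2 * h) * wpp u * wex (x + h) y (u + h) = (tH1 * tY0 * tY1 * tD0 * tD0 * tS0 * tX1 * tX4 * tuXY2 * tu1 * tu1 * tu3) * k"
    "\<theta> (2 * (- (x + h)) + 2 * h) * wdiag x y u * wex (- (x + h)) y (u + h) = (tH1 * tH1 * tY0 * tY1 * tD0 * tS0 * tS2 * tX0 * tuXXm1 * tu1 * tu3 * tuxY4 + tH1 * tH1 * tY0 * tY1 * tD1 * tS1 * tS2 * tX2 * tuXX2 * tu0 * tu1 * tuxY4) * k"
    "\<theta> (2 * y + 2 * h) * wpq (x - y) u * wdiag y (x + h) (u + h) = (tH1 * tH1 * tY0 * tD1 * tS0 * tS1 * tX1 * tX2 * tuXy0 * tuYY0 * tu3 * tu4 + tH1 * tH1 * tY2 * tD0 * tS0 * tS2 * tX1 * tX2 * tuXy0 * tuYY3 * tu1 * tu3) * k"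
    "\<theta> (2 * (- y) + 2 * h) * wpq (x + y) u * wneg (- y) (x + h) (u + h) = (tH1 * tYm2 * tY1 * tD0 * tD0 * tS2 * tX1 * tX2 * tuXY0 * tu1 * tu3 * tu3) * k"
    "WCp x y u * \<theta> (x - y + h) = (tH2 * tY0 * tY1 * tD1 * tD1 * tS1 * tX1 * tX2 * tuXY1 * tu0 * tu2 * tu4) * k"
    unfolding k_def wpp_def wpq_def wex_def wneg_def wdiag_def WCp_def gg_def
    by (simp only: theta_shift theta_sign single_fraction, subst frac_eq_eq, simp add: theta_nonzero, simp add: theta_nonzero, algebra)+
  have "tH2 * (?lhs - ?rhs) = (- tH1 * tD1 * tS0 * tS2 * tX1 * tuXY0 * tuXy0 * tu3 * tuxY4 * ?r1
      + tH1 * tH1 * tY2 * tD0 * tS0 * tS2 * tX1 * tuXy0 * tu3 * ?r2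
      + tH1 * tH1 * tY0 * tD1 * tS0 * tS1 * tX1 * tuXy0 * tu3 * ?r3
      + tH1 * tD0 * tS0 * tS1 * tX1 * tuXY2 * tuXy0 * tu3 * tuxY2 * ?r4
      - tH2 * tH2 * tY1 * tD0 * tD1 * tS1 * tX1 * tuXY2 * tu2 * ?r5
      + tH1 * tH2 * tY0 * tY1 * tD1 * tS1 * tS2 * tu0 * tuxY4 * ?r6
      - tH2 * tH2 * tY0 * tY1 * tD1 * tS1 * tX1 * tu0 * tu2 * ?r7
      - tH2 * tY1 * tD0 * tD0 * tD1 * tD3 * tX1 * tuXY0 * tuXY2 * ?r8
      + tH1 * tH2 * tY1 * tD0 * tD0 * tS0 * tX1 * tuXY2 * tu1 * ?r9
      + tH2 * tY1 * tD0 * tS0 * tS1 * tS3 * tX1 * tuXY2 * tuXy0 * ?r10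
      - tH1 * tH2 * tY1 * tS0 * tS0 * tS2 * tX1 * tuXY0 * tu3 * ?r11
      + tH1 * tH2 * tY0 * tY1 * tS2 * tX0 * tX1 * tuXY0 * tu3 * ?r12
      + tH1 * tH2 * tY1 * tS2 * tX1 * tuXY0 * tu1 * tu3 * tu3 * ?r13
      + tH1 * tH1 * tH2 * tY0 * tY1 * tS2 * tX0 * tu3 * tuxY4 * ?r14
      + tH1 * tH2 * tY1 * tD1 * tD3 * tS2 * tX1 * tuXY0 * tu3 * ?r15) * k"
    unfolding t by algebra
  also have "\<dots> = 0"
    by (simp only: r1 r2 r3 r4 r5 r6 r7 r8 r9 r10 r11 r12 r13 r14 r15 mult_zero_right mult_zero_left add_0 diff_0 minus_zero)
  finally show ?thesis
    using theta_nonzero by (simp only: mult_eq_0_iff right_minus_eq simp_thms)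
qed

section \<open>The second row: identities for the weights of type (2,2)\<close>

lemma sum_step_0:
  "\<theta> (x - y + h) * WC0 y (x + h) (u - h) * WC0 x y u
    + \<theta> (y - x + h) * WCp x (- (y + h)) (u - h) * WB0 y x u = V0 x y u * \<theta> (x - y + h)" (is "?lhs = ?rhs")
proof -
  have r1: "tDm1 * tD2 * tu1 * tu2 + tH1 * tH2 * tuXy1 * tuxY2 - tD0 * tD1 * tu0 * tu3 = 0" (is "?r1 = 0")
    using three_term_half_sum [of "u + x - y + 2 * h" "x - y - h" "x - y + 2 * h" "u + h" "u + 2 * h"]
      theta_minus [of \<tau> "2 * h"] theta_minus [of \<tau> "u - x + y + h"]
    by (simp add: algebra_simps)
  define k where "k = tSm1 * tum1 * tu0 * tu1 * tu2 * tu3 * tu4 / (tH1 * tH1 * tH1 * tH1 * tH3 * tH3 * tH3 * tH3 * tD0 * tS1)"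
  have t: "\<theta> (x - y + h) * WC0 y (x + h) (u - h) * WC0 x y u = (tDm1 * tD2 * tu1 * tu2) * k"
    "\<theta> (y - x + h) * WCp x (- (y + h)) (u - h) * WB0 y x u = (tH1 * tH2 * tuXy1 * tuxY2) * k"
    "V0 x y u * \<theta> (x - y + h) = (tD0 * tD1 * tu0 * tu3) * k"
    unfolding k_def V0_def WB0_def WC0_def WCp_def gg_def
    by (simp only: theta_shift theta_sign single_fraction, subst frac_eq_eq, simp add: theta_nonzero, simp add: theta_nonzero, algebra)+
  have "?lhs - ?rhs = (?r1) * k"
    unfolding t by algebra
  also have "\<dots> = 0"
    by (simp only: r1 mult_zero_right mult_zero_left add_0 diff_0 minus_zero)
  finally show ?thesis
    by (simp only: right_minus_eq)
qed

lemma sum_step_p: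
  "\<theta> (x - y + h) * WC0 y (x + h) (u - h) * WCp x y u
    + \<theta> (y - x + h) * WCp x (- (y + h)) (u - h) * WBp y x u = V1 x y u * \<theta> (2 * (- (y + h)) + 2 * h)" (is "?lhs = ?rhs")
proof -
  have r1: "tH2 * tS2 * tuXy1 * tuYY1 + tY0 * tD0 * tuXYm1 * tu3 - tY2 * tD2 * tuXY1 * tu1 = 0" (is "?r1 = 0")
    using three_term_half_sum [of "u + 3 * h" "2 * h" "x + y + 2 * h" "u - x + y + h" "u - 2 * y + h"]
      theta_minus [of \<tau> "x - y"] theta_minus [of \<tau> "u - x - y - h"]
    by (simp add: algebra_simps)
  define k where "k = tH2 * tum1 * tu0 * tu1 * tu2 * tu3 * tu4 / (tH1 * tH1 * tH1 * tH1 * tH3 * tH3 * tH3 * tH3 * tD0 * tS1)"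
  have t: "\<theta> (x - y + h) * WC0 y (x + h) (u - h) * WCp x y u = (tY2 * tD2 * tuXY1 * tu1) * k"
    "\<theta> (y - x + h) * WCp x (- (y + h)) (u - h) * WBp y x u = (- tH2 * tS2 * tuXy1 * tuYY1) * k"
    "V1 x y u * \<theta> (2 * (- (y + h)) + 2 * h) = (tY0 * tD0 * tuXYm1 * tu3) * k"
    unfolding k_def V1_def WBp_def WC0_def WCp_def gg_def
    by (simp only: theta_shift theta_sign single_fraction, subst frac_eq_eq, simp add: theta_nonzero, simp add: theta_nonzero, algebra)+
  have "?lhs - ?rhs = (- ?r1) * k"
    unfolding t by algebra
  also have "\<dots> = 0"
    by (simp only: r1 mult_zero_right mult_zero_left add_0 diff_0 minus_zero)
  finally show ?thesis
    by (simp only: right_minus_eq)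
qed

text \<open>These contributions belong to paths with last steps q, q, which occur in no
  f-vector.\<close>

lemma sum_step_m:
  "\<theta> (x - y + h) * WC0 y (x + h) (u - h) * WCp x (- y) u
    + \<theta> (y - x + h) * WCp x (- (y + h)) (u - h) * WBm y x u = 0" (is "?lhs = 0")
proof -
  define k where "k = tH2 * tYm2 * tD2 * tuXy1 * tum1 * tu0 * tu1 * tu1 * tu2 * tu3 * tu4 / (tH1 * tH1 * tH1 * tH1 * tH3 * tH3 * tH3 * tH3 * tD0 * tS1)"
  have t: "\<theta> (x - y + h) * WC0 y (x + h) (u - h) * WCp x (- y) u = (- 1) * k"
    "\<theta> (y - x + h) * WCp x (- (y + h)) (u - h) * WBm y x u = (1) * k"
    unfolding k_def WBm_def WC0_def WCp_def gg_def
    by (simp only: theta_shift theta_sign single_fraction, subst frac_eq_eq, simp add: theta_nonzero, simp add: theta_nonzero, algebra)+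
  have "?lhs = 0"
    unfolding t by algebra
  then show ?thesis .
qed

text \<open>The last step -p arises through case A alone. The result must contain the same
  \<open>V1\<close> as \<open>sum_step_p\<close>, since p, -p and -q, q are paths of the same vector
  \<open>f \<nu> \<nu>\<close>.\<close>

lemma sum_step_A:
  "\<theta> (x - y + h) * WCp y (x + h) (u - h) * WA u = V1 x y u * \<theta> (2 * (x + h) + 2 * h)"
  unfolding V1_def WA_def WCp_def gg_def
  by (simp only: theta_shift theta_sign single_fraction, subst frac_eq_eq, simp add: theta_nonzero, simp add: theta_nonzero, algebra)

text \<open>The coefficient of paths with last steps p, -p in the image of
  \<open>f l l \<odot> f l l\<close>. The terms \<open>RR\<close> are placed on the left, so that
  solving for the first three terms gives \<open>V22\<close> times \<theta>(2x + 2h).\<close>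

lemma zero_step_0:
  "\<theta> (2 * x + 2 * h) * WC0 (- (x + h)) y (u - h) * WC0 x y u
    + \<theta> (2 * y + 2 * h) * WCp (- (y + h)) x (u - h) * WB0 y x u
    + \<theta> (2 * (- y) + 2 * h) * WCp (- (- y + h)) x (u - h) * WB0 (- y) x u
    + VQ u * RR x y * \<theta> (2 * x + 2 * h)
    + VQ u * RR x (- y) * \<theta> (2 * x + 2 * h) = V3 u * \<theta> (2 * x + 2 * h)" (is "?lhs = ?rhs")
proof -
  have r1: "tS0 * tS1 * tu0 * tu3 - tH1 * tH2 * tuXY1 * tuxy2 - tSm1 * tS2 * tu1 * tu2 = 0" (is "?r1 = 0")
    using three_term_half_sum [of "u + x + y + 2 * h" "x + y" "x + y + h" "u" "u + 3 * h"]
      theta_minus [of \<tau> "h"] theta_minus [of \<tau> "2 * h"] theta_minus [of \<tau> "u - x - y + h"]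
    by (simp add: algebra_simps)
  have r2: "tH3 * tY0 * tD1 * tS0 - tH1 * tYm2 * tDm1 * tS2 - tH2 * tY1 * tD2 * tSm1 = 0" (is "?r2 = 0")
    using three_term_half_sum [of "x + y + 2 * h" "3 * h" "2 * y" "x - y + h" "x + y"]
      theta_minus [of \<tau> "h"] theta_minus [of \<tau> "2 * y - 2 * h"] theta_minus [of \<tau> "x - y - h"]
    by (simp add: algebra_simps)
  have r3: "tH1 * tY0 * tDm1 * tS2 - tH2 * tY1 * tD0 * tS1 + tH1 * tY2 * tD1 * tS0 = 0" (is "?r3 = 0")
    using three_term_half_sum [of "x + y + h" "h" "2 * y" "x - y - h" "x + y + 2 * h"]
      theta_minus [of \<tau> "h"] theta_minus [of \<tau> "2 * h"] theta_minus [of \<tau> "2 * y + h"] theta_minus [of \<tau> "x - y"]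
    by (simp add: algebra_simps)
  have r4: "tH1 * tH2 * tuXy1 * tuxY2 - tD0 * tD1 * tu0 * tu3 + tDm1 * tD2 * tu1 * tu2 = 0" (is "?r4 = 0")
    using three_term_half_sum [of "u + 3 * h" "h" "2 * h" "u - x + y + h" "u + x - y + 2 * h"]
      theta_minus [of \<tau> "x - y - h"] theta_minus [of \<tau> "x - y"] theta_minus [of \<tau> "x - y + h"] theta_minus [of \<tau> "u"]
    by (simp add: algebra_simps)
  define k where "k = tX2 * tum1 * tu0 * tu1 * tu2 * tu3 * tu4 / (tH1 * tH1 * tH1 * tH1 * tH1 * tH3 * tH3 * tH3 * tH3 * tY0 * tDm1 * tD0 * tD1 * tSm1 * tS0 * tS1)"
  have t: "\<theta> (2 * x + 2 * h) * WC0 (- (x + h)) y (u - h) * WC0 x y u = (tH1 * tY0 * tDm1 * tDm1 * tD2 * tSm1 * tSm1 * tS2 * tu1 * tu2) * k"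
    "\<theta> (2 * y + 2 * h) * WCp (- (y + h)) x (u - h) * WB0 y x u = (- tH1 * tH1 * tH2 * tY2 * tD1 * tSm1 * tSm1 * tS0 * tuXy1 * tuxY2) * k"
    "\<theta> (2 * (- y) + 2 * h) * WCp (- (- y + h)) x (u - h) * WB0 (- y) x u = (- tH1 * tH1 * tH2 * tYm2 * tDm1 * tDm1 * tD0 * tS1 * tuXY1 * tuxy2) * k"
    "VQ u * RR x y * \<theta> (2 * x + 2 * h) = (tH1 * tY2 * tD0 * tD1 * tD1 * tSm1 * tSm1 * tS0 * tu0 * tu3) * k"
    "VQ u * RR x (- y) * \<theta> (2 * x + 2 * h) = (tH1 * tYm2 * tDm1 * tDm1 * tD0 * tS0 * tS1 * tS1 * tu0 * tu3) * k"
    "V3 u * \<theta> (2 * x + 2 * h) = (tH3 * tY0 * tDm1 * tD0 * tD1 * tSm1 * tS0 * tS1 * tu1 * tu2) * k"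
    unfolding k_def V3_def VQ_def RR_def WB0_def WC0_def WCp_def gg_def
    by (simp only: theta_shift theta_sign single_fraction, subst frac_eq_eq, simp add: theta_nonzero, simp add: theta_nonzero, algebra)+
  have "?lhs - ?rhs = (tH1 * tYm2 * tDm1 * tDm1 * tD0 * tS1 * ?r1
      - tDm1 * tD0 * tSm1 * tS1 * tu1 * tu2 * ?r2
      + tDm1 * tD2 * tSm1 * tSm1 * tu1 * tu2 * ?r3
      - tH1 * tY2 * tD1 * tSm1 * tSm1 * tS0 * ?r4) * k"
    unfolding t by algebra
  also have "\<dots> = 0"
    by (simp only: r1 r2 r3 r4 mult_zero_right mult_zero_left add_0 diff_0 minus_zero)
  finally show ?thesis
    by (simp only: right_minus_eq)
qed

text \<open>For \<nu> = l + hat p + hat q, the paths with last steps -q, -p and -p, -q occur in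
  \<open>f \<nu> l\<close> in the ratio of \<theta>(x - y + h) to \<theta>(y - x + h). The lemma is
  this proportion for the image, multiplied out; it places the image in the span without a closed
  form for the off-diagonal weight.\<close>

lemma zero_step_p:
  "\<theta> (2 * x + 2 * h) * WC0 (- (x + h)) y (u - h) * WCp x y u * \<theta> (y - x + h)
    + \<theta> (2 * y + 2 * h) * WCp (- (y + h)) x (u - h) * WBp y x u * \<theta> (y - x + h)
    + \<theta> (2 * (- y) + 2 * h) * WCp (- (- y + h)) x (u - h) * WBm (- y) x u * \<theta> (y - x + h) = \<theta> (2 * y + 2 * h) * WC0 (- (y + h)) x (u - h) * WCp y x u * \<theta> (x - y + h) + \<theta> (2 * x + 2 * h) * WCp (- (x + h)) y (u - h) * WBp x y u * \<theta> (x - y + h) + \<theta> (2 * (- x) + 2 * h) * WCp (- (- x + h)) y (u - h) * WBm (- x) y u * \<theta> (x - y + h)" (is "?lhs = ?rhs")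
proof -
  have r1: "tH1 * tSm1 * tuXy1 * tuYY1 + tYm1 * tDm1 * tuXY1 * tu1 - tY0 * tD0 * tuXY2 * tu0 = 0" (is "?r1 = 0")
    using three_term_half_sum [of "u + h" "h" "x + y - h" "u - x + y + h" "u - 2 * y + h"]
      theta_minus [of \<tau> "x - y - h"] theta_minus [of \<tau> "u - x - y + h"]
    by (simp add: algebra_simps)
  have r2: "tH1 * tY0 * tD2 * tSm1 + tH1 * tYm2 * tD0 * tS1 - tH2 * tYm1 * tD1 * tS0 = 0" (is "?r2 = 0")
    using three_term_half_sum [of "x + y + h" "h" "2 * y" "x - y + 2 * h" "x + y - h"]
      theta_minus [of \<tau> "2 * y - 2 * h"] theta_minus [of \<tau> "x - y"]
    by (simp add: algebra_simps)
  have r3: "tH1 * tSm1 * tuXX1 * tuxY1 - tD1 * tXm1 * tuXY1 * tu1 + tD0 * tX0 * tuXY2 * tu0 = 0" (is "?r3 = 0")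
    using three_term_half_sum [of "u + h" "h" "x + y - h" "u - 2 * x + h" "u + x - y + h"]
      theta_minus [of \<tau> "x - y"] theta_minus [of \<tau> "x - y + h"] theta_minus [of \<tau> "2 * x - h"] theta_minus [of \<tau> "u - x - y + h"]
    by (simp add: algebra_simps)
  have r4: "tH1 * tDm2 * tSm1 * tX0 - tH2 * tDm1 * tS0 * tXm1 + tH1 * tD0 * tS1 * tXm2 = 0" (is "?r4 = 0")
    using three_term_half_sum [of "2 * x - h" "h" "x - y - 2 * h" "x + y - h" "2 * x"]
      theta_minus [of \<tau> "h"] theta_minus [of \<tau> "2 * h"] theta_minus [of \<tau> "x - y - h"] theta_minus [of \<tau> "x + y"]
    by (simp add: algebra_simps)
  define k where "k = tH2 * tY2 * tS2 * tX2 * tum1 * tu0 * tu1 * tu2 * tu3 * tu4 / (tH1 * tH1 * tH1 * tH1 * tH3 * tH3 * tH3 * tH3 * tY0 * tDm1 * tD0 * tD1 * tSm1 * tS0 * tS1 * tX0)"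
  have t: "\<theta> (2 * x + 2 * h) * WC0 (- (x + h)) y (u - h) * WCp x y u * \<theta> (y - x + h) = (- tY0 * tDm1 * tDm1 * tD2 * tSm1 * tX0 * tuXY1 * tu1) * k"
    "\<theta> (2 * y + 2 * h) * WCp (- (y + h)) x (u - h) * WBp y x u * \<theta> (y - x + h) = (- tH2 * tDm1 * tD1 * tSm1 * tS0 * tX0 * tuXy1 * tuYY1) * k"
    "\<theta> (2 * (- y) + 2 * h) * WCp (- (- y + h)) x (u - h) * WBm (- y) x u * \<theta> (y - x + h) = (- tYm2 * tDm1 * tDm1 * tD0 * tS1 * tX0 * tuXY1 * tu1) * k"
    "\<theta> (2 * y + 2 * h) * WC0 (- (y + h)) x (u - h) * WCp y x u * \<theta> (x - y + h) = (- tY0 * tDm2 * tD1 * tD1 * tSm1 * tX0 * tuXY1 * tu1) * k"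
    "\<theta> (2 * x + 2 * h) * WCp (- (x + h)) y (u - h) * WBp x y u * \<theta> (x - y + h) = (tH2 * tY0 * tDm1 * tD1 * tSm1 * tS0 * tuXX1 * tuxY1) * k"
    "\<theta> (2 * (- x) + 2 * h) * WCp (- (- x + h)) y (u - h) * WBm (- x) y u * \<theta> (x - y + h) = (- tY0 * tD0 * tD1 * tD1 * tS1 * tXm2 * tuXY1 * tu1) * k"
    unfolding k_def WBp_def WBm_def WC0_def WCp_def gg_def
    by (simp only: theta_shift theta_sign single_fraction, subst frac_eq_eq, simp add: theta_nonzero, simp add: theta_nonzero, algebra)+
  have "tH1 * (?lhs - ?rhs) = (- tH2 * tDm1 * tD1 * tS0 * tX0 * ?r1
      - tDm1 * tDm1 * tX0 * tuXY1 * tu1 * ?r2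
      - tH2 * tY0 * tDm1 * tD1 * tS0 * ?r3
      + tY0 * tD1 * tD1 * tuXY1 * tu1 * ?r4) * k"
    unfolding t by algebra
  also have "\<dots> = 0"
    by (simp only: r1 r2 r3 r4 mult_zero_right mult_zero_left add_0 diff_0 minus_zero)
  finally show ?thesis
    using theta_nonzero by (simp only: mult_eq_0_iff right_minus_eq simp_thms)
qed

text \<open>All terms are elliptic in x and their poles cancel, which is why the sum is constant;
  the certificate replaces that argument. It converts the fixed weight into the constant term of
  \<open>Mt2\<close>.\<close>

lemma sum_TT:
  "TT x y
    + TT x (- y)
    + TT (- x) y
    + TT (- x) (- y)
    + RR x y
    + RR x (- y) = K0" (is "?lhs = ?rhs")
proof -
  have r1: "tH3 * tY0 * tD0 * tSm1 - tH1 * tYm2 * tDm2 * tS1 - tH2 * tY1 * tD1 * tSm2 = 0" (is "?r1 = 0")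
    using three_term_half_sum [of "x + y + h" "3 * h" "2 * y" "x - y" "x + y - h"]
      theta_minus [of \<tau> "h"] theta_minus [of \<tau> "2 * y - 2 * h"] theta_minus [of \<tau> "x - y - 2 * h"]
    by (simp add: algebra_simps)
  have r2: "tH2 * tY3 * tD1 * tSm4 + tH3 * tYm2 * tDm4 * tS1 - tH5 * tY0 * tDm2 * tSm1 = 0" (is "?r2 = 0")
    using three_term_half_sum [of "x + y + h" "2 * h" "2 * y + 3 * h" "x - y + h" "x + y - 4 * h"]
      theta_minus [of \<tau> "2 * y - 2 * h"] theta_minus [of \<tau> "x - y - 4 * h"]
    by (simp add: algebra_simps)
  have r3: "tH4 * tD1 * tS1 * tX0 - tH1 * tDm2 * tSm2 * tX3 - tH3 * tD2 * tS2 * tXm1 = 0" (is "?r3 = 0")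
    using three_term_half_sum [of "2 * x + 3 * h" "4 * h" "x - y + h" "x + y + h" "2 * x"]
      theta_minus [of \<tau> "h"] theta_minus [of \<tau> "x - y - 2 * h"] theta_minus [of \<tau> "x + y - 2 * h"]
    by (simp add: algebra_simps)
  have r4: "tH2 * tDm5 * tSm1 * tX2 - tH5 * tDm2 * tS2 * tXm1 + tH3 * tD0 * tS4 * tXm3 = 0" (is "?r4 = 0")
    using three_term_half_sum [of "2 * x - h" "2 * h" "x - y - 5 * h" "x + y - h" "2 * x + 2 * h"]
      theta_minus [of \<tau> "3 * h"] theta_minus [of \<tau> "5 * h"] theta_minus [of \<tau> "x - y - 2 * h"] theta_minus [of \<tau> "x + y + 2 * h"]
    by (simp add: algebra_simps)
  have r5: "tH6 * tDm1 * tS1 * tX0 - tH3 * tDm4 * tSm2 * tX3 - tH3 * tD2 * tS4 * tXm3 = 0" (is "?r5 = 0")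
    using three_term_half_sum [of "2 * x + 3 * h" "6 * h" "x - y - h" "x + y + h" "2 * x"]
      theta_minus [of \<tau> "3 * h"] theta_minus [of \<tau> "x - y - 4 * h"] theta_minus [of \<tau> "x + y - 2 * h"]
    by (simp add: algebra_simps)
  have r6: "tH1 * tDm2 * tD0 * txxyy1 - tY2 * tSm1 * tS1 * tX0 + tY1 * tS0 * tS2 * tXm1 = 0" (is "?r6 = 0")
    using three_term_half_sum [of "2 * x" "h" "x - y - 2 * h" "x - y" "2 * x + 2 * y + h"]
      theta_minus [of \<tau> "2 * y + h"] theta_minus [of \<tau> "2 * y + 2 * h"] theta_minus [of \<tau> "x + y - h"] theta_minus [of \<tau> "x + y + h"]
    by (simp add: algebra_simps)
  have r7: "tYm2 * tS1 * tS5 * tXm2 + tH5 * tDm2 * tD2 * txxyy1 - tY3 * tSm4 * tS0 * tX3 = 0" (is "?r7 = 0")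
    using three_term_half_sum [of "2 * x + 2 * y + h" "2 * y - 2 * h" "x + y + h" "x + y + 5 * h" "2 * x - 2 * h"]
      theta_minus [of \<tau> "x - y - 2 * h"] theta_minus [of \<tau> "x - y + 2 * h"]
    by (simp add: algebra_simps)
  have r8: "tH1 * tDm2 * tS0 * tX1 - tH2 * tDm1 * tS1 * tX0 + tH1 * tD0 * tS2 * tXm1 = 0" (is "?r8 = 0")
    using three_term_half_sum [of "2 * x" "h" "x - y - 2 * h" "x + y" "2 * x + h"]
      theta_minus [of \<tau> "h"] theta_minus [of \<tau> "2 * h"] theta_minus [of \<tau> "x - y - h"] theta_minus [of \<tau> "x + y + h"]
    by (simp add: algebra_simps)
  have r9: "tH2 * tD5 * tS1 * tXm2 + tH3 * tD0 * tSm4 * tX3 - tH5 * tD2 * tSm2 * tX1 = 0" (is "?r9 = 0")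
    using three_term_half_sum [of "2 * x + 3 * h" "2 * h" "x - y + 5 * h" "x + y + h" "2 * x - 2 * h"]
      theta_minus [of \<tau> "x - y"] theta_minus [of \<tau> "x + y - 4 * h"]
    by (simp add: algebra_simps)
  have r10: "tH6 * tD1 * tSm1 * tX0 - tH3 * tDm2 * tSm4 * tX3 - tH3 * tD4 * tS2 * tXm3 = 0" (is "?r10 = 0")
    using three_term_half_sum [of "2 * x + 3 * h" "6 * h" "x - y + h" "x + y - h" "2 * x"]
      theta_minus [of \<tau> "3 * h"] theta_minus [of \<tau> "x - y - 2 * h"] theta_minus [of \<tau> "x + y - 4 * h"]
    by (simp add: algebra_simps)
  have r11: "tH2 * tDm1 * tSm5 * tX2 - tH5 * tD2 * tSm2 * tXm1 + tH3 * tD4 * tS0 * tXm3 = 0" (is "?r11 = 0")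
    using three_term_half_sum [of "2 * x - h" "2 * h" "x - y - h" "x + y - 5 * h" "2 * x + 2 * h"]
      theta_minus [of \<tau> "3 * h"] theta_minus [of \<tau> "5 * h"] theta_minus [of \<tau> "x - y + 2 * h"] theta_minus [of \<tau> "x + y - 2 * h"]
    by (simp add: algebra_simps)
  define k where "k = 1 / (tH1 * tH6 * tY0 * tDm1 * tD0 * tD1 * tSm1 * tS0 * tS1 * tX0)"
  have t: "TT x y = (tH1 * tH2 * tY2 * tDm1 * tD0 * tD1 * tSm5 * tSm1 * tS2 * tX2) * k"
    "TT x (- y) = (tH1 * tH2 * tYm2 * tDm5 * tDm1 * tD2 * tSm1 * tS0 * tS1 * tX2) * k"
    "TT (- x) y = (tH1 * tH2 * tY2 * tDm2 * tD1 * tD5 * tSm1 * tS0 * tS1 * tXm2) * k"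
    "TT (- x) (- y) = (tH1 * tH2 * tYm2 * tDm1 * tD0 * tD1 * tSm2 * tS1 * tS5 * tXm2) * k"
    "RR x y = (tH1 * tH6 * tY2 * tD0 * tD1 * tD1 * tSm1 * tSm1 * tS0 * tX0) * k"
    "RR x (- y) = (tH1 * tH6 * tYm2 * tDm1 * tDm1 * tD0 * tS0 * tS1 * tS1 * tX0) * k"
    "K0 = (tH4 * tH5 * tY0 * tDm1 * tD0 * tD1 * tSm1 * tS0 * tS1 * tX0) * k"
    unfolding k_def RR_def TT_def K0_def
    by (simp only: theta_shift theta_sign single_fraction, subst frac_eq_eq, simp add: theta_nonzero, simp add: theta_nonzero, algebra)+
  have "?lhs - ?rhs = (- tH5 * tDm1 * tD2 * tS0 * tS2 * tXm1 * ?r1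
      + tH1 * tDm1 * tD0 * tSm2 * tS0 * tX3 * ?r2
      - tH5 * tY0 * tDm1 * tD0 * tSm1 * tS0 * ?r3
      + tH1 * tYm2 * tDm1 * tD2 * tS0 * tS1 * ?r4
      + tH1 * tYm2 * tDm1 * tD0 * tS0 * tS1 * ?r5
      - tH2 * tH5 * tDm1 * tD1 * tD2 * tSm2 * ?r6
      + tH1 * tH2 * tDm1 * tD0 * tD1 * tSm2 * ?r7
      + tH5 * tY2 * tD1 * tD2 * tSm2 * tSm1 * ?r8
      + tH1 * tY2 * tDm2 * tD1 * tSm1 * tS0 * ?r9
      + tH1 * tY2 * tD0 * tD1 * tSm1 * tS0 * ?r10
      + tH1 * tY2 * tD0 * tD1 * tSm1 * tS2 * ?r11) * k"
    unfolding t by algebra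
  also have "\<dots> = 0"
    by (simp only: r1 r2 r3 r4 r5 r6 r7 r8 r9 r10 r11 mult_zero_right mult_zero_left add_0 diff_0 minus_zero)
  finally show ?thesis
    by (simp only: right_minus_eq)
qed

text \<open>Compares the coefficients of \<phi> at \<lambda> + hat p in the two products of
  \<open>Mt1\<close> and \<open>Mt2\<close>. The constant term of \<open>Mt2\<close> is represented
  by -\<open>RR\<close>, moved to the other side, so the arguments shifted by 5h in
  \<open>TT\<close> do not occur.\<close>

lemma commutator_single_step:
  "AA (- y) x * BB x (y - h)
    + AA y x * BB x (- (y + h))
    + RR x y * AA x y
    + RR x (- y) * AA x y = BB x y * AA (- (y + h)) (x + h) + BB x (- y) * AA (y - h) (x + h) + AA x y * RR (x + h) y + AA x y * RR (x + h) (- y)" (is "?lhs = ?rhs")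
proof -
  have r1: "tD0 * tD3 * tSm1 * tS0 + tH1 * tH2 * tYm2 * tX1 - tD1 * tD2 * tSm2 * tS1 = 0" (is "?r1 = 0")
    using three_term_half_sum [of "2 * x + h" "x - y" "x - y + 3 * h" "x + y - h" "x + y"]
      theta_minus [of \<tau> "2 * h"] theta_minus [of \<tau> "2 * y - 2 * h"]
    by (simp add: algebra_simps)
  have r2: "tD0 * tD1 * tSm1 * tS2 - tH1 * tH2 * tY0 * tX1 - tDm1 * tD2 * tS0 * tS1 = 0" (is "?r2 = 0")
    using three_term_half_sum [of "2 * x + h" "x - y" "x - y + h" "x + y - h" "x + y + 2 * h"]
      theta_minus [of \<tau> "h"] theta_minus [of \<tau> "2 * h"] theta_minus [of \<tau> "2 * y"]
    by (simp add: algebra_simps)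
  have r3: "tDm1 * tD2 * tS0 * tS1 + tH1 * tH2 * tY0 * tX1 - tD0 * tD1 * tSm1 * tS2 = 0" (is "?r3 = 0")
    using three_term_half_sum [of "2 * x + h" "x - y - h" "x - y + 2 * h" "x + y" "x + y + h"]
      theta_minus [of \<tau> "2 * h"] theta_minus [of \<tau> "2 * y"]
    by (simp add: algebra_simps)
  have r4: "tDm1 * tD0 * tS0 * tS3 - tH1 * tH2 * tY2 * tX1 - tDm2 * tD1 * tS1 * tS2 = 0" (is "?r4 = 0")
    using three_term_half_sum [of "2 * x + h" "x - y - h" "x - y" "x + y" "x + y + 3 * h"]
      theta_minus [of \<tau> "h"] theta_minus [of \<tau> "2 * h"] theta_minus [of \<tau> "2 * y + 2 * h"]
    by (simp add: algebra_simps)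
  define k where "k = 1 / (tY0 * tD0 * tD0 * tD1 * tD2 * tS0 * tS0 * tS1 * tS2)"
  have t: "AA (- y) x * BB x (y - h) = (tY0 * tDm1 * tD0 * tD1 * tD2 * tSm2 * tS1 * tS1 * tS2) * k"
    "AA y x * BB x (- (y + h)) = (tY0 * tDm2 * tD1 * tD1 * tD2 * tSm1 * tS0 * tS1 * tS2) * k"
    "RR x y * AA x y = (tY2 * tD0 * tD1 * tD1 * tD2 * tSm1 * tSm1 * tS0 * tS2) * k"
    "RR x (- y) * AA x y = (tYm2 * tDm1 * tDm1 * tD0 * tD2 * tS0 * tS1 * tS1 * tS2) * k"
    "BB x y * AA (- (y + h)) (x + h) = (tY0 * tDm1 * tD0 * tD1 * tD2 * tSm1 * tS0 * tS0 * tS3) * k"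
    "BB x (- y) * AA (y - h) (x + h) = (tY0 * tDm1 * tD0 * tD0 * tD3 * tSm1 * tS0 * tS1 * tS2) * k"
    "AA x y * RR (x + h) y = (tY2 * tDm1 * tD1 * tD2 * tD2 * tSm1 * tS0 * tS0 * tS1) * k"
    "AA x y * RR (x + h) (- y) = (tYm2 * tDm1 * tD0 * tD0 * tD1 * tSm1 * tS1 * tS2 * tS2) * k"
    unfolding k_def RR_def AA_def BB_def
    by (simp only: theta_shift theta_sign single_fraction, subst frac_eq_eq, simp add: theta_nonzero, simp add: theta_nonzero, algebra)+
  have "?lhs - ?rhs = (- tY0 * tDm1 * tD0 * tS1 * tS2 * ?r1
      - tYm2 * tDm1 * tD0 * tS1 * tS2 * ?r2
      - tY2 * tD1 * tD2 * tSm1 * tS0 * ?r3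
      - tY0 * tD1 * tD2 * tSm1 * tS0 * ?r4) * k"
    unfolding t by algebra
  also have "\<dots> = 0"
    by (simp only: r1 r2 r3 r4 mult_zero_right mult_zero_left add_0 diff_0 minus_zero)
  finally show ?thesis
    by (simp only: right_minus_eq)
qed

text \<open>Compares the coefficients at \<lambda> + 2 hat p + hat q, a weight that each order of
  the two operators reaches in exactly one way.\<close>

lemma AA_BB_exchange:
  "AA x y * BB (x + h) y = BB x y * AA (x + h) (y + h)"
  unfolding AA_def BB_def
  by (simp only: theta_shift single_fraction, subst frac_eq_eq, simp add: theta_nonzero, simp add: theta_nonzero, algebra)

end

end

subsection \<open>Weights\<close>

lemma form_coordinates: "form x y = (x $ 1 * y $ 1 + x $ 2 * y $ 2) / 2"
  by (simp add: form_def sum_2)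

lemma form_add_left [simp]: "form (x + y) z = form x z + form y z"
  and form_add_right [simp]: "form x (y + z) = form x y + form x z"
  and form_diff_right [simp]: "form x (y - z) = form x y - form x z"
  and form_minus_right [simp]: "form x (- y) = - form x y"
  and form_minus_left [simp]: "form (- x) y = - form x y"
  and form_scale_left [simp]: "form (a *s x) y = a * form x y"
  and form_0_left [simp]: "form 0 y = 0"
  and form_0_right [simp]: "form x 0 = 0"
  by (simp_all add: form_coordinates field_simps)

text \<open>A frame: \<open>P\<^sub>1\<close> consists of p, -p, q, -q. The computations are done
  for an arbitrary frame, so the Weyl group acts on them by sign changes and by exchange of p and
  q.\<close>

definition orth :: "weight \<Rightarrow> weight \<Rightarrow> bool" where
  "orth p q \<longleftrightarrow> p \<in> P\<^sub>1 \<and> q \<in> P\<^sub>1 \<and> q \<noteq> p \<and> q \<noteq> - p"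

lemma P1_uminus [simp]: "- p \<in> P\<^sub>1 \<longleftrightarrow> p \<in> P\<^sub>1"
  unfolding P\<^sub>1_def by (auto simp: minus_equation_iff [of p])

lemma orth_sym: "orth p q \<Longrightarrow> orth q p"
  and orth_uminus_left: "orth p q \<Longrightarrow> orth (- p) q"
  and orth_uminus_right: "orth p q \<Longrightarrow> orth p (- q)"
  by (auto simp: orth_def minus_equation_iff)

lemma epsilon_nth [simp]: "\<epsilon> i $ j = (if j = i then 1 else 0)"
  by (simp add: \<epsilon>_def axis_def)

lemma orth_frame:
  assumes "orth p q"
  shows "P\<^sub>1 = {p, - p, q, - q}" "form p p = 1 / 2" "form q q = 1 / 2" "form p q = 0" "form q p = 0"
    "p \<noteq> - p" "- p \<noteq> p" "q \<noteq> - q" "- q \<noteq> q" "p \<noteq> q" "q \<noteq> p" "p \<noteq> - q" "- q \<noteq> p" "q \<noteq> - p" "- p \<noteq> q"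
    "- p \<noteq> - q" "- q \<noteq> - p" "p \<noteq> 0" "q \<noteq> 0"
proof -
  have eps: "\<epsilon> 1 \<noteq> \<epsilon> 2" "\<epsilon> 2 \<noteq> \<epsilon> 1" "\<epsilon> 1 \<noteq> - \<epsilon> 2" "- \<epsilon> 2 \<noteq> \<epsilon> 1" "\<epsilon> 2 \<noteq> - \<epsilon> 1" "- \<epsilon> 1 \<noteq> \<epsilon> 2"
    "\<epsilon> 1 \<noteq> - \<epsilon> 1" "- \<epsilon> 1 \<noteq> \<epsilon> 1" "\<epsilon> 2 \<noteq> - \<epsilon> 2" "- \<epsilon> 2 \<noteq> \<epsilon> 2" "\<epsilon> 1 \<noteq> 0" "\<epsilon> 2 \<noteq> 0"
    by (simp_all only: vec_eq_iff forall_2 epsilon_nth zero_index uminus_vec_def vec_lambda_beta) simp_all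
  have frm: "form (\<epsilon> 1) (\<epsilon> 1) = 1 / 2" "form (\<epsilon> 2) (\<epsilon> 2) = 1 / 2" "form (\<epsilon> 1) (\<epsilon> 2) = 0" "form (\<epsilon> 2) (\<epsilon> 1) = 0"
    by (simp_all add: form_coordinates)
  have "p = \<epsilon> 1 \<or> p = - \<epsilon> 1 \<or> p = \<epsilon> 2 \<or> p = - \<epsilon> 2" "q = \<epsilon> 1 \<or> q = - \<epsilon> 1 \<or> q = \<epsilon> 2 \<or> q = - \<epsilon> 2" "q \<noteq> p" "q \<noteq> - p"
    using assms by (simp_all add: orth_def P\<^sub>1_def)
  then have cases: "p = \<epsilon> 1 \<and> q = \<epsilon> 2 \<or> p = \<epsilon> 1 \<and> q = - \<epsilon> 2 \<or> p = - \<epsilon> 1 \<and> q = \<epsilon> 2 \<or> p = - \<epsilon> 1 \<and> q = - \<epsilon> 2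
      \<or> p = \<epsilon> 2 \<and> q = \<epsilon> 1 \<or> p = \<epsilon> 2 \<and> q = - \<epsilon> 1 \<or> p = - \<epsilon> 2 \<and> q = \<epsilon> 1 \<or> p = - \<epsilon> 2 \<and> q = - \<epsilon> 1"
    by (elim disjE) simp_all
  then show "P\<^sub>1 = {p, - p, q, - q}"
    unfolding P\<^sub>1_def by (elim disjE conjE; simp only: minus_minus; blast)
  show "form p p = 1 / 2" "form q q = 1 / 2" "form p q = 0" "form q p = 0"
    using cases by (elim disjE conjE; simp add: frm)+
  show "p \<noteq> - p" "- p \<noteq> p" "q \<noteq> - q" "- q \<noteq> q" "p \<noteq> q" "q \<noteq> p" "p \<noteq> - q" "- q \<noteq> p" "q \<noteq> - p" "- p \<noteq> q"
    "- p \<noteq> - q" "- q \<noteq> - p" "p \<noteq> 0" "q \<noteq> 0"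
    using cases by (elim disjE conjE; simp only: eps minus_minus neg_equal_iff_equal neg_equal_0_iff_equal not_False_eq_True)+
qed

lemma finite_P1 [simp]: "finite P\<^sub>1"
  by (simp add: P\<^sub>1_def)

lemma orth_exists: "p \<in> P\<^sub>1 \<Longrightarrow> \<exists>q. orth p q"
proof -
  have "orth (\<epsilon> 1) (\<epsilon> 2)"
    unfolding orth_def P\<^sub>1_def by (simp add: vec_eq_iff forall_2)
  moreover assume "p \<in> P\<^sub>1"
  ultimately show ?thesis
    unfolding P\<^sub>1_def using orth_sym orth_uminus_left by blast
qed

lemma sum_P1:
  assumes "orth p q"
  shows "(\<Sum>s\<in>P\<^sub>1. g s) = g p + g (- p) + g q + (g (- q) :: 'a :: comm_monoid_add)"
proof -
  have "distinct [p, - p, q, - q]"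
    using orth_frame(6-) [OF assms] by (simp only: distinct.simps list.set insert_iff empty_iff simp_thms)
  then have "sum g {p, - p, q, - q} = sum_list (map g [p, - p, q, - q])"
    using sum.distinct_set_conv_list [of "[p, - p, q, - q]" g] by (simp only: list.set)
  also have "\<dots> = g p + g (- p) + g q + g (- q)"
    by (simp only: list.map sum_list.Cons sum_list.Nil add_0_right add.assoc)
  finally show ?thesis
    unfolding orth_frame(1) [OF assms] .
qed

text \<open>Determines the lower steps of a face with upper steps p, p or p, q. All elements of
  \<open>P\<^sub>1\<close> have square length 1/2, so expanding the square length of the remaining
  step fixes the pairings of s with p and q.\<close>

lemma orth_steps:
  assumes "orth p q"
  shows "p + p - s \<in> P\<^sub>1 \<and> s \<in> P\<^sub>1 \<longleftrightarrow> s = p"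
    and "p + q - s \<in> P\<^sub>1 \<and> s \<in> P\<^sub>1 \<longleftrightarrow> s = p \<or> s = q"
proof -
  have expand: "form (p + p - s) (p + p - s) = 4 * form p p - 4 * form p s + form s s"
    "form (p + q - s) (p + q - s) = form p p + form q q + form s s + 2 * form p q - 2 * form p s - 2 * form q s"
    unfolding form_coordinates vector_add_component vector_minus_component by (simp_all add: field_simps)
  have norm: "form t t = 1 / 2" if "t \<in> P\<^sub>1" for t
    using that orth_exists orth_frame(2) by blast
  have "form p s = 1 / 2" if "p + p - s \<in> P\<^sub>1" "s \<in> P\<^sub>1"
    using expand(1) unfolding norm [OF that(1)] norm [OF that(2)] orth_frame(2) [OF assms] by (simp add: field_simps)
  moreover have "form p s + form q s = 1 / 2" if "p + q - s \<in> P\<^sub>1" "s \<in> P\<^sub>1"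
  proof -
    have "4 * (form p s + form q s) = 2"
      using expand(2) unfolding norm [OF that(1)] norm [OF that(2)] orth_frame(2-5) [OF assms]
      by (simp add: algebra_simps)
    then have "form p s + form q s = 2 / 4"
      by (metis nonzero_mult_div_cancel_left zero_neq_numeral)
    then show ?thesis by simp
  qed
  moreover have "s \<in> P\<^sub>1 \<Longrightarrow> s = p \<or> s = - p \<or> s = q \<or> s = - q"
    using orth_frame(1) [OF assms] by blast
  moreover have "form p (- p) = - (1 / 2)" "form q (- q) = - (1 / 2)" "form p (- q) = 0" "form q (- p) = 0"
    using orth_frame(2-5) [OF assms] by simp_all
  ultimately have "p + p - s \<in> P\<^sub>1 \<Longrightarrow> s \<in> P\<^sub>1 \<Longrightarrow> s = p"
    "p + q - s \<in> P\<^sub>1 \<Longrightarrow> s \<in> P\<^sub>1 \<Longrightarrow> s = p \<or> s = q"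
    using orth_frame(2-5) [OF assms] by auto
  moreover have "p \<in> P\<^sub>1" "q \<in> P\<^sub>1" "p + p - p = p" "p + q - p = q" "p + q - q = p"
    using assms by (simp_all add: orth_def)
  ultimately show "p + p - s \<in> P\<^sub>1 \<and> s \<in> P\<^sub>1 \<longleftrightarrow> s = p"
    "p + q - s \<in> P\<^sub>1 \<and> s \<in> P\<^sub>1 \<longleftrightarrow> s = p \<or> s = q"
    by metis+
qed

subsection \<open>Path vectors\<close>

lemma lookup_scale [simp]: "Poly_Mapping.lookup (scale a v) x = a * Poly_Mapping.lookup v x"
  by (simp add: scale_def map.rep_eq when_def)

lemma scale_add [simp]: "scale a (v + w) = scale a v + scale a w"
  and scale_scale [simp]: "scale a (scale b v) = scale (a * b) v"
  and scale_add_left: "scale (a + b) v = scale a v + scale b v"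
  and scale_0 [simp]: "scale a 0 = 0" "scale 0 v = 0"
  and scale_single [simp]: "scale a (Poly_Mapping.single x b) = Poly_Mapping.single x (a * b)"
  by (simp_all add: poly_mapping_eq_iff fun_eq_iff lookup_add lookup_single when_def algebra_simps)

lemma scale_sum [simp]: "scale a (sum g A) = (\<Sum>i\<in>A. scale a (g i))"
  by (induction A rule: infinite_finite_induct) auto

lemma linear_extension_superset:
  assumes "finite A" "Poly_Mapping.keys v \<subseteq> A"
  shows "linear_extension b v = (\<Sum>x\<in>A. scale (Poly_Mapping.lookup v x) (b x))"
  unfolding linear_extension_def
  by (rule sum.mono_neutral_left [OF assms]) (auto simp: in_keys_iff)

lemma linear_extension_single [simp]: "linear_extension b (Poly_Mapping.single x a) = scale a (b x)"
  by (subst linear_extension_superset [of "{x}"]) auto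

lemma linear_extension_0 [simp]: "linear_extension b 0 = 0"
  by (simp add: linear_extension_def)

lemma linear_extension_add [simp]: "linear_extension b (v + w) = linear_extension b v + linear_extension b w"
proof -
  let ?A = "Poly_Mapping.keys v \<union> Poly_Mapping.keys w"
  have "Poly_Mapping.keys (v + w) \<subseteq> ?A"
    by (rule keys_add)
  then show ?thesis
    using linear_extension_superset [of ?A]
    by (simp add: lookup_add scale_add_left sum.distrib)
qed

lemma linear_extension_scale [simp]: "linear_extension b (scale a v) = scale a (linear_extension b v)"
proof -
  have "Poly_Mapping.keys (scale a v) \<subseteq> Poly_Mapping.keys v"
    by (auto simp: in_keys_iff)
  then show ?thesis
    using linear_extension_superset [of "Poly_Mapping.keys v"] by simp
qed

lemma linear_extension_add_fun: "linear_extension (\<lambda>x. b x + d x) v = linear_extension b v + linear_extension d v"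
  by (simp add: linear_extension_def sum.distrib)

lemma linear_extension_scale_fun: "linear_extension (\<lambda>x. scale a (b x)) v = scale a (linear_extension b v)"
  by (simp add: linear_extension_def mult.commute)

lemma tensor_add_left [simp]: "(v + v') \<odot> w = v \<odot> w + v' \<odot> w"
  and tensor_scale_left [simp]: "scale a v \<odot> w = scale a (v \<odot> w)"
  and tensor_add_right [simp]: "v \<odot> (w + w') = v \<odot> w + v \<odot> w'"
  and tensor_scale_right [simp]: "v \<odot> scale a w = scale a (v \<odot> w)"
  and tensor_single [simp]: "Poly_Mapping.single x a \<odot> Poly_Mapping.single y b = Poly_Mapping.single (x @ tl y) (a * b)"
  by (simp_all add: tensor_def linear_extension_add_fun linear_extension_scale_fun)

section \<open>Paths described by their steps\<close>

context C2_face
begin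

fun verts :: "weight \<Rightarrow> weight list \<Rightarrow> weight list" where
  "verts l [] = [l]"
| "verts l (p # ps) = l # verts (l + hat p) ps"

text \<open>\<open>st l ps\<close> is the path that starts at \<open>l\<close> and has the steps \<open>hat p\<close> for \<open>p\<close> in \<open>ps\<close>.\<close>

definition st :: "weight \<Rightarrow> weight list \<Rightarrow> complex \<Rightarrow> pathvec" where
  "st l ps a = Poly_Mapping.single (verts l ps) a"

lemma hat_add: "hat (p + q) = hat p + hat q" and hat_uminus [simp]: "hat (- p) = - hat p"
  and hat_0 [simp]: "hat 0 = 0" and hat_diff: "hat (p - q) = hat p - hat q"
  by (simp_all add: hat_def vec_eq_iff algebra_simps)

lemma verts_append: "verts l (xs @ ys) = verts l xs @ tl (verts (l + hat (sum_list xs)) ys)"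
proof (induction xs arbitrary: l)
  case Nil
  then show ?case by (cases ys) auto
qed (simp add: hat_add add.assoc)

lemma length_verts [simp]: "length (verts l ps) = Suc (length ps)"
  by (induction ps arbitrary: l) auto

lemma verts_nth: "i \<le> length ps \<Longrightarrow> verts l ps ! i = l + hat (sum_list (take i ps))"
  by (induction ps arbitrary: l i) (auto simp: nth_Cons hat_add add.assoc split: nat.splits)

lemma st_add: "st l ps (a + b) = st l ps a + st l ps b"
  by (simp add: st_def single_add)

lemma st_0 [simp]: "st l ps 0 = 0"
  by (simp add: st_def)

lemma scale_st [simp]: "scale a (st l ps b) = st l ps (a * b)"
  by (simp add: st_def)

lemma tensor_st: "m = l + hat (sum_list xs) \<Longrightarrow> st l xs a \<odot> st m ys b = st l (xs @ ys) (a * b)"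
  by (simp add: st_def verts_append)

lemma e_st: "e l (l + hat p) = st l [p] 1"
  by (simp add: e_def st_def)

lemma Wop_add [simp]: "Wop j z (v + w) = Wop j z v + Wop j z w"
  and Wop_0 [simp]: "Wop j z 0 = 0"
  by (simp_all add: Wop_def)

end

context generic_face
begin

lemma hat_inject [simp]: "hat p = hat q \<longleftrightarrow> p = q"
  using h_nonzero by (simp add: hat_def vec_eq_iff)

lemma unhat_hat [simp]: "unhat (hat p) = p"
  using h_nonzero by (simp add: hat_def unhat_def vec_eq_iff)

lemma hat_in_image [simp]: "hat p \<in> hat ` A \<longleftrightarrow> p \<in> A"
  by auto

lemma W_steps:
  assumes "a \<in> P\<^sub>1" "b \<in> P\<^sub>1" "s \<in> P\<^sub>1"
  shows "W m (m + hat a) (m + hat s) (m + hat a + hat b) z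
    = (if a + b - s \<in> P\<^sub>1 then bw m a b s (a + b - s) z else 0)"
proof -
  have "m + hat a - m = hat a" "m + hat a + hat b - (m + hat a) = hat b" "m + hat s - m = hat s"
    "m + hat a + hat b - (m + hat s) = hat (a + b - s)"
    by (simp_all add: hat_add hat_diff)
  then show ?thesis
    unfolding W_def by (simp only: insert_subset empty_subsetI hat_in_image unhat_hat assms simp_thms)
qed

lemma Wop_st:
  assumes "a \<in> P\<^sub>1" "b \<in> P\<^sub>1"
  shows "Wop (Suc (length xs)) z (st l (xs @ a # b # ys) k)
    = (\<Sum>s\<in>P\<^sub>1. if a + b - s \<in> P\<^sub>1
        then st l (xs @ s # (a + b - s) # ys) (k * bw (l + hat (sum_list xs)) a b s (a + b - s) z) else 0)"
proof -
  define m where "m = l + hat (sum_list xs)"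
  let ?x = "verts l (xs @ a # b # ys)"
  have nth: "?x ! length xs = m" "?x ! Suc (length xs) = m + hat a" "?x ! Suc (Suc (length xs)) = m + hat a + hat b"
    by (simp_all add: verts_nth m_def hat_add add_ac)
  \<comment> \<open>The new steps s and a + b - s have the same sum as a and b, so all other
    vertices stay where they are.\<close>
  have upd: "?x[Suc (length xs) := m + hat s] = verts l (xs @ s # (a + b - s) # ys)" for s
  proof -
    have "l + hat (sum_list xs) + hat s + hat (a + b - s) = l + hat (sum_list xs) + hat a + hat b"
      by (simp add: hat_add hat_diff)
    then show ?thesis
      unfolding verts_append [of l xs] m_def by (simp only: verts.simps list.sel list_update_append length_verts nth_append list_update.simps diff_Suc_1 less_irrefl if_False diff_self_eq_0 nat.case)
  qed
  \<comment> \<open>The sum in \<open>Wop\<close> runs over weights; injectivity turns it into a sum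
    over steps.\<close>
  have "inj_on (\<lambda>s. m + hat s) P\<^sub>1"
    by (rule inj_onI) (simp only: add_left_cancel hat_inject)
  then have "Wop (Suc (length xs)) z (st l (xs @ a # b # ys) k) = (\<Sum>s\<in>P\<^sub>1. scale k (scale (W m (m + hat a) (m + hat s) (m + hat a + hat b) z)
      (Poly_Mapping.single (?x[Suc (length xs) := m + hat s]) 1)))"
    by (simp only: Wop_def st_def linear_extension_single diff_Suc_1 add_Suc_right add_0_right One_nat_def diff_Suc_Suc diff_zero nth sum.reindex o_def scale_sum)
  also have "\<dots> = (\<Sum>s\<in>P\<^sub>1. if a + b - s \<in> P\<^sub>1
        then st l (xs @ s # (a + b - s) # ys) (k * bw m a b s (a + b - s) z) else 0)"
    unfolding upd using assms by (intro sum.cong refl) (simp add: W_steps st_def)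
  finally show ?thesis
    by (simp only: m_def)
qed

section \<open>Symmetries of genericity, and \<open>Wop\<close> on a pair of steps\<close>

lemma generic_pair_swap: "generic_pair y x \<longleftrightarrow> generic_pair x y"
proof -
  have "generic_pair y x" if "generic_pair x y" for x y
    unfolding generic_pair_def
  proof (intro allI conjI)
    fix k :: int
    note g = that [unfolded generic_pair_def, rule_format]
    show "\<theta> (y + x + of_int k * h) \<noteq> 0" "\<theta> (2 * y + of_int k * h) \<noteq> 0" "\<theta> (2 * x + of_int k * h) \<noteq> 0"
      using g [of k] by (auto simp: add_ac)
    show "\<theta> (y - x + of_int k * h) \<noteq> 0"
      using g [of "- k"] theta_minus [of \<tau> "y - x + of_int k * h"] by (auto simp: algebra_simps)
  qed
  then show ?thesis by blast
qed

lemma generic_pair_uminus [simp]: "generic_pair x (- y) \<longleftrightarrow> generic_pair x y"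
proof -
  have "generic_pair x (- y)" if "generic_pair x y" for x y
    unfolding generic_pair_def
  proof (intro allI conjI)
    fix k :: int
    note g = that [unfolded generic_pair_def, rule_format]
    show "\<theta> (x + - y + of_int k * h) \<noteq> 0" "\<theta> (x - - y + of_int k * h) \<noteq> 0" "\<theta> (2 * x + of_int k * h) \<noteq> 0"
      using g [of k] by auto
    show "\<theta> (2 * - y + of_int k * h) \<noteq> 0"
      using g [of "- k"] theta_minus [of \<tau> "2 * - y + of_int k * h"] by (auto simp: algebra_simps)
  qed
  from this [of x y] this [of x "- y"] show ?thesis by auto
qed

lemma generic_pair_uminus_left [simp]: "generic_pair (- x) y \<longleftrightarrow> generic_pair x y"
  using generic_pair_swap generic_pair_uminus by metis

lemma generic_pair_shift: "generic_pair x y \<Longrightarrow> generic_pair (x + of_int k * h) (y + of_int j * h)"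
  unfolding generic_pair_def
proof (intro allI)
  fix n :: int
  assume "\<forall>k::int. \<theta> (x + y + of_int k * h) \<noteq> 0 \<and> \<theta> (x - y + of_int k * h) \<noteq> 0
     \<and> \<theta> (2 * x + of_int k * h) \<noteq> 0 \<and> \<theta> (2 * y + of_int k * h) \<noteq> 0"
  note g = this [rule_format]
  show "\<theta> (x + of_int k * h + (y + of_int j * h) + of_int n * h) \<noteq> 0
    \<and> \<theta> (x + of_int k * h - (y + of_int j * h) + of_int n * h) \<noteq> 0
    \<and> \<theta> (2 * (x + of_int k * h) + of_int n * h) \<noteq> 0 \<and> \<theta> (2 * (y + of_int j * h) + of_int n * h) \<noteq> 0"
    using g [of "k + j + n"] g [of "k - j + n"] g [of "2 * k + n"] g [of "2 * j + n"]
    by (simp add: algebra_simps)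
qed

lemma bw_same: "p \<in> P\<^sub>1 \<Longrightarrow> bw l p p p p u = wpp u"
  by (simp add: bw_def wpp_def)

context
  fixes p q :: weight
  assumes orth: "orth p q"
begin

lemma P1_minus: "P\<^sub>1 - {p, - p} = {q, - q}" "P\<^sub>1 - {- p, p} = {q, - q}" "P\<^sub>1 - {q, - q} = {p, - p}"
  using orth_frame [OF orth] by blast+

lemma prod_pair: "(\<Prod>t\<in>{p, - p}. g t) = g p * (g (- p) :: complex)" "(\<Prod>t\<in>{q, - q}. g t) = g q * (g (- q) :: complex)"
  using orth_frame(6-9) [OF orth] by simp_all

lemma bw_orth: "bw l p q p q u = wpq (form l p - form l q) u" "bw l p q q p u = wqp (form l q - form l p) u"
  using orth_frame(6-) [OF orth] by (simp_all add: bw_def wpq_def wqp_def)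

lemma bw_opposite:
  assumes "generic_pair (form l p) (form l q)"
  shows "bw l p (- p) p (- p) u = wdiag (form l p) (form l q) u"
    and "bw l p (- p) (- p) p u = wneg (form l p) (form l q) u"
    and "bw l p (- p) q (- q) u = wex (form l p) (form l q) u"
proof -
  define x y where "x = form l p" and "y = form l q"
  note nz = generic_pairD [OF assms, folded x_def y_def]
  note ne = orth_frame(6-) [OF orth]
  have c0: "\<theta> c \<noteq> 0" "\<theta> h \<noteq> 0"
    using theta_h_nonzero by (simp_all add: c_def)
  have "bw l p (- p) p (- p) u = \<theta> (c - u) * \<theta> (2 * x + h - u) / (\<theta> c * \<theta> (2 * x + h))
     - \<theta> u * \<theta> (2 * x + h + c - u) / (\<theta> c * \<theta> (2 * x + h))
       * (\<theta> (2 * x + 2 * h) / \<theta> (2 * x))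
       * (\<theta> (x + y + h) / \<theta> (x + y) * (\<theta> (x - y + h) / \<theta> (x - y)))"
    unfolding bw_def P1_minus prod_pair x_def y_def using ne by simp
  also have "\<dots> = wdiag x y u"
    using nz c0 by (simp add: wdiag_def field_simps)
  finally show "bw l p (- p) p (- p) u = wdiag (form l p) (form l q) u"
    by (simp add: x_def y_def)
  have "bw l p (- p) (- p) p u = - (\<theta> u * \<theta> (h + c - u) / (\<theta> c * \<theta> h)) * (\<theta> (2 * h - 2 * x) / \<theta> (2 * x))
      * (\<theta> (y - x + h) * \<theta> (h - x - y) / (\<theta> (x + y) * \<theta> (x - y)))"
    unfolding bw_def P1_minus minus_minus prod_pair x_def y_def using ne by (simp add: algebra_simps)
  also have "\<dots> = wneg x y u"
    by (simp add: wneg_def mult_ac)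
  finally show "bw l p (- p) (- p) p u = wneg (form l p) (form l q) u"
    by (simp add: x_def y_def)
  have "bw l p (- p) q (- q) u = - (\<theta> u * \<theta> (x + y + h + c - u) / (\<theta> c * \<theta> (x + y + h))) * (\<theta> (2 * y + 2 * h) / \<theta> (2 * x))
      * (\<theta> (x + y + h) * \<theta> (y - x + h) / (\<theta> (x + y) * \<theta> (x - y)))"
    unfolding bw_def P1_minus prod_pair x_def y_def using ne by (simp add: add_ac)
  also have "\<dots> = wex x y u"
    using nz by (simp add: wex_def mult_ac)
  finally show "bw l p (- p) q (- q) u = wex (form l p) (form l q) u"
    by (simp add: x_def y_def)
qed

end

lemma Wop_same:
  assumes "p \<in> P\<^sub>1"
  shows "Wop (Suc (length xs)) z (st l (xs @ p # p # ys) k) = st l (xs @ p # p # ys) (k * wpp z)"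
proof -
  obtain q where "orth p q"
    using orth_exists [OF assms] by blast
  then have "{s \<in> P\<^sub>1. p + p - s \<in> P\<^sub>1} = {p}"
    using orth_steps(1) by blast
  then show ?thesis
    unfolding Wop_st [OF assms assms] sum.inter_filter [symmetric, OF finite_P1]
    by (simp add: bw_same [OF assms])
qed

lemma Wop_orth:
  assumes "orth p q" "form (l + hat (sum_list xs)) p = x" "form (l + hat (sum_list xs)) q = y"
  shows "Wop (Suc (length xs)) z (st l (xs @ p # q # ys) k)
    = st l (xs @ p # q # ys) (k * wpq (x - y) z) + st l (xs @ q # p # ys) (k * wqp (y - x) z)"
proof -
  have "{s \<in> P\<^sub>1. p + q - s \<in> P\<^sub>1} = {p, q}"
    using orth_steps(2) [OF assms(1)] by blast
  moreover have "p \<noteq> q" "p \<in> P\<^sub>1" "q \<in> P\<^sub>1"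
    using assms(1) by (auto simp: orth_def)
  ultimately show ?thesis
    using assms(2,3) by (simp add: Wop_st sum.inter_filter [symmetric, OF finite_P1] bw_orth [OF assms(1)])
qed

lemma Wop_opposite:
  assumes "orth p q" "form (l + hat (sum_list xs)) p = x" "form (l + hat (sum_list xs)) q = y" "generic_pair x y"
  shows "Wop (Suc (length xs)) z (st l (xs @ p # (- p) # ys) k)
    = st l (xs @ p # (- p) # ys) (k * wdiag x y z) + st l (xs @ (- p) # p # ys) (k * wneg x y z)
    + st l (xs @ q # (- q) # ys) (k * wex x y z) + st l (xs @ (- q) # q # ys) (k * wex x (- y) z)"
proof -
  have "p \<in> P\<^sub>1" "q \<in> P\<^sub>1"
    using assms(1) by (auto simp: orth_def)
  moreover have "generic_pair x (- y)"
    using assms(4) by (simp add: generic_pair_uminus)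
  ultimately show ?thesis
    using assms bw_opposite [OF assms(1)] bw_opposite(3) [OF orth_uminus_right [OF assms(1)]]
    by (simp add: Wop_st sum_P1 [OF assms(1)])
qed

text \<open>With $x = \mu_p$ and $y = \mu_q$ at the end \<open>\<mu>\<close> of the steps \<open>xs\<close>, the next two definitions are
  $f_\mu^\mu$ and $f_\mu^{\mu + \widehat p + \widehat q}$, preceded by \<open>xs\<close> and followed by \<open>ys\<close>.\<close>

definition fz where
  "fz p q x y l xs ys k =
     st l (xs @ p # (- p) # ys) (k * \<theta> (2 * x + 2 * h)) + st l (xs @ (- p) # p # ys) (k * \<theta> (2 * (- x) + 2 * h))
   + st l (xs @ q # (- q) # ys) (k * \<theta> (2 * y + 2 * h)) + st l (xs @ (- q) # q # ys) (k * \<theta> (2 * (- y) + 2 * h))"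

definition fo where
  "fo p q x y l xs ys k =
     st l (xs @ p # q # ys) (k * \<theta> (x - y + h)) + st l (xs @ q # p # ys) (k * \<theta> (y - x + h))"

lemmas prefix_simps = minus_minus length_append list.size(3,4) One_nat_def add_Suc_right add_0_right add_0
  append_assoc append_Cons append_Nil

lemma st_distrib: "st l ps (k * (a + b)) = st l ps (k * a) + st l ps (k * b)"
  by (simp add: distrib_left st_add)

text \<open>Lets a coefficient 0 be expanded into contributions that cancel, so that rewriting can
  match two sums path by path.\<close>

lemma st_zero: "t = 0 \<Longrightarrow> st l ps (k * 0) = st l ps (k * t)"
  by simp

lemma form_hat: "orth p q \<Longrightarrow> form (hat p) p = h" "orth p q \<Longrightarrow> form (hat p) q = 0" "orth p q \<Longrightarrow> form (hat q) p = 0"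
   "orth p q \<Longrightarrow> form (hat q) q = h"
  by (simp_all add: hat_def orth_frame(2-5))

lemma form_diff_left [simp]: "form (x - y) z = form x z - form y z"
  by (simp add: form_coordinates field_simps)

lemmas uminus_simps = minus_minus diff_minus_eq_add add_uminus_conv_diff

lemma form_uminus_right_eq: "form m p = a \<Longrightarrow> form m (- p) = - a"
  by simp

lemma wdiag_uminus: "wdiag x (- y) u = wdiag x y u"
  by (simp add: wdiag_def mult_ac)

lemma WC0_uminus: "WC0 x (- y) u = WC0 x y u"
  by (simp add: WC0_def mult_ac)

section \<open>One row: two adjacent operators applied to a step and an f-vector\<close>

context
  fixes p q :: weight and l :: weight and xs :: "weight list" and x y :: complex
  assumes orth: "orth p q"
    and x: "form (l + hat (sum_list xs)) p = x" and y: "form (l + hat (sum_list xs)) q = y"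
    and gen: "generic_pair x y"
begin

lemma forms_shift:
  "form (l + hat (sum_list (xs @ [p]))) p = x + h" "form (l + hat (sum_list (xs @ [p]))) q = y"
  "form (l + hat (sum_list (xs @ [q]))) p = x" "form (l + hat (sum_list (xs @ [q]))) q = y + h"
  "form (l + hat (sum_list (xs @ [- p]))) p = x - h" "form (l + hat (sum_list (xs @ [- p]))) q = y"
  "form (l + hat (sum_list (xs @ [- q]))) p = x" "form (l + hat (sum_list (xs @ [- q]))) q = y - h"
  using x y by (simp_all add: hat_add hat_diff form_hat [OF orth])

lemma gen_shift: "generic_pair (x + h) y" "generic_pair x (y + h)" "generic_pair (y + h) x"
  "generic_pair (- (x + h)) y" "generic_pair (- (y + h)) x"
proof -
  have 1: "generic_pair (x + h) y" and 2: "generic_pair x (y + h)"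
    using generic_pair_shift [OF gen, of 1 0] generic_pair_shift [OF gen, of 0 1] by simp_all
  from 1 show "generic_pair (x + h) y" .
  from 2 show "generic_pair x (y + h)" .
  from 2 show 3: "generic_pair (y + h) x"
    by (rule generic_pair_swap [THEN iffD2])
  from 1 show "generic_pair (- (x + h)) y"
    by (simp only: generic_pair_uminus_left)
  from 3 show "generic_pair (- (y + h)) x"
    by (simp only: generic_pair_uminus_left)
qed

lemma frame_uminus: "orth q p" "orth (- p) q" "orth p (- q)" "orth (- q) p" "orth q (- p)" "p \<in> P\<^sub>1" "q \<in> P\<^sub>1" "- q \<in> P\<^sub>1"
  using orth orth_sym [OF orth] orth_uminus_left [OF orth] orth_uminus_right [OF orth]
    orth_uminus_left [OF orth_sym [OF orth]] orth_uminus_right [OF orth_sym [OF orth]]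
  by (simp_all add: orth_def)

lemma Wop_row_A:
  "Wop (Suc (Suc (length xs))) (u + h) (Wop (Suc (length xs)) u (fo p q (x + h) y l (xs @ [p]) ys k))
   = fo p q x y l xs (p # ys) (k * WA u)"
proof -
  note steps = Wop_same [of _ xs] Wop_orth [OF orth x y]
    Wop_same [of _ "xs @ [q]"] Wop_orth [OF orth forms_shift(1,2)] Wop_orth [OF frame_uminus(1) forms_shift(2,1)]
  \<comment> \<open>The path p, p, q is added with coefficient 0, which \<open>st_zero\<close>
    expands. The other path identities are used from right to left, so both sides become the same
    sum up to order.\<close>
  have "Wop (Suc (Suc (length xs))) (u + h) (Wop (Suc (length xs)) u (fo p q (x + h) y l (xs @ [p]) ys k))
   = fo p q x y l xs (p # ys) (k * WA u) + st l (xs @ p # p # q # ys) (k * 0)"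
    unfolding fo_def
    by (simp only: steps [simplified prefix_simps] frame_uminus append_assoc append_Cons append_Nil Wop_add uminus_simps
        st_zero [OF path_A_ppq [OF gen, where u = u]]
        mult.assoc path_A_pqp [OF gen, symmetric] path_A_qpp [OF gen, symmetric] st_distrib) (simp only: add_ac)
  then show ?thesis by simp
qed

lemma Wop_row_B:
  "Wop (Suc (Suc (length xs))) (u + h) (Wop (Suc (length xs)) u (fo (- p) q (- (x + h)) y l (xs @ [p]) ys k))
   = fz p q x y l xs (q # ys) (k * WB0 x y u) + fo p q x y l xs ((- p) # ys) (k * WBp x y u)
     + fo (- p) q (- x) y l xs (p # ys) (k * WBm x y u)"
  (is "_ = ?rhs")
proof -
  note steps1 = Wop_orth [OF orth x y] Wop_opposite [OF orth x y gen]
  note steps2 = Wop_same [of _ "xs @ [- q]"]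
    Wop_orth [OF frame_uminus(2) form_uminus_right_eq [OF forms_shift(1)] forms_shift(2)]
    Wop_orth [OF frame_uminus(5) forms_shift(2) form_uminus_right_eq [OF forms_shift(1)]]
    Wop_orth [OF orth forms_shift(5,6)]
    Wop_opposite [OF orth forms_shift(3,4) gen_shift(2)]
    Wop_opposite [OF frame_uminus(4) form_uminus_right_eq [OF forms_shift(4)] forms_shift(3) gen_shift(5)]
  have "Wop (Suc (Suc (length xs))) (u + h) (Wop (Suc (length xs)) u (fo (- p) q (- (x + h)) y l (xs @ [p]) ys k))
   = ?rhs + st l (xs @ q # q # (- q) # ys) (k * 0)"
    unfolding fo_def fz_def
    by (simp only: steps1 steps2 [simplified prefix_simps] frame_uminus append_assoc append_Cons append_Nil Wop_add uminus_simps
        st_zero [OF path_B_qqQ [OF gen, where u = u]]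
        mult.assoc path_B_pPq [OF gen, symmetric] path_B_pqP [OF gen, symmetric] path_B_Ppq [OF gen, symmetric]
        path_B_Pqp [OF gen, symmetric] path_B_qQq [OF gen, symmetric] path_B_qpP [OF gen, symmetric]
        path_B_qPp [OF gen, symmetric] path_B_Qqq [OF gen, symmetric] st_distrib) (simp only: add_ac)
  then show ?thesis by simp
qed

lemma Wop_row_C:
  "Wop (Suc (Suc (length xs))) (u + h) (Wop (Suc (length xs)) u (fz p q (x + h) y l (xs @ [p]) ys k))
   = fz p q x y l xs (p # ys) (k * WC0 x y u) + fo p q x y l xs ((- q) # ys) (k * WCp x y u)
     + fo p (- q) x (- y) l xs (q # ys) (k * WCp x (- y) u)"
  (is "_ = ?rhs")
proof -
  have gen_neg: "generic_pair x (- y)" "generic_pair y (x + h)" "generic_pair (- y) (x + h)"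
    using gen gen_shift(1) by (simp_all add: generic_pair_swap [of "x + h" y])
  \<comment> \<open>Written as -(-y + h) to fit the pattern -(y + h) of the identities with y
    negated.\<close>
  have shift: "form (l + hat (sum_list (xs @ [- q]))) q = - (- y + h)"
    using forms_shift(8) by simp
  note steps1 = Wop_same [of _ xs] Wop_orth [OF orth x y] Wop_orth [OF frame_uminus(3) x form_uminus_right_eq [OF y]]
    Wop_opposite [OF orth x y gen]
  note steps2 = Wop_same [of _ "xs @ [- p]"]
    Wop_opposite [OF orth forms_shift(1,2) gen_shift(1)]
    Wop_opposite [OF frame_uminus(2) form_uminus_right_eq [OF forms_shift(1)] forms_shift(2) gen_shift(4)]
    Wop_opposite [OF frame_uminus(1) forms_shift(2,1) gen_neg(2)]
    Wop_opposite [OF frame_uminus(4) form_uminus_right_eq [OF forms_shift(2)] forms_shift(1) gen_neg(3)]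
    Wop_orth [OF frame_uminus(4) form_uminus_right_eq [OF forms_shift(4)] forms_shift(3)]
    Wop_orth [OF frame_uminus(3) forms_shift(3) form_uminus_right_eq [OF forms_shift(4)]]
    Wop_orth [OF frame_uminus(1) shift forms_shift(7)]
    Wop_orth [OF orth forms_shift(7) shift]
  \<comment> \<open>The frame p, -q has the coordinates x, -y; the paths that involve the other
    direction use the same identities with y negated.\<close>
  note entries = path_C_pPp [OF gen] path_C_Ppp [OF gen] path_C_pqQ [OF gen] path_C_qpQ [OF gen] path_C_qQp [OF gen]
    path_C_pqQ [OF gen_neg(1), simplified uminus_simps wdiag_uminus] path_C_qpQ [OF gen_neg(1), simplified uminus_simps]
    path_C_qQp [OF gen_neg(1), simplified uminus_simps WC0_uminus]
  have "Wop (Suc (Suc (length xs))) (u + h) (Wop (Suc (length xs)) u (fz p q (x + h) y l (xs @ [p]) ys k))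
   = ?rhs + st l (xs @ p # p # (- p) # ys) (k * 0)"
    unfolding fo_def fz_def
    by (simp only: steps1 steps2 [simplified prefix_simps] frame_uminus append_assoc append_Cons append_Nil Wop_add uminus_simps
        st_zero [OF path_C_ppP [OF gen, where u = u]] mult.assoc entries [symmetric] st_distrib) (simp only: add_ac)
  then show ?thesis by simp
qed

end

subsection \<open>The fused operators\<close>

text \<open>The product of G and H in which the denominator \<theta>(u) \<theta>(u + 3h) of H has
  been cancelled, so that it is meaningful for all u.\<close>

definition GH :: "complex \<Rightarrow> complex" where
  "GH u = gg u * gg (u - h) * \<theta> (u + 6 * h) * \<theta> (u - 3 * h) * \<theta> (2 * h) / \<theta> (6 * h)"

text \<open>This is the origin of H. After removal of the common factor it is a single three-term
  relation in u and multiples of h.\<close>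

lemma VQ_K0: "VQ u * K0 = V3 u + GH u" (is "?lhs = ?rhs")
proof -
  note nz = theta_h_nonzero
  let ?H1 = "\<theta> h" and ?H2 = "\<theta> (2 * h)" and ?H3 = "\<theta> (3 * h)"
    and ?H4 = "\<theta> (4 * h)" and ?H5 = "\<theta> (5 * h)" and ?H6 = "\<theta> (6 * h)"
    and ?um3 = "\<theta> (u - 3 * h)" and ?um1 = "\<theta> (u - h)" and ?u0 = "\<theta> u"
    and ?u1 = "\<theta> (u + h)" and ?u2 = "\<theta> (u + 2 * h)" and ?u3 = "\<theta> (u + 3 * h)"
    and ?u4 = "\<theta> (u + 4 * h)" and ?u6 = "\<theta> (u + 6 * h)"
  have args: "\<theta> (u - h + 2 * h) = \<theta> (u + h)" "\<theta> (u - h + 4 * h) = \<theta> (u + 3 * h)"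
    by (rule arg_cong [of _ _ \<theta>]; simp add: c_def algebra_simps)+
  have neg: "\<theta> c = - \<theta> (3 * h)"
    by (rule theta_eq_minus; simp add: c_def algebra_simps)+
  have r1: "?H3 * ?H6 * ?u1 * ?u2 + ?H1 * ?H2 * ?um3 * ?u6 - ?H4 * ?H5 * ?u0 * ?u3 = 0" (is "?r1 = 0")
    using three_term_half_sum [of "u + 6 * h" "3 * h" "6 * h" "u + h" "u + 2 * h"]
      theta_minus [of \<tau> "2 * h"] theta_minus [of \<tau> "u - 3 * h"]
    by (simp add: algebra_simps)
  define k where "k = ?um1 * ?u0 * ?u1 * ?u2 * ?u3 * ?u4 / (?H1 * ?H1 * ?H1 * ?H1 * ?H1 * ?H3 * ?H3 * ?H3 * ?H3 * ?H6)"
  have t1: "VQ u * K0 = (?H4 * ?H5 * ?u0 * ?u3) * k"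
    unfolding k_def V3_def VQ_def GH_def K0_def gg_def by (simp only: args neg single_fraction, subst frac_eq_eq, simp add: nz, simp add: nz, algebra)
  have t2: "V3 u = (?H3 * ?H6 * ?u1 * ?u2) * k"
    unfolding k_def V3_def VQ_def GH_def K0_def gg_def by (simp only: args neg single_fraction, subst frac_eq_eq, simp add: nz, simp add: nz, algebra)
  have t3: "GH u = (?H1 * ?H2 * ?um3 * ?u6) * k"
    unfolding k_def V3_def VQ_def GH_def K0_def gg_def by (simp only: args neg single_fraction, subst frac_eq_eq, simp add: nz, simp add: nz, algebra)
  have "?lhs - ?rhs = (- ?r1) * k"
    unfolding t1 t2 t3 by algebra
  also have "\<dots> = 0"
    by (simp only: r1 mult_zero_right mult_zero_left add_0 diff_0 minus_zero)
  finally show ?thesis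
    by (simp only: right_minus_eq)
qed

text \<open>The scalar in front of the paths with last steps -q, -p in the image of
  \<open>f l l \<odot> f l l\<close>, before those paths are combined with -p, -q.\<close>

definition Ep :: "complex \<Rightarrow> complex \<Rightarrow> complex \<Rightarrow> complex" where
  "Ep x y u = \<theta> (2 * x + 2 * h) * WC0 (- (x + h)) y (u - h) * WCp x y u
     + \<theta> (2 * y + 2 * h) * WCp (- (y + h)) x (u - h) * WBp y x u
     + \<theta> (2 * (- y) + 2 * h) * WCp (- (- y + h)) x (u - h) * WBm (- y) x u"

definition V22 :: "complex \<Rightarrow> complex \<Rightarrow> complex \<Rightarrow> complex" where
  "V22 x y u = V3 u - VQ u * (RR x y + RR x (- y))"

lemma fz_frame:
  "fz (- p) q (- x) y l xs ys k = fz p q x y l xs ys k"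
  "fz p (- q) x (- y) l xs ys k = fz p q x y l xs ys k"
  "fz q p y x l xs ys k = fz p q x y l xs ys k"
  by (simp_all add: fz_def add_ac)

lemma fo_commute: "fo q p y x l xs ys k = fo p q x y l xs ys k"
  by (simp add: fo_def add_ac)

lemma fz_add: "fz p q x y l xs ys (k + k') = fz p q x y l xs ys k + fz p q x y l xs ys k'"
  by (simp add: fz_def distrib_right st_add add_ac)

lemma fo_add: "fo p q x y l xs ys (k + k') = fo p q x y l xs ys k + fo p q x y l xs ys k'"
  by (simp add: fo_def distrib_right st_add add_ac)

lemma fo_0: "fo p q x y l xs ys 0 = 0"
  by (simp add: fo_def)

lemma scale_fz: "scale a (fz p q x y l xs ys k) = fz p q x y l xs ys (a * k)"
  by (simp add: fz_def mult_ac)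

lemma scale_fo: "scale a (fo p q x y l xs ys k) = fo p q x y l xs ys (a * k)"
  by (simp add: fo_def mult_ac)

lemma tensor_fz_right: "m = l + hat (sum_list xs) \<Longrightarrow> st l xs a \<odot> fz p q x y m [] zs k = fz p q x y l xs zs (a * k)"
  by (simp add: fz_def tensor_st mult_ac)

lemma tensor_fz_left: "m = l + hat (sum_list xs) \<Longrightarrow> fz p q x y l xs [] k \<odot> st m zs b = fz p q x y l xs zs (k * b)"
  by (simp add: fz_def tensor_st mult_ac)

lemma tensor_fo_left: "m = l + hat (sum_list xs) + hat p + hat q \<Longrightarrow> fo p q x y l xs [] k \<odot> st m zs b = fo p q x y l xs zs (k * b)"
  by (simp add: fo_def tensor_st mult_ac hat_add add_ac)

lemma f_zero:
  assumes "orth p q"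
  shows "f l l = fz p q (form l p) (form l q) l [] [] 1"
proof -
  have "e l (l + hat s) \<odot> e (l + hat s) l = st l [s, - s] 1" for s
    using tensor_st [of "l + hat s" l "[s]" 1 "[- s]" 1] e_st [of l s] e_st [of "l + hat s" "- s"] by simp
  then show ?thesis
    by (simp add: f_def sum_P1 [OF assms] fz_def)
qed

lemma P1_cases: "p \<in> P\<^sub>1 \<Longrightarrow> p \<in> {\<epsilon> 1, - \<epsilon> 1} \<or> p \<in> {\<epsilon> 2, - \<epsilon> 2}"
  by (auto simp: P\<^sub>1_def)

lemma f_sum:
  assumes "orth p q"
  shows "f l (l + hat p + hat q) = fo p q (form l p) (form l q) l [] [] 1"
proof -
  have main: "f l (l + hat p + hat q) = fo p q (form l p) (form l q) l [] [] 1"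
    if p: "p \<in> {\<epsilon> 1, - \<epsilon> 1}" and q: "q \<in> {\<epsilon> 2, - \<epsilon> 2}" for p q
  proof -
    have inj: "p' + q' = p + q \<longleftrightarrow> p' = p \<and> q' = q" if "p' \<in> {\<epsilon> 1, - \<epsilon> 1}" "q' \<in> {\<epsilon> 2, - \<epsilon> 2}" for p' q'
      using p q that by (auto simp: vec_eq_iff forall_2)
    have "p + q \<noteq> 0"
      using p q by (auto simp: vec_eq_iff forall_2)
    then have ne: "l + hat p + hat q \<noteq> l"
      using hat_inject [of "p + q" 0] by (simp add: hat_add add.assoc)
    have shift: "l + hat p + hat q = l + hat p' + hat q' \<longleftrightarrow> p' = p \<and> q' = q"
      if "p' \<in> {\<epsilon> 1, - \<epsilon> 1}" "q' \<in> {\<epsilon> 2, - \<epsilon> 2}" for p' q'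
      using inj [OF that] hat_inject [of "p + q" "p' + q'"] by (auto simp: hat_add add.assoc)
    define g where "g = (\<lambda>p q. scale (\<theta> (form l (p - q) + h)) (e l (l + hat p) \<odot> e (l + hat p) (l + hat p + hat q))
            + scale (\<theta> (form l (q - p) + h)) (e l (l + hat q) \<odot> e (l + hat q) (l + hat p + hat q)))"
    have "f l (l + hat p + hat q) = (\<Sum>p'\<in>{\<epsilon> 1, - \<epsilon> 1}. \<Sum>q'\<in>{\<epsilon> 2, - \<epsilon> 2}. if p' = p \<and> q' = q then g p q else 0)"
      unfolding f_def using ne
    proof (simp only: if_False, intro sum.cong refl)
      fix p' q' assume "p' \<in> {\<epsilon> 1, - \<epsilon> 1}" "q' \<in> {\<epsilon> 2, - \<epsilon> 2}"
      note eq = shift [OF this]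
      show "(if l + hat p + hat q = l + hat p' + hat q'
            then scale (\<theta> (form l (p' - q') + h)) (e l (l + hat p') \<odot> e (l + hat p') (l + hat p + hat q))
              + scale (\<theta> (form l (q' - p') + h)) (e l (l + hat q') \<odot> e (l + hat q') (l + hat p + hat q))
            else 0) = (if p' = p \<and> q' = q then g p q else 0)"
        unfolding eq by (cases "p' = p \<and> q' = q") (auto simp only: g_def if_True if_False simp_thms)
    qed
    also have "\<dots> = (\<Sum>p'\<in>{\<epsilon> 1, - \<epsilon> 1}. if p' = p then (\<Sum>q'\<in>{\<epsilon> 2, - \<epsilon> 2}. if q' = q then g p q else 0) else 0)"
      by (intro sum.cong refl) simp
    also have "\<dots> = g p q"
      using p q by (simp only: sum.delta' sum.delta finite.intros if_True)
    also have "g p q = fo p q (form l p) (form l q) l [] [] 1"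
    proof -
      have "e l (l + hat p) \<odot> e (l + hat p) (l + hat p + hat q) = st l [p, q] 1"
        using tensor_st [of "l + hat p" l "[p]" 1 "[q]" 1] by (simp add: e_st)
      moreover have "e l (l + hat q) \<odot> e (l + hat q) (l + hat p + hat q) = st l [q, p] 1"
        using tensor_st [of "l + hat q" l "[q]" 1 "[p]" 1] e_st [of "l + hat q" p] by (simp add: e_st add_ac)
      ultimately show ?thesis
        by (simp add: g_def fo_def)
    qed
    finally show ?thesis .
  qed
  have "p \<in> {\<epsilon> 1, - \<epsilon> 1} \<and> q \<in> {\<epsilon> 2, - \<epsilon> 2} \<or> q \<in> {\<epsilon> 1, - \<epsilon> 1} \<and> p \<in> {\<epsilon> 2, - \<epsilon> 2}"
    using assms P1_cases [of p] P1_cases [of q] unfolding orth_def by auto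
  then show ?thesis
  proof
    assume "q \<in> {\<epsilon> 1, - \<epsilon> 1} \<and> p \<in> {\<epsilon> 2, - \<epsilon> 2}"
    then have "f l (l + hat q + hat p) = fo q p (form l q) (form l p) l [] [] 1"
      using main by blast
    then show ?thesis
      by (simp only: fo_commute [of q p] add.assoc add.commute [of "hat q"])
  qed (use main in blast)
qed

section \<open>Regrouping the four factors into two rows\<close>

lemma Wop_sum: "Wop j z (\<Sum>i\<in>A. g i) = (\<Sum>i\<in>A. Wop j z (g i))"
  by (induction A rule: infinite_finite_induct) auto

lemma Wop_if_zero: "Wop j z (if P then v else 0) = (if P then Wop j z v else 0)"
  by simp

text \<open>The operators act on disjoint pairs of steps, and replacing a, b by steps with the same
  sum does not move the vertex where the second pair begins.\<close>

lemma Wop_3_1_commute: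
  assumes "a \<in> P\<^sub>1" "b \<in> P\<^sub>1" "s \<in> P\<^sub>1" "t \<in> P\<^sub>1"
  shows "Wop 3 z (Wop 1 w (st l [a, b, s, t] k)) = Wop 1 w (Wop 3 z (st l [a, b, s, t] k))"
proof -
  have one: "Wop 1 w (st l (c # d # ys) k) = (\<Sum>r\<in>P\<^sub>1. if c + d - r \<in> P\<^sub>1
        then st l (r # (c + d - r) # ys) (k * bw l c d r (c + d - r) w) else 0)" if "c \<in> P\<^sub>1" "d \<in> P\<^sub>1" for c d ys k
    using Wop_st [OF that, of "[]" w l ys k] by (simp cong: if_cong)
  have three: "Wop 3 z (st l [c, d, s, t] k) = (\<Sum>r\<in>P\<^sub>1. if s + t - r \<in> P\<^sub>1
        then st l [c, d, r, s + t - r] (k * bw (l + hat (c + d)) s t r (s + t - r) z) else 0)" for c d k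
    using Wop_st [OF assms(3,4), of "[c, d]" z l "[]" k] by (simp add: numeral_3_eq_3 cong: if_cong)
  have cancel: "r + (a + b - r) = a + b" for r
    by simp
  have "Wop 3 z (Wop 1 w (st l [a, b, s, t] k)) = (\<Sum>r\<in>P\<^sub>1. \<Sum>r'\<in>P\<^sub>1. if a + b - r \<in> P\<^sub>1 \<and> s + t - r' \<in> P\<^sub>1
        then st l [r, a + b - r, r', s + t - r'] (k * bw l a b r (a + b - r) w * bw (l + hat (a + b)) s t r' (s + t - r') z) else 0)"
    unfolding one [OF assms(1,2)] Wop_sum Wop_if_zero three by (intro sum.cong refl) (auto simp: cancel cong: if_cong)
  also have "\<dots> = (\<Sum>r'\<in>P\<^sub>1. \<Sum>r\<in>P\<^sub>1. if a + b - r \<in> P\<^sub>1 \<and> s + t - r' \<in> P\<^sub>1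
        then st l [r, a + b - r, r', s + t - r'] (k * bw l a b r (a + b - r) w * bw (l + hat (a + b)) s t r' (s + t - r') z) else 0)"
    by (rule sum.swap)
  also have "\<dots> = Wop 1 w (Wop 3 z (st l [a, b, s, t] k))"
    unfolding three Wop_sum Wop_if_zero one [OF assms(1,2)] by (intro sum.cong refl) (auto simp: mult_ac cong: if_cong)
  finally show ?thesis .
qed

lemma Wop_3_1_2_commute:
  assumes "a \<in> P\<^sub>1" "b \<in> P\<^sub>1" "s \<in> P\<^sub>1" "t \<in> P\<^sub>1"
  shows "Wop 3 z (Wop 1 w (Wop 2 v (st l [a, b, s, t] k))) = Wop 1 w (Wop 3 z (Wop 2 v (st l [a, b, s, t] k)))"
proof -
  have two: "Wop 2 v (st l [a, b, s, t] k) = (\<Sum>r\<in>P\<^sub>1. if b + s - r \<in> P\<^sub>1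
        then st l [a, r, b + s - r, t] (k * bw (l + hat a) b s r (b + s - r) v) else 0)"
    using Wop_st [OF assms(2,3), of "[a]" v l "[t]" k] by (simp add: numeral_2_eq_2 cong: if_cong)
  show ?thesis
    unfolding two Wop_sum Wop_if_zero
    by (intro sum.cong refl) (use assms in \<open>auto simp: Wop_3_1_commute simp del: One_nat_def\<close>)
qed

definition fused where
  "fused u v = Wop 2 (u + h) (Wop 3 u (Wop 1 u (Wop 2 (u - h) v)))"

lemma fused_add: "fused u (v + w) = fused u v + fused u w"
  by (simp add: fused_def)

lemma fused_st:
  assumes "a \<in> P\<^sub>1" "b \<in> P\<^sub>1" "s \<in> P\<^sub>1" "t \<in> P\<^sub>1"
  shows "fused u (st l [a, b, s, t] k) = Wop 2 (u + h) (Wop 1 u (Wop 3 u (Wop 2 (u - h) (st l [a, b, s, t] k))))"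
  unfolding fused_def Wop_3_1_2_commute [OF assms] ..

lemma fused_fz:
  assumes "orth p q" "a \<in> P\<^sub>1" "b \<in> P\<^sub>1"
  shows "fused u (fz p q x y l [a, b] [] k) = Wop 2 (u + h) (Wop 1 u (Wop 3 u (Wop 2 (u - h) (fz p q x y l [a, b] [] k))))"
proof -
  have "p \<in> P\<^sub>1" "q \<in> P\<^sub>1" "- p \<in> P\<^sub>1" "- q \<in> P\<^sub>1"
    using assms(1) by (auto simp: orth_def)
  then show ?thesis
    using assms(2,3) by (simp add: fz_def fused_add fused_st)
qed

lemma V22_K0: "generic_pair x y \<Longrightarrow> V22 x y u = V3 u - VQ u * (K0 - (TT x y + TT x (- y) + TT (- x) y + TT (- x) (- y)))"
  using sum_TT [of x y] unfolding V22_def by (metis (no_types, lifting) add.assoc add_diff_cancel_left')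

text \<open>By \<open>sum_TT\<close> the weight depends on x and y only through the sum of
  \<open>TT\<close> over all signs, which the Weyl group preserves. Hence the contributions of p,
  -p, q and -q share one coefficient.\<close>

lemma V22_frame:
  assumes "generic_pair x y"
  shows "V22 (- x) y u = V22 x y u" "V22 y x u = V22 x y u" "V22 (- y) x u = V22 x y u"
proof -
  have TT: "TT b a = TT a b" for a b
    by (simp add: TT_def add.commute mult_ac)
  have "generic_pair y x"
    using assms generic_pair_swap by blast
  then show "V22 (- x) y u = V22 x y u" "V22 y x u = V22 x y u" "V22 (- y) x u = V22 x y u"
    using assms by (simp_all add: V22_K0 TT [of y] TT [of "- y"] add_ac)
qed

lemma V_commute: "V0 y x u = V0 x y u" "V1 y x u = V1 x y u"
  by (simp_all add: V0_def V1_def add.commute diff_diff_eq)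

text \<open>The weight from \<open>f l l \<odot> f l l\<close> to the vector through l + hat p + hat
  q, read off from one component; \<open>cE_eq\<close> shows that the other component gives the same
  value.\<close>

definition cE where "cE x y u = Ep x y u / \<theta> (x - y + h)"

lemma cE_eq:
  assumes "generic_pair x y"
  shows "Ep x y u = cE x y u * \<theta> (x - y + h)" "Ep y x u = cE x y u * \<theta> (y - x + h)"
  using zero_step_p [OF assms, of u] generic_pairD(7) [OF assms]
  by (simp_all add: cE_def Ep_def distrib_right eq_divide_eq)

text \<open>$W^{1,2}$ and $W^{2,3}$ do not change the last of the four steps, so the vector obtained from
  $W^{3,4}(u) W^{2,3}(u-\hbar)$ is split according to it: \<open>mid_zero\<close> collects the last step \<open>- p\<close> in the
  image of \<open>f l l \<odot> f l l\<close>; \<open>mid_sum\<close> and \<open>mid_same\<close> collect the last steps \<open>q\<close> and \<open>- p\<close> in the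
  image of \<open>f l \<nu> \<odot> f \<nu> \<nu>\<close>, $\nu = \lambda + \widehat p + \widehat q$. The versions with \<open>final\<close>
  are their images under $W^{2,3}(u+\hbar) W^{1,2}(u)$.\<close>

definition mid_zero where
  "mid_zero p q x y l u = fz (- p) q (- (x + h)) y l [p] [- p] (\<theta> (2 * x + 2 * h) * WC0 (- (x + h)) y (u - h))
     + fo (- q) p (- (y + h)) x l [q] [- p] (\<theta> (2 * y + 2 * h) * WCp (- (y + h)) x (u - h))
     + fo q p (- (- y + h)) x l [- q] [- p] (\<theta> (2 * (- y) + 2 * h) * WCp (- (- y + h)) x (u - h))"

definition final_zero where
  "final_zero p q x y l u = fz p q x y l [] [p, - p] (V22 x y u * \<theta> (2 * x + 2 * h))
     + fo p q x y l [] [- q, - p] (Ep x y u) + fo p (- q) x (- y) l [] [q, - p] (Ep x (- y) u)"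

definition mid_sum where
  "mid_sum p q x y l u = fz q p y (x + h) l [p] [q] (\<theta> (x - y + h) * WC0 y (x + h) (u - h))
     + fo p (- q) x (- (y + h)) l [q] [q] (\<theta> (y - x + h) * WCp x (- (y + h)) (u - h))"

definition final_sum where
  "final_sum p q x y l u = fz p q x y l [] [p, q] (V0 x y u * \<theta> (x - y + h))
     + fo p q x y l [] [- q, q] (V1 x y u * \<theta> (2 * (- (y + h)) + 2 * h))"

definition mid_same where
  "mid_same p q x y l u = fo q p y (x + h) l [p] [- p] (\<theta> (x - y + h) * WCp y (x + h) (u - h))"

definition final_same where
  "final_same p q x y l u = fo p q x y l [] [p, - p] (V1 x y u * \<theta> (2 * (x + h) + 2 * h))"

context
  fixes p q :: weight and l :: weight and x y :: complex
  assumes orth: "orth p q" and x: "form l p = x" and y: "form l q = y" and gen: "generic_pair x y"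
begin

lemma row_A_start: "Wop 2 (u + h) (Wop 1 u (fo p q (x + h) y l [p] ys k)) = fo p q x y l [] (p # ys) (k * WA u)"
  using Wop_row_A [OF orth, of l "[]" x y u ys k] x y gen by (simp add: numeral_2_eq_2)

lemma row_B_start: "Wop 2 (u + h) (Wop 1 u (fo (- p) q (- (x + h)) y l [p] ys k))
   = fz p q x y l [] (q # ys) (k * WB0 x y u) + fo p q x y l [] ((- p) # ys) (k * WBp x y u)
     + fo (- p) q (- x) y l [] (p # ys) (k * WBm x y u)"
  using Wop_row_B [OF orth, of l "[]" x y u ys k] x y gen by (simp add: numeral_2_eq_2)

lemma row_C_start: "Wop 2 (u + h) (Wop 1 u (fz p q (x + h) y l [p] ys k))
   = fz p q x y l [] (p # ys) (k * WC0 x y u) + fo p q x y l [] ((- q) # ys) (k * WCp x y u)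
     + fo p (- q) x (- y) l [] (q # ys) (k * WCp x (- y) u)"
  using Wop_row_C [OF orth, of l "[]" x y u ys k] x y gen by (simp add: numeral_2_eq_2)

end

text \<open>Case C one position later, with u - h for u: its second parameter (u - h) + h is then
  the u of \<open>Wop 3 u\<close>.\<close>

lemma row_C_next:
  assumes "orth p q" "form (l + hat a) p = x" "form (l + hat a) q = y" "generic_pair x y"
  shows "Wop 3 u (Wop 2 (u - h) (fz p q (x + h) y l [a, p] ys k))
   = fz p q x y l [a] (p # ys) (k * WC0 x y (u - h)) + fo p q x y l [a] ((- q) # ys) (k * WCp x y (u - h))
     + fo p (- q) x (- y) l [a] (q # ys) (k * WCp x (- y) (u - h))"
  using Wop_row_C [OF assms(1), of l "[a]" x y "u - h" ys k] assms(2-4) by (simp add: numeral_2_eq_2 numeral_3_eq_3)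

context
  fixes p q :: weight and l :: weight and x y :: complex
  assumes orth: "orth p q" and x: "form l p = x" and y: "form l q = y" and gen: "generic_pair x y"
begin

lemma frame_rev: "form l (- p) = - x" "form l (- q) = - y" "orth q p" "orth (- p) q" "orth p (- q)" "orth (- q) p" "orth (- p) (- q)"
    "generic_pair y x" "generic_pair (- x) y" "generic_pair x (- y)" "generic_pair (- y) x"
  using x y orth orth_sym [OF orth] orth_uminus_left [OF orth] orth_uminus_right [OF orth] gen
    orth_uminus_left [OF orth_sym [OF orth]] orth_uminus_right [OF orth_uminus_left [OF orth]]
    generic_pair_swap [of x y]
  by simp_all

lemma frame_shift: "form (l + hat p) p = x + h" "form (l + hat p) q = y" "form (l + hat q) p = x" "form (l + hat q) q = y + h"
  using x y by (simp_all add: form_hat [OF orth])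

text \<open>At \<lambda> + hat p, from where the step -p leads back, the frame -p, q has the
  coordinates -(x + h) and y, so case C applies again.\<close>

lemma first_zero_step:
  "Wop 3 u (Wop 2 (u - h) (fz p q x y l [p, - p] [] k))
    = fz (- p) q (- (x + h)) y l [p] [- p] (k * WC0 (- (x + h)) y (u - h))
      + fo (- p) q (- (x + h)) y l [p] [- q] (k * WCp (- (x + h)) y (u - h))
      + fo (- p) (- q) (- (x + h)) (- y) l [p] [q] (k * WCp (- (x + h)) (- y) (u - h))"
proof -
  have "generic_pair (x + h) y"
    using generic_pair_shift [OF gen, of 1 0] by simp
  then have "generic_pair (- (x + h)) y"
    by (simp only: generic_pair_uminus_left)
  then have "Wop 3 u (Wop 2 (u - h) (fz (- p) q (- (x + h) + h) y l [p, - p] [] k))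
    = fz (- p) q (- (x + h)) y l [p] [- p] (k * WC0 (- (x + h)) y (u - h))
      + fo (- p) q (- (x + h)) y l [p] [- q] (k * WCp (- (x + h)) y (u - h))
      + fo (- p) (- q) (- (x + h)) (- y) l [p] [q] (k * WCp (- (x + h)) (- y) (u - h))"
    by (intro row_C_next frame_rev frame_shift form_uminus_right_eq)
  moreover have "fz (- p) q (- (x + h) + h) y l [p, - p] [] k = fz p q x y l [p, - p] [] k"
    using fz_frame(1) [of p q x y] by simp
  ultimately show ?thesis by simp
qed

lemma second_zero_step: "Wop 2 (u + h) (Wop 1 u (mid_zero p q x y l u)) = final_zero p q x y l u"
proof -
  define k1 k2 k3 where "k1 = \<theta> (2 * x + 2 * h) * WC0 (- (x + h)) y (u - h)"
    and "k2 = \<theta> (2 * y + 2 * h) * WCp (- (y + h)) x (u - h)"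
    and "k3 = \<theta> (2 * (- y) + 2 * h) * WCp (- (- y + h)) x (u - h)"
  note rows = row_C_start [OF orth x y gen] row_B_start [OF frame_rev(3) y x frame_rev(8)]
    row_B_start [OF frame_rev(6) frame_rev(2) x frame_rev(11), unfolded minus_minus]
  note frames = fz_frame(1) [of q p y x] fz_frame(3) [of p q x y] fo_commute [of p q x y] fo_commute [of p "- q" x "- y"]
  have "Wop 2 (u + h) (Wop 1 u (mid_zero p q x y l u))
    = fz p q x y l [] [p, - p] (k1 * WC0 x y u + k2 * WB0 y x u + k3 * WB0 (- y) x u)
      + fo p q x y l [] [- q, - p] (k1 * WCp x y u + k2 * WBp y x u + k3 * WBm (- y) x u)
      + fo p (- q) x (- y) l [] [q, - p] (k1 * WCp x (- y) u + k2 * WBm y x u + k3 * WBp (- y) x u)"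
    unfolding mid_zero_def k1_def [symmetric] k2_def [symmetric] k3_def [symmetric] fz_frame(1) [of p q "x + h" y]
    by (simp only: Wop_add rows frames fz_add fo_add) (simp only: add_ac)
  also have "k1 * WC0 x y u + k2 * WB0 y x u + k3 * WB0 (- y) x u = V22 x y u * \<theta> (2 * x + 2 * h)"
    using zero_step_0 [OF gen, of u] by (simp add: V22_def k1_def k2_def k3_def algebra_simps)
  also have "k1 * WCp x y u + k2 * WBp y x u + k3 * WBm (- y) x u = Ep x y u"
    by (simp only: Ep_def k1_def k2_def k3_def)
  also have "k1 * WCp x (- y) u + k2 * WBm y x u + k3 * WBp (- y) x u = Ep x (- y) u"
    by (simp only: Ep_def k1_def k2_def k3_def minus_minus WC0_uminus) (simp only: add_ac)
  finally show ?thesis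
    by (simp only: final_zero_def)
qed

text \<open>Seen from l + hat p + hat q, the way back is the f-vector of the frame -p, -q with
  coordinates -(x + h), -(y + h). Its two coefficients are the theta values in
  \<open>cE_eq\<close>.\<close>

lemma collect_zero_step:
  "fo p q x y l [] [- q, - p] (Ep x y u) + fo q p y x l [] [- p, - q] (Ep y x u)
    = scale (cE x y u) (f l (l + hat p + hat q) \<odot> f (l + hat p + hat q) l)"
proof -
  let ?b = "l + hat p + hat q"
  have "f ?b (?b + hat (- p) + hat (- q)) = fo (- p) (- q) (form ?b (- p)) (form ?b (- q)) ?b [] [] 1"
    by (rule f_sum) (rule frame_rev)
  moreover have "form ?b (- p) = - (x + h)" "form ?b (- q) = - (y + h)"
    using x y by (simp_all add: form_hat [OF orth])
  moreover have "?b + hat (- p) + hat (- q) = l" by simp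
  ultimately have "f ?b l = fo (- p) (- q) (- (x + h)) (- (y + h)) ?b [] [] 1"
    by metis
  also have "\<dots> = st ?b [- q, - p] (\<theta> (x - y + h)) + st ?b [- p, - q] (\<theta> (y - x + h))"
    by (simp add: fo_def algebra_simps)
  finally have "f l ?b \<odot> f ?b l = fo p q x y l [] [- q, - p] (\<theta> (x - y + h)) + fo p q x y l [] [- p, - q] (\<theta> (y - x + h))"
    using f_sum [OF orth, of l] x y by (simp add: tensor_fo_left)
  then show ?thesis
    by (simp add: cE_eq [OF gen] scale_fo fo_commute [of p q x y])
qed

lemma first_sum_step:
  "Wop 3 u (Wop 2 (u - h) (fz q p (y + h) (x + h) l [p, q] [] k))
    = fz q p y (x + h) l [p] [q] (k * WC0 y (x + h) (u - h)) + fo q p y (x + h) l [p] [- p] (k * WCp y (x + h) (u - h))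
      + fo q (- p) y (- (x + h)) l [p] [p] (k * WCp y (- (x + h)) (u - h))"
proof -
  have "generic_pair y (x + h)"
    using generic_pair_shift [OF gen, of 1 0] generic_pair_swap [of "x + h" y] by simp
  then show ?thesis
    by (intro row_C_next frame_rev frame_shift)
qed

lemma second_sum_step: "Wop 2 (u + h) (Wop 1 u (mid_sum p q x y l u)) = final_sum p q x y l u"
proof -
  define k1 k2 where "k1 = \<theta> (x - y + h) * WC0 y (x + h) (u - h)"
    and "k2 = \<theta> (y - x + h) * WCp x (- (y + h)) (u - h)"
  note rows = row_C_start [OF orth x y gen] row_B_start [OF frame_rev(3) y x frame_rev(8)]
  note frames = fz_frame(3) [of q p y "x + h"] fz_frame(3) [of p q x y] fo_commute [of p q x y] fo_commute [of p "- q" x "- y"]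
  have "Wop 2 (u + h) (Wop 1 u (mid_sum p q x y l u))
    = fz p q x y l [] [p, q] (k1 * WC0 x y u + k2 * WB0 y x u)
      + fo p q x y l [] [- q, q] (k1 * WCp x y u + k2 * WBp y x u)
      + fo p (- q) x (- y) l [] [q, q] (k1 * WCp x (- y) u + k2 * WBm y x u)"
    unfolding mid_sum_def k1_def [symmetric] k2_def [symmetric] fo_commute [of p "- q" x "- (y + h)"]
    by (simp only: Wop_add rows frames fz_add fo_add) (simp only: add_ac)
  also have "k1 * WC0 x y u + k2 * WB0 y x u = V0 x y u * \<theta> (x - y + h)"
    using sum_step_0 [OF gen, of u] by (simp only: k1_def k2_def)
  also have "k1 * WCp x y u + k2 * WBp y x u = V1 x y u * \<theta> (2 * (- (y + h)) + 2 * h)"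
    using sum_step_p [OF gen, of u] by (simp only: k1_def k2_def)
  also have "k1 * WCp x (- y) u + k2 * WBm y x u = 0"
    using sum_step_m [OF gen, of u] by (simp only: k1_def k2_def)
  finally show ?thesis
    by (simp only: final_sum_def fo_0 add_0_right)
qed

lemma second_same: "Wop 2 (u + h) (Wop 1 u (mid_same p q x y l u)) = final_same p q x y l u"
  by (simp only: mid_same_def final_same_def fo_commute [of q p y "x + h"] row_A_start [OF orth x y gen] sum_step_A [OF gen])

end

section \<open>Images of pairs of f-vectors under the two-row operator\<close>

lemma f_zero_zero:
  assumes orth: "orth p q" and x: "form l p = x" and y: "form l q = y"
  shows "f l l \<odot> f l l = fz p q x y l [p, - p] [] (\<theta> (2 * x + 2 * h)) + fz p q x y l [- p, p] [] (\<theta> (2 * (- x) + 2 * h))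
    + fz p q x y l [q, - q] [] (\<theta> (2 * y + 2 * h)) + fz p q x y l [- q, q] [] (\<theta> (2 * (- y) + 2 * h))"
proof -
  have 1: "f l l = fz p q x y l [] [] 1"
    using f_zero [OF orth, of l] x y by simp
  have 2: "f l l = (st l [p, - p] (\<theta> (2 * x + 2 * h)) + st l [- p, p] (\<theta> (2 * (- x) + 2 * h))
    + st l [q, - q] (\<theta> (2 * y + 2 * h)) + st l [- q, q] (\<theta> (2 * (- y) + 2 * h)))"
    unfolding 1 by (simp only: fz_def append_Nil mult_1)
  have "f l l \<odot> f l l = (st l [p, - p] (\<theta> (2 * x + 2 * h)) + st l [- p, p] (\<theta> (2 * (- x) + 2 * h))
    + st l [q, - q] (\<theta> (2 * y + 2 * h)) + st l [- q, q] (\<theta> (2 * (- y) + 2 * h))) \<odot> fz p q x y l [] [] 1"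
    by (rule arg_cong2 [of _ _ _ _ "(\<odot>)"]) (fact 2, fact 1)
  then show ?thesis
    by (simp only: tensor_add_left) (simp add: tensor_fz_right)
qed

text \<open>Here the right factor is expanded, to recognise the result; \<open>f_zero_zero\<close>
  expands the left one, to start the computation.\<close>

lemma f_zero_zero':
  assumes orth: "orth p q" and x: "form l p = x" and y: "form l q = y"
  shows "f l l \<odot> f l l = fz p q x y l [] [p, - p] (\<theta> (2 * x + 2 * h)) + fz p q x y l [] [- p, p] (\<theta> (2 * (- x) + 2 * h))
    + fz p q x y l [] [q, - q] (\<theta> (2 * y + 2 * h)) + fz p q x y l [] [- q, q] (\<theta> (2 * (- y) + 2 * h))"
proof -
  have 1: "f l l = fz p q x y l [] [] 1"
    using f_zero [OF orth, of l] x y by simp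
  have 2: "f l l = (st l [p, - p] (\<theta> (2 * x + 2 * h)) + st l [- p, p] (\<theta> (2 * (- x) + 2 * h))
    + st l [q, - q] (\<theta> (2 * y + 2 * h)) + st l [- q, q] (\<theta> (2 * (- y) + 2 * h)))"
    unfolding 1 by (simp only: fz_def append_Nil mult_1)
  have "f l l \<odot> f l l = fz p q x y l [] [] 1 \<odot> (st l [p, - p] (\<theta> (2 * x + 2 * h)) + st l [- p, p] (\<theta> (2 * (- x) + 2 * h))
    + st l [q, - q] (\<theta> (2 * y + 2 * h)) + st l [- q, q] (\<theta> (2 * (- y) + 2 * h)))"
    by (rule arg_cong2 [of _ _ _ _ "(\<odot>)"]) (fact 1, fact 2)
  then show ?thesis
    by (simp only: tensor_add_right) (simp add: tensor_fz_left)
qed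

text \<open>Sorting by the last step gives four \<open>mid_zero\<close>. The first terms of their
  images form \<open>f l l \<odot> f l l\<close> with the common coefficient \<open>V22\<close>; the
  other eight terms pair off by \<open>collect_zero_step\<close>.\<close>

lemma fused_zero_step:
  assumes orth: "orth p q" and x: "form l p = x" and y: "form l q = y" and gen: "generic_pair x y"
  shows "fused u (f l l \<odot> f l l) = scale (V22 x y u) (f l l \<odot> f l l)
    + scale (cE x y u) (f l (l + hat p + hat q) \<odot> f (l + hat p + hat q) l)
    + scale (cE x (- y) u) (f l (l + hat p + hat (- q)) \<odot> f (l + hat p + hat (- q)) l)
    + scale (cE (- x) y u) (f l (l + hat (- p) + hat q) \<odot> f (l + hat (- p) + hat q) l)
    + scale (cE (- x) (- y) u) (f l (l + hat (- p) + hat (- q)) \<odot> f (l + hat (- p) + hat (- q)) l)"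
proof -
  note R = frame_rev [OF orth x y gen]
  have mem: "p \<in> P\<^sub>1" "q \<in> P\<^sub>1" "- p \<in> P\<^sub>1" "- q \<in> P\<^sub>1"
    using orth by (auto simp: orth_def)
  note first = first_zero_step [OF orth x y gen] first_zero_step [OF R(4) R(1) y R(9), unfolded minus_minus fz_frame(1)]
    first_zero_step [OF R(3) y x R(8), unfolded fz_frame(3) [of q p y x]]
    first_zero_step [OF R(6) R(2) x R(11), unfolded minus_minus fz_frame(1) fz_frame(3) [of q p y x]]
  have "Wop 3 u (Wop 2 (u - h) (f l l \<odot> f l l)) = mid_zero p q x y l u + mid_zero (- p) q (- x) y l u + mid_zero q p y x l u + mid_zero (- q) p (- y) x l u"
    unfolding f_zero_zero [OF orth x y] mid_zero_def minus_minus by (simp only: Wop_add first minus_minus) (simp only: add_ac)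
  moreover have "fused u (f l l \<odot> f l l) = Wop 2 (u + h) (Wop 1 u (Wop 3 u (Wop 2 (u - h) (f l l \<odot> f l l))))"
    unfolding f_zero_zero [OF orth x y] by (simp only: fused_add Wop_add fused_fz [OF orth] mem)
  ultimately have "fused u (f l l \<odot> f l l) = final_zero p q x y l u + final_zero (- p) q (- x) y l u + final_zero q p y x l u + final_zero (- q) p (- y) x l u"
    by (simp only: Wop_add second_zero_step [OF orth x y gen] second_zero_step [OF R(4) R(1) y R(9)] second_zero_step [OF R(3) y x R(8)] second_zero_step [OF R(6) R(2) x R(11)])
  also have "\<dots> = scale (V22 x y u) (f l l \<odot> f l l)
    + (fo p q x y l [] [- q, - p] (Ep x y u) + fo q p y x l [] [- p, - q] (Ep y x u))
    + (fo p (- q) x (- y) l [] [q, - p] (Ep x (- y) u) + fo (- q) p (- y) x l [] [- p, q] (Ep (- y) x u))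
    + (fo (- p) q (- x) y l [] [- q, p] (Ep (- x) y u) + fo q (- p) y (- x) l [] [p, - q] (Ep y (- x) u))
    + (fo (- p) (- q) (- x) (- y) l [] [q, p] (Ep (- x) (- y) u) + fo (- q) (- p) (- y) (- x) l [] [p, q] (Ep (- y) (- x) u))"
    unfolding final_zero_def f_zero_zero' [OF orth x y] V22_frame [OF gen]
    by (simp only: scale_add scale_fz minus_minus fz_frame(1) fz_frame(3) [of q p y x]) (simp only: add_ac)
  also note collect_zero_step [OF orth x y gen]
  also note collect_zero_step [OF R(5) x R(2) R(10), unfolded minus_minus]
  also note collect_zero_step [OF R(4) R(1) y R(9), unfolded minus_minus]
  also note collect_zero_step [OF R(7) R(1,2), unfolded minus_minus generic_pair_uminus generic_pair_uminus_left, OF gen]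
  finally show ?thesis .
qed

text \<open>\<open>V0\<close> and \<open>V1\<close> are symmetric in x and y. So the images that
  start with p, q and with q, p combine: two terms with \<open>V0\<close> form
  \<open>f l l \<odot> f l \<nu>\<close>, and four with \<open>V1\<close> form
  \<open>f l \<nu> \<odot> f \<nu> \<nu>\<close>.\<close>

lemma fused_sum_step:
  assumes orth: "orth p q" and x: "form l p = x" and y: "form l q = y" and gen: "generic_pair x y"
  defines "\<nu> \<equiv> l + hat p + hat q"
  shows "fused u (f l \<nu> \<odot> f \<nu> \<nu>) = scale (V0 x y u) (f l l \<odot> f l \<nu>) + scale (V1 x y u) (f l \<nu> \<odot> f \<nu> \<nu>)"
proof -
  note R = frame_rev [OF orth x y gen]
  have mem: "p \<in> P\<^sub>1" "q \<in> P\<^sub>1"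
    using orth by (auto simp: orth_def)
  have fl: "f l l = fz p q x y l [] [] 1" "f l \<nu> = fo p q x y l [] [] 1"
    using f_zero [OF orth, of l] f_sum [OF orth, of l] x y by (simp_all add: \<nu>_def)
  have "form \<nu> p = x + h" "form \<nu> q = y + h"
    using x y by (simp_all add: \<nu>_def form_hat [OF orth])
  then have f\<nu>: "f \<nu> \<nu> = fz p q (x + h) (y + h) \<nu> [] [] 1"
    using f_zero [OF orth, of \<nu>] by simp
  have fo_st: "fo p q x y l [] [] 1 = st l [p, q] (\<theta> (x - y + h)) + st l [q, p] (\<theta> (y - x + h))"
    by (simp add: fo_def)
  have start: "f l \<nu> \<odot> f \<nu> \<nu> = fz q p (y + h) (x + h) l [p, q] [] (\<theta> (x - y + h)) + fz p q (x + h) (y + h) l [q, p] [] (\<theta> (y - x + h))"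
    unfolding fl f\<nu> fo_st fz_frame(3) [of p q "x + h" "y + h"]
    by (simp add: tensor_fz_right \<nu>_def hat_add add_ac)
  note first = first_sum_step [OF orth x y gen] first_sum_step [OF R(3) y x R(8)]
  have "Wop 3 u (Wop 2 (u - h) (f l \<nu> \<odot> f \<nu> \<nu>)) = mid_sum p q x y l u + mid_same p q x y l u + mid_sum q p y x l u + mid_same q p y x l u"
    unfolding start mid_sum_def mid_same_def by (simp only: Wop_add first) (simp only: add_ac)
  moreover have "fused u (f l \<nu> \<odot> f \<nu> \<nu>) = Wop 2 (u + h) (Wop 1 u (Wop 3 u (Wop 2 (u - h) (f l \<nu> \<odot> f \<nu> \<nu>))))"
    unfolding start by (simp only: fused_add Wop_add fused_fz [OF orth] fused_fz [OF R(3)] mem)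
  ultimately have "fused u (f l \<nu> \<odot> f \<nu> \<nu>) = final_sum p q x y l u + final_same p q x y l u + final_sum q p y x l u + final_same q p y x l u"
    by (simp only: Wop_add second_sum_step [OF orth x y gen] second_sum_step [OF R(3) y x R(8)] second_same [OF orth x y gen] second_same [OF R(3) y x R(8)])
  moreover have "f l l \<odot> f l \<nu> = fz p q x y l [] [p, q] (\<theta> (x - y + h)) + fz p q x y l [] [q, p] (\<theta> (y - x + h))"
    unfolding fl fo_st by (simp add: tensor_fz_left)
  moreover have "f l \<nu> \<odot> f \<nu> \<nu> = fo p q x y l [] [p, - p] (\<theta> (2 * (x + h) + 2 * h)) + fo p q x y l [] [- p, p] (\<theta> (2 * (- (x + h)) + 2 * h))
      + fo p q x y l [] [q, - q] (\<theta> (2 * (y + h) + 2 * h)) + fo p q x y l [] [- q, q] (\<theta> (2 * (- (y + h)) + 2 * h))"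
  proof -
    have "f \<nu> \<nu> = st \<nu> [p, - p] (\<theta> (2 * (x + h) + 2 * h)) + st \<nu> [- p, p] (\<theta> (2 * (- (x + h)) + 2 * h))
      + st \<nu> [q, - q] (\<theta> (2 * (y + h) + 2 * h)) + st \<nu> [- q, q] (\<theta> (2 * (- (y + h)) + 2 * h))"
      unfolding f\<nu> by (simp only: fz_def append_Nil mult_1)
    then show ?thesis
      unfolding fl by (simp only: tensor_add_right tensor_fo_left [OF refl] \<nu>_def sum_list.Nil hat_0 add_0_right mult_1
          tensor_fo_left [of \<nu> l "[]" p q, unfolded \<nu>_def sum_list.Nil hat_0 add_0_right, OF refl])
  qed
  ultimately show ?thesis
    unfolding final_sum_def final_same_def V_commute [of y x] 
    by (simp only: scale_add scale_fz scale_fo fz_frame(3) [of q p y x] fo_commute [of q p y x]) (simp only: add_ac)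
qed

end

subsection \<open>Uniqueness of the expansions\<close>

lemma keys_scale: "Poly_Mapping.keys (scale a v) \<subseteq> Poly_Mapping.keys v"
  by (auto simp: in_keys_iff)

lemma keys_linear_extension: "Poly_Mapping.keys (linear_extension b v) \<subseteq> (\<Union>x\<in>Poly_Mapping.keys v. Poly_Mapping.keys (b x))"
  unfolding linear_extension_def using keys_sum [of "\<lambda>x. scale (Poly_Mapping.lookup v x) (b x)"] keys_scale by fastforce

lemma keys_tensor: "Poly_Mapping.keys (v \<odot> w) \<subseteq> (\<Union>x\<in>Poly_Mapping.keys v. \<Union>y\<in>Poly_Mapping.keys w. {x @ tl y})"
  unfolding tensor_def
  by (rule order.trans [OF keys_linear_extension], intro UN_mono subset_refl order.trans [OF keys_linear_extension]) auto

text \<open>\<open>tl\<close> drops the common vertex, but all lists in w start at the same weight,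
  so a tail determines its list and the coefficient of a concatenation is a single product.\<close>

lemma lookup_single_tensor:
  assumes "\<forall>y\<in>Poly_Mapping.keys w. y \<noteq> [] \<and> hd y = \<rho>" and "y \<in> Poly_Mapping.keys w"
    and "length x' = length x"
  shows "Poly_Mapping.lookup (Poly_Mapping.single x a \<odot> w) (x' @ tl y) = (if x = x' then a * Poly_Mapping.lookup w y else 0)"
proof -
  have "z = y" if "z \<in> Poly_Mapping.keys w" "tl z = tl y" for z
    using assms(1,2) that by (metis list.collapse)
  then have eq: "x @ tl z = x' @ tl y \<longleftrightarrow> x = x' \<and> z = y" if "z \<in> Poly_Mapping.keys w" for z
    using assms(3) that by auto
  have "Poly_Mapping.lookup (Poly_Mapping.single x a \<odot> w) (x' @ tl y)
      = (\<Sum>z\<in>Poly_Mapping.keys w. a * Poly_Mapping.lookup w z * (if x @ tl z = x' @ tl y then 1 else 0))"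
    by (simp add: tensor_def linear_extension_def lookup_sum lookup_single when_def) (auto intro!: sum.cong)
  also have "\<dots> = (\<Sum>z\<in>Poly_Mapping.keys w. if z = y then (if x = x' then a * Poly_Mapping.lookup w y else 0) else 0)"
    by (intro sum.cong refl) (auto simp: eq)
  finally show ?thesis
    using assms(2) by simp
qed

text \<open>A path x that occurs in only one of the vectors isolates the coefficient of that
  vector.\<close>

lemma expansion_unique:
  assumes "finite M" "\<rho> \<in> M"
    and "Poly_Mapping.lookup (v \<rho>) x \<noteq> 0" "\<And>\<rho>'. \<rho>' \<in> M \<Longrightarrow> \<rho>' \<noteq> \<rho> \<Longrightarrow> Poly_Mapping.lookup (v \<rho>') x = 0"
    and "(\<Sum>\<rho>\<in>M. scale (a \<rho>) (v \<rho>)) = (\<Sum>\<rho>\<in>M. scale (b \<rho>) (v \<rho>))"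
  shows "a \<rho> = (b \<rho> :: complex)"
proof -
  have "Poly_Mapping.lookup (\<Sum>\<rho>\<in>M. scale (c \<rho>) (v \<rho>)) x = c \<rho> * Poly_Mapping.lookup (v \<rho>) x" for c :: "_ \<Rightarrow> complex"
  proof -
    have "Poly_Mapping.lookup (\<Sum>\<rho>\<in>M. scale (c \<rho>) (v \<rho>)) x = (\<Sum>\<rho>'\<in>M. if \<rho>' = \<rho> then c \<rho> * Poly_Mapping.lookup (v \<rho>) x else 0)"
      unfolding lookup_sum by (intro sum.cong refl) (auto simp: assms(4))
    then show ?thesis
      using assms(1,2) by simp
  qed
  from this [of a] this [of b] show ?thesis
    using assms(3,5) by simp
qed

lemma finite_P2 [simp]: "finite P\<^sub>2"
  by (simp add: P\<^sub>2_def)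

lemma orth_epsilon: "orth (\<epsilon> 1) (\<epsilon> 2)"
  unfolding orth_def P\<^sub>1_def by (simp add: vec_eq_iff forall_2)

lemma P2_cases:
  assumes "t \<in> P\<^sub>2"
  obtains "t = 0" | p q where "orth p q" "t = p + q"
proof -
  note o = orth_epsilon
  have "orth (- \<epsilon> 1) (- \<epsilon> 2)" "orth (\<epsilon> 1) (- \<epsilon> 2)" "orth (- \<epsilon> 1) (\<epsilon> 2)"
    using o orth_uminus_left orth_uminus_right by blast+
  then show ?thesis
    using assms o that unfolding P\<^sub>2_def by (auto simp: algebra_simps)
qed

lemma orth_in_P2: "orth p q \<Longrightarrow> p + q \<in> P\<^sub>2"
  unfolding orth_def P\<^sub>1_def P\<^sub>2_def by (auto simp: algebra_simps)

lemma zero_in_P2 [simp]: "0 \<in> P\<^sub>2"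
  by (simp add: P\<^sub>2_def)

lemma two_form_int:
  assumes "p \<in> P\<^sub>1" "q \<in> P\<^sub>1"
  obtains n :: int where "2 * form p q = of_int n"
proof -
  consider "q = p" | "q = - p" | "orth p q"
    using assms by (auto simp: orth_def)
  moreover have "form p p = 1 / 2"
    using orth_exists [OF assms(1)] orth_frame(2) by blast
  ultimately have "2 * form p q \<in> {1, - 1, 0}"
    by cases (auto simp: orth_frame(4) mult.commute)
  then show ?thesis
    using that [of 1] that [of "- 1"] that [of 0] by auto
qed

section \<open>Generic weights and the supports of f-vectors\<close>

context generic_face
begin

lemma generic_imp_generic_pair:
  assumes "l \<in> generic" "orth p q"
  shows "generic_pair (form l p) (form l q)"
proof -
  have g: "\<theta> (form l s + form l t + of_int k * h) \<noteq> 0" if "s \<in> P\<^sub>1" "t \<in> P\<^sub>1" "s + t \<noteq> 0" for s t and k :: int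
    using assms(1) that unfolding generic_def by fastforce
  have "p + q \<noteq> 0" "p + - q \<noteq> 0" "p + p \<noteq> 0" "q + q \<noteq> 0"
    using orth_frame(6-) [OF assms(2)] by (metis add_eq_0_iff minus_minus)+
  moreover have "p \<in> P\<^sub>1" "q \<in> P\<^sub>1" "- q \<in> P\<^sub>1"
    using assms(2) by (auto simp: orth_def)
  ultimately show ?thesis
    unfolding generic_pair_def using g [of p q] g [of p "- q"] g [of p p] g [of q q] by simp
qed

text \<open>Twice the form is integral on \<open>P\<^sub>1\<close>, so hat p shifts every argument
  by an integer multiple of h.\<close>

lemma generic_shift:
  assumes "l \<in> generic" "p \<in> P\<^sub>1"
  shows "l + hat p \<in> generic"
  unfolding generic_def
proof (intro CollectI ballI impI allI)
  fix s t and k :: int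
  assume st: "s \<in> P\<^sub>1" "t \<in> P\<^sub>1" "s + t \<noteq> 0"
  obtain m n :: int where "2 * form p s = of_int m" "2 * form p t = of_int n"
    using two_form_int [OF assms(2)] st by metis
  then have "form (l + hat p) (s + t) + of_int k * h = form l (s + t) + of_int (k + m + n) * h"
    by (simp add: hat_def algebra_simps flip: mult.assoc)
  moreover have "\<theta> (form l (s + t) + of_int (k + m + n) * h) \<noteq> 0"
    using assms(1) st unfolding generic_def by blast
  ultimately show "\<theta> (form (l + hat p) (s + t) + of_int k * h) \<noteq> 0"
    by metis
qed

lemma verts_not_Nil [simp]: "verts l ps \<noteq> []" and hd_verts [simp]: "hd (verts l ps) = l"
  by (cases ps; simp)+

lemma verts_inject [simp]: "verts l ps = verts l qs \<longleftrightarrow> ps = qs"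
proof (induction ps arbitrary: l qs)
  case Nil
  show ?case by (cases qs) (auto simp: eq_commute [of "[]"])
next
  case (Cons p ps)
  show ?case
  proof (cases qs)
    case (Cons q qs')
    have "p = q" if "verts (l + hat p) ps = verts (l + hat q) qs'"
      using arg_cong [OF that, of hd] by (simp only: hd_verts add_left_cancel hat_inject)
    then show ?thesis
      using Cons.IH [of "l + hat p" qs'] Cons by auto
  qed auto
qed

lemma lookup_st: "Poly_Mapping.lookup (st l ps a) (verts l qs) = (if ps = qs then a else 0)"
  by (simp add: st_def lookup_single when_def)

lemma lookup_st_tensor:
  assumes "\<forall>y\<in>Poly_Mapping.keys w. y \<noteq> [] \<and> hd y = \<rho>" and "y \<in> Poly_Mapping.keys w"
    and "length qs = length ps"
  shows "Poly_Mapping.lookup (st l ps a \<odot> w) (verts l qs @ tl y) = (if ps = qs then a * Poly_Mapping.lookup w y else 0)"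
  unfolding st_def using lookup_single_tensor [OF assms(1,2), of "verts l qs" "verts l ps" a] assms(3) by simp

text \<open>The two ingredients of uniqueness. Genericity gives a path whose coefficient stays
  nonzero after concatenation, and all paths have the end weight at index 2, so vectors with
  different middle weights have disjoint supports.\<close>

lemma f_structure:
  assumes "l \<in> generic" "t \<in> P\<^sub>2"
  shows "\<exists>ps. Poly_Mapping.lookup (f l (l + hat t)) (verts l ps) \<noteq> 0 \<and>
      (\<forall>w y. (\<forall>y\<in>Poly_Mapping.keys w. y \<noteq> [] \<and> hd y = l + hat t) \<longrightarrow> y \<in> Poly_Mapping.keys w
        \<longrightarrow> Poly_Mapping.lookup (f l (l + hat t) \<odot> w) (verts l ps @ tl y) \<noteq> 0)" (is "\<exists>ps. ?P ps")
    and "\<forall>x\<in>Poly_Mapping.keys (f l (l + hat t)). length x = 3 \<and> hd x = l \<and> x ! 2 = l + hat t" (is ?Q)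
proof -
  from assms(2) have "(\<exists>ps. ?P ps) \<and> ?Q"
proof (cases rule: P2_cases)
  case 1
  define p q where "p = \<epsilon> 1" and "q = \<epsilon> 2"
  have orth: "orth p q" by (simp add: p_def q_def orth_epsilon)
  define x y where "x = form l p" and "y = form l q"
  have gen: "generic_pair x y"
    using generic_imp_generic_pair [OF assms(1) orth] by (simp add: x_def y_def)
  have f: "f l (l + hat t) = st l [p, - p] (\<theta> (2 * x + 2 * h)) + st l [- p, p] (\<theta> (2 * (- x) + 2 * h))
      + st l [q, - q] (\<theta> (2 * y + 2 * h)) + st l [- q, q] (\<theta> (2 * (- y) + 2 * h))"
    using f_zero [OF orth, of l] by (simp add: 1 x_def y_def fz_def)
  note ne = orth_frame(6-) [OF orth] generic_pairD(13) [OF gen]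
  have "?P [p, - p]"
  proof (intro conjI allI impI)
    show "Poly_Mapping.lookup (f l (l + hat t)) (verts l [p, - p]) \<noteq> 0"
      unfolding f using ne by (simp add: lookup_add lookup_st del: verts.simps)
    fix w :: pathvec and z assume w: "\<forall>y\<in>Poly_Mapping.keys w. y \<noteq> [] \<and> hd y = l + hat t" "z \<in> Poly_Mapping.keys w"
    show "Poly_Mapping.lookup (f l (l + hat t) \<odot> w) (verts l [p, - p] @ tl z) \<noteq> 0"
      unfolding f using ne w(2) by (simp add: lookup_add lookup_st_tensor [OF w] in_keys_iff del: verts.simps)
  qed
  moreover have ?Q
  proof
    fix z assume "z \<in> Poly_Mapping.keys (f l (l + hat t))"
    then have "z \<in> {verts l [p, - p], verts l [- p, p], verts l [q, - q], verts l [- q, q]}"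
      unfolding f in_keys_iff by (auto simp: lookup_add st_def lookup_single when_def simp del: verts.simps split: if_splits)
    then show "length z = 3 \<and> hd z = l \<and> z ! 2 = l + hat t"
      by (auto simp: 1)
  qed
  ultimately show ?thesis by blast
next
  case (2 p q)
  note orth = 2(1)
  define x y where "x = form l p" and "y = form l q"
  have gen: "generic_pair x y"
    using generic_imp_generic_pair [OF assms(1) orth] by (simp add: x_def y_def)
  have f: "f l (l + hat t) = st l [p, q] (\<theta> (x - y + h)) + st l [q, p] (\<theta> (y - x + h))"
    using f_sum [OF orth, of l] by (simp add: 2(2) x_def y_def fo_def hat_add add.assoc)
  note ne = orth_frame(6-) [OF orth] generic_pairD(7) [OF gen]
  have "?P [p, q]"
  proof (intro conjI allI impI)
    show "Poly_Mapping.lookup (f l (l + hat t)) (verts l [p, q]) \<noteq> 0"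
      unfolding f using ne by (simp add: lookup_add lookup_st del: verts.simps)
    fix w :: pathvec and z assume w: "\<forall>y\<in>Poly_Mapping.keys w. y \<noteq> [] \<and> hd y = l + hat t" "z \<in> Poly_Mapping.keys w"
    show "Poly_Mapping.lookup (f l (l + hat t) \<odot> w) (verts l [p, q] @ tl z) \<noteq> 0"
      unfolding f using ne w(2) by (simp add: lookup_add lookup_st_tensor [OF w] in_keys_iff del: verts.simps)
  qed
  moreover have ?Q
  proof
    fix z assume "z \<in> Poly_Mapping.keys (f l (l + hat t))"
    then have "z \<in> {verts l [p, q], verts l [q, p]}"
      unfolding f in_keys_iff by (auto simp: lookup_add st_def lookup_single when_def simp del: verts.simps split: if_splits)
    then show "length z = 3 \<and> hd z = l \<and> z ! 2 = l + hat t"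
      by (auto simp: 2(2) hat_add add_ac)
  qed
  ultimately show ?thesis by blast
qed
  then show "\<exists>ps. ?P ps" ?Q by blast+
qed

text \<open>Evaluates the description operators of \<open>W12\<close> and \<open>W22\<close> at
  once; w \<rho> stands for \<open>e \<rho> \<nu>\<close> or \<open>f \<rho> \<nu>\<close>.\<close>

lemma coefficients_unique:
  assumes l: "l \<in> generic" and A: "A \<subseteq> {\<rho>. \<rho> - l \<in> hat ` P\<^sub>2}"
    and w: "\<And>\<rho>. \<rho> \<in> A \<Longrightarrow> Poly_Mapping.keys (w \<rho>) \<noteq> {}"
    and w_hd: "\<And>\<rho> y. \<rho> \<in> A \<Longrightarrow> y \<in> Poly_Mapping.keys (w \<rho>) \<Longrightarrow> y \<noteq> [] \<and> hd y = \<rho>"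
    and a: "\<forall>\<rho>. \<rho> \<notin> A \<longrightarrow> a \<rho> = 0" and V: "V = (\<Sum>\<rho>\<in>A. scale (a \<rho>) (f l \<rho> \<odot> w \<rho>))"
  shows "(THE a. (\<forall>\<rho>. \<rho> \<notin> A \<longrightarrow> a \<rho> = 0) \<and> V = (\<Sum>\<rho>\<in>A. scale (a \<rho>) (f l \<rho> \<odot> w \<rho>))) = a"
proof (rule the_equality)
  show "(\<forall>\<rho>. \<rho> \<notin> A \<longrightarrow> a \<rho> = 0) \<and> V = (\<Sum>\<rho>\<in>A. scale (a \<rho>) (f l \<rho> \<odot> w \<rho>))"
    using a V by blast
  have shift: "\<exists>t\<in>P\<^sub>2. \<rho> = l + hat t" if mem: "\<rho> \<in> A" for \<rho>
  proof -
    obtain t where "t \<in> P\<^sub>2" "\<rho> - l = hat t"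
      using A mem by blast
    then show ?thesis
      by (metis add.commute diff_add_cancel)
  qed
  have "A \<subseteq> (\<lambda>t. l + hat t) ` P\<^sub>2"
    using shift by blast
  then have "finite A"
    by (rule finite_subset) simp
  fix b assume b: "(\<forall>\<rho>. \<rho> \<notin> A \<longrightarrow> b \<rho> = 0) \<and> V = (\<Sum>\<rho>\<in>A. scale (b \<rho>) (f l \<rho> \<odot> w \<rho>))"
  show "b = a"
  proof
    fix \<rho>
    show "b \<rho> = a \<rho>"
    proof (cases "\<rho> \<in> A")
      case True
      obtain t where t: "t \<in> P\<^sub>2" "\<rho> = l + hat t"
        using shift [OF True] by blast
      obtain y where y: "y \<in> Poly_Mapping.keys (w \<rho>)"
        using w [OF True] by blast
      obtain ps where "Poly_Mapping.lookup (f l \<rho> \<odot> w \<rho>) (verts l ps @ tl y) \<noteq> 0"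
        using f_structure(1) [OF l t(1)] w_hd [OF True] y unfolding t(2) by blast
      moreover have third: "z ! 2 = \<rho>'" if \<rho>': "\<rho>' \<in> A" "z \<in> Poly_Mapping.keys (f l \<rho>' \<odot> w \<rho>')" for \<rho>' z
      proof -
        obtain t' where t': "t' \<in> P\<^sub>2" "\<rho>' = l + hat t'"
          using shift [OF \<rho>'(1)] by blast
        obtain x' y' where "z = x' @ tl y'" "x' \<in> Poly_Mapping.keys (f l \<rho>')"
          using keys_tensor \<rho>'(2) by blast
        then show ?thesis
          using f_structure(2) [OF l t'(1)] t'(2) by (simp add: nth_append)
      qed
      moreover have "Poly_Mapping.lookup (f l \<rho>' \<odot> w \<rho>') (verts l ps @ tl y) = 0" if "\<rho>' \<in> A" "\<rho>' \<noteq> \<rho>" for \<rho>'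
        using third [OF that(1)] third [OF True] that(2) calculation(1) unfolding in_keys_iff by blast
      moreover have "(\<Sum>\<rho>\<in>A. scale (b \<rho>) (f l \<rho> \<odot> w \<rho>)) = (\<Sum>\<rho>\<in>A. scale (a \<rho>) (f l \<rho> \<odot> w \<rho>))"
        using b V by simp
      ultimately show ?thesis
        using expansion_unique [OF \<open>finite A\<close> True, of "\<lambda>\<rho>. f l \<rho> \<odot> w \<rho>" "verts l ps @ tl y" b a] by blast
    qed (use a b in simp)
  qed
qed

subsection \<open>Commuting difference operators\<close>

definition SS where "SS x y = TT x y + TT x (- y) + TT (- x) y + TT (- x) (- y)"

lemma AA_uminus: "AA x (- y) = AA x y"
  by (simp add: AA_def mult_ac)

lemma BB_commute: "BB x y = BB y x"
  by (simp add: BB_def add_ac)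

lemma SS_uminus: "SS (- x) y = SS x y"
  by (simp add: SS_def)

lemma SS_commute: "SS x y = SS y x"
proof -
  have "TT b a = TT a b" for a b
    by (simp add: TT_def add.commute mult_ac)
  then show ?thesis
    by (simp add: SS_def)
qed

lemma SS_K0: "generic_pair x y \<Longrightarrow> SS x y = K0 - (RR x y + RR x (- y))"
  using sum_TT [of x y] unfolding SS_def by (metis (no_types, lifting) add.assoc add_diff_cancel_right')

text \<open>\<open>commutator_single_step\<close> with the constant term of \<open>Mt2\<close>
  restored; the multiples of \<open>K0\<close> on the two sides are equal and cancel.\<close>

lemma commutator_middle:
  assumes "generic_pair x y"
  shows "AA x y * SS (x + h) y + AA y x * BB x (- (y + h)) + AA (- y) x * BB x (y - h)
    = SS x y * AA x y + BB x (- y) * AA (y - h) (x + h) + BB x y * AA (- (y + h)) (x + h)"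
proof -
  have SS: "SS x y = K0 - (RR x y + RR x (- y))" "SS (x + h) y = K0 - (RR (x + h) y + RR (x + h) (- y))"
    using SS_K0 assms generic_pair_shift [OF assms, of 1 0] by simp_all
  have "(AA x y * SS (x + h) y + AA y x * BB x (- (y + h)) + AA (- y) x * BB x (y - h))
      - (SS x y * AA x y + BB x (- y) * AA (y - h) (x + h) + BB x y * AA (- (y + h)) (x + h))
    = (AA (- y) x * BB x (y - h) + AA y x * BB x (- (y + h)) + RR x y * AA x y + RR x (- y) * AA x y)
      - (BB x y * AA (- (y + h)) (x + h) + BB x (- y) * AA (y - h) (x + h) + AA x y * RR (x + h) y + AA x y * RR (x + h) (- y))"
    unfolding SS by algebra
  also have "\<dots> = 0"
    unfolding commutator_single_step [OF assms] by (rule diff_self)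
  finally show ?thesis
    by (simp only: right_minus_eq)
qed

text \<open>Twelve shifts occur in the commutator: eight of the form 2s + t with orthogonal s, t,
  and four single steps. The Weyl group permutes each kind transitively, so
  \<open>AA_BB_exchange\<close> and \<open>commutator_middle\<close> in all frames cover
  them.\<close>

lemma commutator_coefficients:
  assumes gen: "generic_pair x y"
  shows "AA (- x) y * BB (- (x - h)) (- y)
      = BB (- x) (- y) * AA (- (x - h)) (y - h)"
    "AA (- x) y * BB (- (x - h)) y
      = BB (- x) y * AA (- (x - h)) (y + h)"
    "AA (- y) x * BB (- x) (- (y - h))
      = BB (- x) (- y) * AA (- (y - h)) (x - h)"
    "AA (- x) y * SS (x - h) y + AA y x * BB (- x) (- (y + h)) + AA (- y) x * BB (- x) (y - h)
      = SS x y * AA (- x) y + BB (- x) (- y) * AA (y - h) (x - h) + BB (- x) y * AA (- (y + h)) (x - h)"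
    "AA y x * BB (- x) (y + h)
      = BB (- x) y * AA (y + h) (x - h)"
    "AA x y * BB (- (x + h)) (- y) + AA (- x) y * BB (x - h) (- y) + AA (- y) x * SS x (y - h)
      = BB (- x) (- y) * AA (x - h) (y - h) + BB x (- y) * AA (- (x + h)) (y - h) + SS x y * AA (- y) x"
    "AA x y * BB (- (x + h)) y + AA (- x) y * BB (x - h) y + AA y x * SS x (y + h)
      = BB (- x) y * AA (x - h) (y + h) + BB x y * AA (- (x + h)) (y + h) + SS x y * AA y x"
    "AA (- y) x * BB x (- (y - h))
      = BB x (- y) * AA (- (y - h)) (x + h)"
    "AA x y * SS (x + h) y + AA y x * BB x (- (y + h)) + AA (- y) x * BB x (y - h)
      = SS x y * AA x y + BB x (- y) * AA (y - h) (x + h) + BB x y * AA (- (y + h)) (x + h)"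
    "AA y x * BB x (y + h)
      = BB x y * AA (y + h) (x + h)"
    "AA x y * BB (x + h) (- y)
      = BB x (- y) * AA (x + h) (y - h)"
    "AA x y * BB (x + h) y
      = BB x y * AA (x + h) (y + h)"
proof -
  have g: "generic_pair x (- y)" "generic_pair (- x) y" "generic_pair (- x) (- y)" "generic_pair y x"
      "generic_pair y (- x)" "generic_pair (- y) x" "generic_pair (- y) (- x)"
    using gen generic_pair_swap [of x y] by simp_all
  have neg_shift: "- a + h = - (a - h)" for a
    by simp
  note rules = neg_shift minus_minus AA_uminus SS_uminus
    BB_commute [of y] BB_commute [of "- y"] BB_commute [of "y + h"] BB_commute [of "- (y - h)"]
    SS_commute [of y] SS_commute [of "y + h"] SS_commute [of "y - h"]
  from AA_BB_exchange [OF g(3)] show "AA (- x) y * BB (- (x - h)) (- y)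
      = BB (- x) (- y) * AA (- (x - h)) (y - h)"
    unfolding rules .
  from AA_BB_exchange [OF g(2)] show "AA (- x) y * BB (- (x - h)) y
      = BB (- x) y * AA (- (x - h)) (y + h)"
    unfolding rules .
  from AA_BB_exchange [OF g(7)] show "AA (- y) x * BB (- x) (- (y - h))
      = BB (- x) (- y) * AA (- (y - h)) (x - h)"
    unfolding rules .
  from commutator_middle [OF g(2)] show "AA (- x) y * SS (x - h) y + AA y x * BB (- x) (- (y + h)) + AA (- y) x * BB (- x) (y - h)
      = SS x y * AA (- x) y + BB (- x) (- y) * AA (y - h) (x - h) + BB (- x) y * AA (- (y + h)) (x - h)"
    unfolding rules by (simp only: add_ac)
  from AA_BB_exchange [OF g(5)] show "AA y x * BB (- x) (y + h)
      = BB (- x) y * AA (y + h) (x - h)"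
    unfolding rules .
  from commutator_middle [OF g(6)] show "AA x y * BB (- (x + h)) (- y) + AA (- x) y * BB (x - h) (- y) + AA (- y) x * SS x (y - h)
      = BB (- x) (- y) * AA (x - h) (y - h) + BB x (- y) * AA (- (x + h)) (y - h) + SS x y * AA (- y) x"
    unfolding rules by (simp only: add_ac)
  from commutator_middle [OF g(4)] show "AA x y * BB (- (x + h)) y + AA (- x) y * BB (x - h) y + AA y x * SS x (y + h)
      = BB (- x) y * AA (x - h) (y + h) + BB x y * AA (- (x + h)) (y + h) + SS x y * AA y x"
    unfolding rules by (simp only: add_ac)
  from AA_BB_exchange [OF g(6)] show "AA (- y) x * BB x (- (y - h))
      = BB x (- y) * AA (- (y - h)) (x + h)"
    unfolding rules .
  from commutator_middle [OF gen] show "AA x y * SS (x + h) y + AA y x * BB x (- (y + h)) + AA (- y) x * BB x (y - h)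
      = SS x y * AA x y + BB x (- y) * AA (y - h) (x + h) + BB x y * AA (- (y + h)) (x + h)"
    unfolding rules by (simp only: add_ac)
  from AA_BB_exchange [OF g(4)] show "AA y x * BB x (y + h)
      = BB x y * AA (y + h) (x + h)"
    unfolding rules .
  from AA_BB_exchange [OF g(1)] show "AA x y * BB (x + h) (- y)
      = BB x (- y) * AA (x + h) (y - h)"
    unfolding rules .
  from AA_BB_exchange [OF gen] show "AA x y * BB (x + h) y
      = BB x y * AA (x + h) (y + h)"
    unfolding rules .
qed

lemma Mt1_frame:
  assumes "orth a b" "form m a = x" "form m b = y"
  shows "Mt1 \<phi> m = AA x y * \<phi> (m + hat a) + AA (- x) y * \<phi> (m - hat a)
    + AA y x * \<phi> (m + hat b) + AA (- y) x * \<phi> (m - hat b)"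
proof -
  have AA: "(\<Prod>r\<in>P\<^sub>1 - {p, - p}. \<theta> (form m (p + r) - h) / \<theta> (form m (p + r))) = AA (form m p) (form m q)"
    if "orth p q" for p q
    unfolding P1_minus(1) [OF that] prod_pair(2) [OF that] by (simp add: AA_def)
  note o = orth_sym [OF assms(1)]
  show ?thesis
    unfolding Mt1_def T_def sum_P1 [OF assms(1)] AA [OF assms(1)] AA [OF orth_uminus_left [OF assms(1)]]
      AA [OF o] AA [OF orth_uminus_left [OF o]]
    by (simp add: assms(2,3))
qed

lemma sum_epsilon: "(\<Sum>p\<in>{\<epsilon> i, - \<epsilon> i}. g p) = g (\<epsilon> i) + (g (- \<epsilon> i) :: complex)"
proof -
  have "\<epsilon> i \<noteq> - \<epsilon> i"
    by (simp add: vec_eq_iff)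
  then show ?thesis by simp
qed

lemma Mt2_frame:
  assumes "form m (\<epsilon> 1) = x" "form m (\<epsilon> 2) = y"
  shows "Mt2 \<phi> m = BB x y * \<phi> (m + hat (\<epsilon> 1) + hat (\<epsilon> 2)) + BB x (- y) * \<phi> (m + hat (\<epsilon> 1) - hat (\<epsilon> 2))
    + BB (- x) y * \<phi> (m - hat (\<epsilon> 1) + hat (\<epsilon> 2)) + BB (- x) (- y) * \<phi> (m - hat (\<epsilon> 1) - hat (\<epsilon> 2)) + SS x y * \<phi> m"
  unfolding Mt2_def T_def sum_epsilon
  by (simp add: assms BB_def SS_def TT_def algebra_simps)

lemma Mt_commute:
  assumes "l \<in> generic"
  shows "Mt1 (Mt2 \<phi>) l = Mt2 (Mt1 \<phi>) l"
proof -
  define a b where "a = \<epsilon> 1" and "b = \<epsilon> 2"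
  define x y where "x = form l a" and "y = form l b"
  have orth: "orth a b"
    by (simp add: a_def b_def orth_epsilon)
  have gen: "generic_pair x y"
    using generic_imp_generic_pair [OF assms orth] by (simp add: x_def y_def)
  \<comment> \<open>Integer coordinates for the shifted weights make the arguments of \<phi> reached
    along different routes syntactically equal.\<close>
  define pos :: "int \<Rightarrow> int \<Rightarrow> weight" where "pos i j = l + of_int i *s hat a + of_int j *s hat b" for i j
  have pos: "pos i j + hat a = pos (i + 1) j" "pos i j - hat a = pos (i - 1) j"
      "pos i j + hat b = pos i (j + 1)" "pos i j - hat b = pos i (j - 1)" for i j
    by (simp_all add: pos_def vec_eq_iff algebra_simps)
  have form_pos: "form (pos i j) a = x + of_int i * h" "form (pos i j) b = y + of_int j * h" for i j
    using form_hat [OF orth] by (simp_all add: pos_def x_def y_def)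
  note Mt1_pos = Mt1_frame [OF orth form_pos, unfolded pos]
  note Mt2_pos = Mt2_frame [of "pos _ _", folded a_def b_def, OF form_pos, unfolded pos]
  have arith: "(0::int) + 1 = 1" "(0::int) - 1 = - 1" "(1::int) + 1 = 2" "(1::int) - 1 = 0" "- (1::int) + 1 = 0" "- (1::int) - 1 = - 2"
      "z + of_int 0 * h = z" "z + of_int 1 * h = z + h" "z + of_int (- 1) * h = z - h" for z
    by simp_all
  have "Mt1 (Mt2 \<phi>) (pos 0 0) - Mt2 (Mt1 \<phi>) (pos 0 0)
    = \<phi> (pos (- 2) (- 1)) * ((AA (- x) y * BB (- (x - h)) (- y))
        - (BB (- x) (- y) * AA (- (x - h)) (y - h)))
      + \<phi> (pos (- 2) 1) * ((AA (- x) y * BB (- (x - h)) y)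
        - (BB (- x) y * AA (- (x - h)) (y + h)))
      + \<phi> (pos (- 1) (- 2)) * ((AA (- y) x * BB (- x) (- (y - h)))
        - (BB (- x) (- y) * AA (- (y - h)) (x - h)))
      + \<phi> (pos (- 1) 0) * ((AA (- x) y * SS (x - h) y + AA y x * BB (- x) (- (y + h)) + AA (- y) x * BB (- x) (y - h))
        - (SS x y * AA (- x) y + BB (- x) (- y) * AA (y - h) (x - h) + BB (- x) y * AA (- (y + h)) (x - h)))
      + \<phi> (pos (- 1) 2) * ((AA y x * BB (- x) (y + h))
        - (BB (- x) y * AA (y + h) (x - h)))
      + \<phi> (pos 0 (- 1)) * ((AA x y * BB (- (x + h)) (- y) + AA (- x) y * BB (x - h) (- y) + AA (- y) x * SS x (y - h))
        - (BB (- x) (- y) * AA (x - h) (y - h) + BB x (- y) * AA (- (x + h)) (y - h) + SS x y * AA (- y) x))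
      + \<phi> (pos 0 1) * ((AA x y * BB (- (x + h)) y + AA (- x) y * BB (x - h) y + AA y x * SS x (y + h))
        - (BB (- x) y * AA (x - h) (y + h) + BB x y * AA (- (x + h)) (y + h) + SS x y * AA y x))
      + \<phi> (pos 1 (- 2)) * ((AA (- y) x * BB x (- (y - h)))
        - (BB x (- y) * AA (- (y - h)) (x + h)))
      + \<phi> (pos 1 0) * ((AA x y * SS (x + h) y + AA y x * BB x (- (y + h)) + AA (- y) x * BB x (y - h))
        - (SS x y * AA x y + BB x (- y) * AA (y - h) (x + h) + BB x y * AA (- (y + h)) (x + h)))
      + \<phi> (pos 1 2) * ((AA y x * BB x (y + h))
        - (BB x y * AA (y + h) (x + h)))
      + \<phi> (pos 2 (- 1)) * ((AA x y * BB (x + h) (- y))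
        - (BB x (- y) * AA (x + h) (y - h)))
      + \<phi> (pos 2 1) * ((AA x y * BB (x + h) y)
        - (BB x y * AA (x + h) (y + h)))"
    unfolding Mt1_pos Mt2_pos arith by algebra
  also have "\<dots> = 0"
    by (simp only: commutator_coefficients [OF gen] diff_self mult_zero_right add_0_right)
  finally show ?thesis
    by (simp add: pos_def)
qed

text \<open>The formulas for \<open>M1\<close> and \<open>M2\<close> hold at generic weights only.
  \<open>Mt1\<close> and \<open>Mt2\<close> evaluate a function at generic shifts of l, so such a
  formula can still be inserted under them.\<close>

lemma Mt_linear:
  assumes "l \<in> generic" "\<And>m. m \<in> generic \<Longrightarrow> \<psi> m = \<alpha> * \<eta> m + \<beta> * \<xi> m"
  shows "Mt1 \<psi> l = \<alpha> * Mt1 \<eta> l + \<beta> * Mt1 \<xi> l" "Mt2 \<psi> l = \<alpha> * Mt2 \<eta> l + \<beta> * Mt2 \<xi> l"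
proof -
  have e: "\<epsilon> 1 \<in> P\<^sub>1" "\<epsilon> 2 \<in> P\<^sub>1" "- \<epsilon> 1 \<in> P\<^sub>1" "- \<epsilon> 2 \<in> P\<^sub>1"
    by (simp_all add: P\<^sub>1_def)
  have gen: "l + hat (\<epsilon> 1) \<in> generic" "l - hat (\<epsilon> 1) \<in> generic" "l + hat (\<epsilon> 2) \<in> generic" "l - hat (\<epsilon> 2) \<in> generic"
    "l + hat (\<epsilon> 1) + hat (\<epsilon> 2) \<in> generic" "l + hat (\<epsilon> 1) - hat (\<epsilon> 2) \<in> generic"
    "l - hat (\<epsilon> 1) + hat (\<epsilon> 2) \<in> generic" "l - hat (\<epsilon> 1) - hat (\<epsilon> 2) \<in> generic"
    using generic_shift [OF assms(1)] generic_shift [OF generic_shift [OF assms(1)]] e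
    by (metis add_uminus_conv_diff hat_uminus)+
  note eqs = gen [THEN assms(2)] assms(2) [OF assms(1)]
  show "Mt1 \<psi> l = \<alpha> * Mt1 \<eta> l + \<beta> * Mt1 \<xi> l"
    unfolding Mt1_frame [OF orth_epsilon refl refl] eqs by algebra
  show "Mt2 \<psi> l = \<alpha> * Mt2 \<eta> l + \<beta> * Mt2 \<xi> l"
    unfolding Mt2_frame [OF refl refl] eqs by algebra
qed

section \<open>Diagonal fused weights\<close>

lemma keys_f_hd:
  assumes "l \<in> generic" "t \<in> P\<^sub>2" "x \<in> Poly_Mapping.keys (f l (l + hat t))"
  shows "x \<noteq> [] \<and> hd x = l"
  using f_structure(2) [OF assms(1,2)] assms(3) by force

lemma keys_f_nonempty:
  assumes "l \<in> generic" "t \<in> P\<^sub>2"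
  shows "Poly_Mapping.keys (f l (l + hat t)) \<noteq> {}"
  using f_structure(1) [OF assms] by (auto simp: in_keys_iff)

lemma orth_distinct:
  assumes "orth p q"
  shows "distinct [0, p + q, p + - q, - p + q, - p + - q]"
proof -
  have "distinct (map (\<lambda>t. (form p t, form q t)) [0, p + q, p + - q, - p + q, - p + - q])"
    by (simp add: orth_frame(2-5) [OF assms])
  then show ?thesis
    by (simp only: distinct_map)
qed

lemma orth_distinct_shift:
  assumes "orth p q"
  shows "distinct [l, l + hat p + hat q, l + hat p + hat (- q), l + hat (- p) + hat q, l + hat (- p) + hat (- q)]"
proof -
  have "distinct (map (\<lambda>t. l + hat t) [0, p + q, p + - q, - p + q, - p + - q])"
    unfolding distinct_map using orth_distinct [OF assms]
    by (intro conjI inj_onI) (simp_all only: add_left_cancel hat_inject)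
  then show ?thesis
    by (simp only: list.map hat_add hat_0 add_0_right add.assoc)
qed

lemma W12_diagonal:
  assumes l: "l \<in> generic" and orth: "orth p q"
  shows "W12 l (l + hat p) l (l + hat p) u = WC0 (form l p) (form l q) u"
proof -
  define x y where "x = form l p" and "y = form l q"
  define \<nu> where "\<nu> = l + hat p"
  have gen: "generic_pair x y"
    using generic_imp_generic_pair [OF l orth] by (simp add: x_def y_def)
  have x: "form l p = x" and y: "form l q = y"
    by (simp_all add: x_def y_def)
  \<comment> \<open>All lower rows for this upper row, with value 0 off the three middle weights:
    the complete function that the description operator selects.\<close>
  define a where "a = (\<lambda>\<rho>. if \<rho> = l then WC0 x y u else if \<rho> = l + hat p + hat q then WCp x y u
    else if \<rho> = l + hat p + hat (- q) then WCp x (- y) u else 0)"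
  have q: "orth p (- q)" "q \<in> P\<^sub>1" "- q \<in> P\<^sub>1" "p \<in> P\<^sub>1"
    using orth orth_uminus_right by (auto simp: orth_def)
  have mem: "l \<in> mid12 l \<nu>" "l + hat p + hat q \<in> mid12 l \<nu>" "l + hat p + hat (- q) \<in> mid12 l \<nu>"
    using q orth_in_P2 [OF orth] orth_in_P2 [OF q(1)] zero_in_P2
    by (auto simp: mid12_def \<nu>_def image_iff hat_add hat_diff intro: bexI [of _ "p + q"] bexI [of _ "p - q"] bexI [of _ 0] bexI [of _ q] bexI [of _ "- q"] bexI [of _ p])
  have distinct: "l + hat p + hat q \<noteq> l" "l + hat p + hat (- q) \<noteq> l" "l + hat p + hat q \<noteq> l + hat p + hat (- q)"
    using orth_distinct_shift [OF orth, of l] by (auto simp del: hat_uminus)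
  have fin: "finite (mid12 l \<nu>)"
    by (rule finite_subset [of _ "(\<lambda>t. l + hat t) ` P\<^sub>2"]) (auto simp: mid12_def algebra_simps image_iff intro!: bexI)
  have "(\<Sum>\<rho>\<in>mid12 l \<nu>. scale (a \<rho>) (f l \<rho> \<odot> e \<rho> \<nu>)) = (\<Sum>\<rho>\<in>{l, l + hat p + hat q, l + hat p + hat (- q)}. scale (a \<rho>) (f l \<rho> \<odot> e \<rho> \<nu>))"
    by (rule sum.mono_neutral_right [OF fin]) (use mem in \<open>auto simp: a_def\<close>)
  also have "\<dots> = scale (WC0 x y u) (f l l \<odot> e l \<nu>) + scale (WCp x y u) (f l (l + hat p + hat q) \<odot> e (l + hat p + hat q) \<nu>)
      + scale (WCp x (- y) u) (f l (l + hat p + hat (- q)) \<odot> e (l + hat p + hat (- q)) \<nu>)"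
    using distinct by (simp add: a_def add.assoc del: hat_uminus)
  also have "f l l \<odot> e l \<nu> = fz p q x y l [] [p] 1"
    using f_zero [OF orth, of l] x y by (simp add: \<nu>_def e_st tensor_fz_left)
  also have "f l (l + hat p + hat q) \<odot> e (l + hat p + hat q) \<nu> = fo p q x y l [] [- q] 1"
    using f_sum [OF orth, of l] x y e_st [of "l + hat p + hat q" "- q"] by (simp add: \<nu>_def tensor_fo_left)
  also have "f l (l + hat p + hat (- q)) \<odot> e (l + hat p + hat (- q)) \<nu> = fo p (- q) x (- y) l [] [q] 1"
    using f_sum [OF q(1), of l] x y e_st [of "l + hat p + hat (- q)" q] by (simp add: \<nu>_def tensor_fo_left)
  also have "scale (WC0 x y u) (fz p q x y l [] [p] 1) + scale (WCp x y u) (fo p q x y l [] [- q] 1)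
      + scale (WCp x (- y) u) (fo p (- q) x (- y) l [] [q] 1) = Wop 2 (u + h) (Wop 1 u (fz p q (x + h) y l [p] [] 1))"
    unfolding row_C_start [OF orth x y gen] by (simp only: scale_fz scale_fo mult_1 mult_1_right)
  also have "fz p q (x + h) y l [p] [] 1 = e l \<nu> \<odot> f \<nu> \<nu>"
    using f_zero [OF orth, of \<nu>] x y form_hat [OF orth] by (simp add: \<nu>_def e_st tensor_fz_right)
  finally have V: "Wop 2 (u + h) (Wop 1 u (e l \<nu> \<odot> f \<nu> \<nu>)) = (\<Sum>\<rho>\<in>mid12 l \<nu>. scale (a \<rho>) (f l \<rho> \<odot> e \<rho> \<nu>))"
    by (rule sym)
  have "(THE a. (\<forall>\<rho>. \<rho> \<notin> mid12 l \<nu> \<longrightarrow> a \<rho> = 0) \<and> Wop 2 (u + h) (Wop 1 u (e l \<nu> \<odot> f \<nu> \<nu>))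
      = (\<Sum>\<rho>\<in>mid12 l \<nu>. scale (a \<rho>) (f l \<rho> \<odot> e \<rho> \<nu>))) = a"
  proof (rule coefficients_unique [OF l _ _ _ _ V])
    show "\<forall>\<rho>. \<rho> \<notin> mid12 l \<nu> \<longrightarrow> a \<rho> = 0"
      using mem by (auto simp: a_def)
  qed (auto simp: mid12_def e_def)
  then show ?thesis
    by (simp add: W12_def \<nu>_def a_def x_def y_def)
qed

lemma finite_mid22: "finite (mid22 l \<nu>)"
  by (rule finite_subset [of _ "(\<lambda>t. l + hat t) ` P\<^sub>2"]) (auto simp: mid22_def algebra_simps image_iff intro!: bexI)

lemma P2_uminus: "t \<in> P\<^sub>2 \<Longrightarrow> - t \<in> P\<^sub>2"
  by (auto simp: P\<^sub>2_def)

lemma generic_shift_P2: "l \<in> generic \<Longrightarrow> t \<in> P\<^sub>2 \<Longrightarrow> l + hat t \<in> generic"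
  by (erule P2_cases) (auto simp: hat_add orth_def simp flip: add.assoc intro!: generic_shift)

text \<open>An expansion over a part B of \<open>mid22\<close> suffices: its extension by 0 is
  admissible, and uniqueness identifies it with the weights.\<close>

lemma W22_eqI:
  assumes l: "l \<in> generic" and B: "B \<subseteq> mid22 l \<nu>"
    and V: "fused u (f l \<mu> \<odot> f \<mu> \<nu>) = (\<Sum>\<rho>\<in>B. scale (a \<rho>) (f l \<rho> \<odot> f \<rho> \<nu>))"
    and \<kappa>: "\<kappa> \<in> B"
  shows "W22 l \<mu> \<kappa> \<nu> u = a \<kappa>"
proof -
  define a' where "a' = (\<lambda>\<rho>. if \<rho> \<in> B then a \<rho> else 0)"
  have gen: "\<rho> \<in> generic" if "\<rho> \<in> mid22 l \<nu>" for \<rho>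
  proof -
    obtain t where "t \<in> P\<^sub>2" "\<rho> - l = hat t"
      using \<open>\<rho> \<in> mid22 l \<nu>\<close> unfolding mid22_def by blast
    then show ?thesis
      using generic_shift_P2 [OF l] by (metis add.commute diff_add_cancel)
  qed
  have target: "\<exists>t\<in>P\<^sub>2. \<nu> = \<rho> + hat t" if mem: "\<rho> \<in> mid22 l \<nu>" for \<rho>
  proof -
    obtain t where "t \<in> P\<^sub>2" "\<nu> - \<rho> = hat t"
      using mem unfolding mid22_def by blast
    then show ?thesis
      by (metis add.commute diff_add_cancel)
  qed
  have "(\<Sum>\<rho>\<in>mid22 l \<nu>. scale (a' \<rho>) (f l \<rho> \<odot> f \<rho> \<nu>)) = (\<Sum>\<rho>\<in>B. scale (a' \<rho>) (f l \<rho> \<odot> f \<rho> \<nu>))"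
    by (rule sum.mono_neutral_right [OF finite_mid22 B]) (simp add: a'_def)
  also have "\<dots> = fused u (f l \<mu> \<odot> f \<mu> \<nu>)"
    unfolding V by (simp add: a'_def)
  finally have V': "fused u (f l \<mu> \<odot> f \<mu> \<nu>) = (\<Sum>\<rho>\<in>mid22 l \<nu>. scale (a' \<rho>) (f l \<rho> \<odot> f \<rho> \<nu>))"
    by (rule sym)
  have "(THE a. (\<forall>\<rho>. \<rho> \<notin> mid22 l \<nu> \<longrightarrow> a \<rho> = 0) \<and> fused u (f l \<mu> \<odot> f \<mu> \<nu>)
      = (\<Sum>\<rho>\<in>mid22 l \<nu>. scale (a \<rho>) (f l \<rho> \<odot> f \<rho> \<nu>))) = a'"
  proof (rule coefficients_unique [OF l _ _ _ _ V'])
    show "Poly_Mapping.keys (f \<rho> \<nu>) \<noteq> {}" if "\<rho> \<in> mid22 l \<nu>" for \<rho>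
      using target [OF that] keys_f_nonempty [OF gen [OF that]] by blast
    show "z \<noteq> [] \<and> hd z = \<rho>" if "\<rho> \<in> mid22 l \<nu>" "z \<in> Poly_Mapping.keys (f \<rho> \<nu>)" for \<rho> z
      using target [OF that(1)] keys_f_hd [OF gen [OF that(1)]] that(2) by blast
  qed (use B in \<open>auto simp: mid22_def a'_def\<close>)
  then show ?thesis
    using \<kappa> unfolding W22_def fused_def by (simp add: a'_def)
qed

lemma W22_sum_step:
  assumes l: "l \<in> generic" and orth: "orth p q"
  shows "W22 l (l + hat p + hat q) l (l + hat p + hat q) u = V0 (form l p) (form l q) u"
proof -
  define \<nu> where "\<nu> = l + hat p + hat q"
  define a where "a = (\<lambda>\<rho>. if \<rho> = l then V0 (form l p) (form l q) u else V1 (form l p) (form l q) u)"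
  have ne: "\<nu> \<noteq> l" "l \<noteq> \<nu>"
    using orth_distinct_shift [OF orth, of l] by (auto simp: \<nu>_def simp del: hat_uminus)
  have "\<nu> - l = hat (p + q)" "l - l = hat 0" "\<nu> - \<nu> = hat 0"
    by (simp_all add: \<nu>_def hat_add)
  then have B: "{l, \<nu>} \<subseteq> mid22 l \<nu>"
    using imageI [OF orth_in_P2 [OF orth], of hat] imageI [OF zero_in_P2, of hat] by (simp add: mid22_def)
  have V: "fused u (f l \<nu> \<odot> f \<nu> \<nu>) = (\<Sum>\<rho>\<in>{l, \<nu>}. scale (a \<rho>) (f l \<rho> \<odot> f \<rho> \<nu>))"
    using fused_sum_step [OF orth refl refl generic_imp_generic_pair [OF l orth], of u] ne
    by (simp add: a_def \<nu>_def [symmetric])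
  have "W22 l \<nu> l \<nu> u = a l"
    by (rule W22_eqI [OF l B V]) simp
  then show ?thesis
    by (simp only: a_def \<nu>_def if_True refl)
qed

lemma W22_fixed:
  assumes l: "l \<in> generic" and orth: "orth p q"
  shows "W22 l l l l u = V22 (form l p) (form l q) u"
proof -
  define x y where "x = form l p" and "y = form l q"
  define n1 n2 n3 n4 where "n1 = l + hat p + hat q" and "n2 = l + hat p + hat (- q)"
    and "n3 = l + hat (- p) + hat q" and "n4 = l + hat (- p) + hat (- q)"
  define a where "a = (\<lambda>\<rho>. if \<rho> = l then V22 x y u else if \<rho> = n1 then cE x y u
    else if \<rho> = n2 then cE x (- y) u else if \<rho> = n3 then cE (- x) y u else cE (- x) (- y) u)"
  have distinct: "distinct [l, n1, n2, n3, n4]"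
    using orth_distinct_shift [OF orth, of l] unfolding n1_def n2_def n3_def n4_def .
  have shift: "l + hat s + hat t \<in> mid22 l l" if "orth s t" for s t
  proof -
    have "s + t \<in> P\<^sub>2" "- (s + t) \<in> P\<^sub>2"
      using orth_in_P2 [OF that] P2_uminus by blast+
    moreover have "l + hat s + hat t - l = hat (s + t)" "l - (l + hat s + hat t) = hat (- (s + t))"
      by (simp_all add: hat_add hat_diff)
    ultimately show ?thesis
      unfolding mid22_def by blast
  qed
  have "l \<in> mid22 l l"
    using zero_in_P2 hat_0 by (auto simp: mid22_def image_iff intro!: bexI [of _ 0])
  moreover have "orth p (- q)" "orth (- p) q" "orth (- p) (- q)"
    using orth orth_uminus_left orth_uminus_right by blast+
  ultimately have B: "set [l, n1, n2, n3, n4] \<subseteq> mid22 l l"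
    using shift [OF orth] shift by (simp add: n1_def n2_def n3_def n4_def del: hat_uminus)
  have "(\<Sum>\<rho>\<in>set [l, n1, n2, n3, n4]. scale (a \<rho>) (f l \<rho> \<odot> f \<rho> l))
      = scale (V22 x y u) (f l l \<odot> f l l) + scale (cE x y u) (f l n1 \<odot> f n1 l) + scale (cE x (- y) u) (f l n2 \<odot> f n2 l)
        + scale (cE (- x) y u) (f l n3 \<odot> f n3 l) + scale (cE (- x) (- y) u) (f l n4 \<odot> f n4 l)"
  proof -
    have "a l = V22 x y u" "a n1 = cE x y u" "a n2 = cE x (- y) u" "a n3 = cE (- x) y u" "a n4 = cE (- x) (- y) u"
      using distinct by (auto simp: a_def)
    then show ?thesis
      unfolding sum.distinct_set_conv_list [OF distinct] by (simp add: add.assoc)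
  qed
  also have "\<dots> = fused u (f l l \<odot> f l l)"
    using fused_zero_step [OF orth refl refl generic_imp_generic_pair [OF l orth], of u]
    unfolding n1_def n2_def n3_def n4_def x_def y_def by (rule sym)
  finally have "W22 l l l l u = a l"
    by (intro W22_eqI [OF l B]) simp_all
  then show ?thesis
    by (simp only: a_def x_def y_def if_True refl)
qed

section \<open>\<open>M1\<close> and \<open>M2\<close> in terms of \<open>Mt1\<close> and
  \<open>Mt2\<close>\<close>

lemma WC0_AA: "WC0 x y u = F u * AA x y"
  by (simp add: WC0_def F_def gg_def AA_def c_def power2_eq_square mult_ac)

lemma V0_BB: "V0 x y u = VQ u * BB x y"
  by (simp add: V0_def VQ_def BB_def)

text \<open>The two \<open>RR\<close> become \<open>K0\<close> minus the constant term of
  \<open>Mt2\<close>, and the remainder \<open>VQ u * K0 - V3 u\<close> is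
  \<open>GH u\<close>.\<close>

lemma V22_SS: "generic_pair x y \<Longrightarrow> V22 x y u = VQ u * SS x y - GH u"
  unfolding V22_def SS_K0 right_diff_distrib VQ_K0 by algebra

lemma M1_eq:
  assumes l: "l \<in> generic"
  shows "M1 u \<phi> l = F u * Mt1 \<phi> l"
proof -
  note o = orth_epsilon orth_uminus_left [OF orth_epsilon] orth_sym [OF orth_epsilon] orth_uminus_left [OF orth_sym [OF orth_epsilon]]
  show ?thesis
    unfolding M1_def sum_P1 [OF orth_epsilon] o [THEN W12_diagonal [OF l]] Mt1_frame [OF orth_epsilon refl refl] T_def WC0_AA
    by (simp add: algebra_simps)
qed

lemma M2_eq:
  assumes l: "l \<in> generic"
  shows "M2 u \<phi> l = VQ u * Mt2 \<phi> l - GH u * \<phi> l"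
proof -
  define a b where "a = \<epsilon> 1" and "b = \<epsilon> 2"
  have orth: "orth a b"
    by (simp add: a_def b_def orth_epsilon)
  note o = orth orth_uminus_right [OF orth] orth_uminus_left [OF orth] orth_uminus_left [OF orth_uminus_right [OF orth]]
  have P2: "P\<^sub>2 = set [0, a + b, a + - b, - a + b, - a + - b]"
    by (auto simp: P\<^sub>2_def a_def b_def)
  have "M2 u \<phi> l = W22 l l l l u * \<phi> l + (\<Sum>(s, t)\<leftarrow>[(a, b), (a, - b), (- a, b), (- a, - b)].
      W22 l (l + hat s + hat t) l (l + hat s + hat t) u * \<phi> (l + hat s + hat t))"
    unfolding M2_def P2 sum.distinct_set_conv_list [OF orth_distinct [OF orth]]
    by (simp only: T_def hat_add hat_0 add_0_right add.assoc list.map sum_list.Cons sum_list.Nil prod.case)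
  also have "\<dots> = V22 (form l a) (form l b) u * \<phi> l
      + V0 (form l a) (form l b) u * \<phi> (l + hat a + hat b) + V0 (form l a) (- form l b) u * \<phi> (l + hat a - hat b)
      + V0 (- form l a) (form l b) u * \<phi> (l - hat a + hat b) + V0 (- form l a) (- form l b) u * \<phi> (l - hat a - hat b)"
    using o [THEN W22_sum_step [OF l]] by (simp add: W22_fixed [OF l orth])
  also have "\<dots> = VQ u * Mt2 \<phi> l - GH u * \<phi> l"
    unfolding V22_SS [OF generic_imp_generic_pair [OF l orth]] V0_BB
      Mt2_frame [OF refl refl, folded a_def b_def] by algebra
  finally show ?thesis .
qed

lemma G_eq_VQ: "G u = VQ u"
proof -
  have "u - h + 2 * h = u + h" "u - h + 4 * h = u + 3 * h"
    by simp_all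
  then show ?thesis
    by (simp add: G_def VQ_def gg_def c_def power2_eq_square power4_eq_xxxx mult_ac add.commute)
qed

lemma GH_eq:
  assumes "\<theta> u \<noteq> 0" "\<theta> (u + 3 * h) \<noteq> 0"
  shows "GH u = G u * H u"
  unfolding G_eq_VQ GH_def VQ_def H_def using assms by simp

text \<open>Operators with the same d are combinations of one operator and the identity, and the
  mixed case rests on \<open>Mt_commute\<close>. Since \<open>GH\<close> replaces the product with
  H, no value of u is excluded.\<close>

lemma M_commute:
  assumes l: "l \<in> generic" and "d \<in> {1, 2}" "d' \<in> {1, 2}"
  shows "M d u (M d' v \<phi>) l = M d' v (M d u \<phi>) l"
proof -
  \<comment> \<open>Scaling is the instance of \<open>Mt_linear\<close> whose second summand is
    zero.\<close>
  have one: "M1 u (M1 v \<phi>) l = F u * (F v * Mt1 (Mt1 \<phi>) l)" for u v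
    using Mt_linear(1) [OF l, of "M1 v \<phi>" "F v" "Mt1 \<phi>" 0 "\<lambda>_. 0"] by (simp add: M1_eq l)
  have M2: "M2 u \<phi> m = VQ u * Mt2 \<phi> m + (- GH u) * \<phi> m" if "m \<in> generic" for u \<phi> m
    using M2_eq [OF that] by simp
  have one_two: "M1 u (M2 v \<phi>) l = F u * (VQ v * Mt1 (Mt2 \<phi>) l + (- GH v) * Mt1 \<phi> l)" for u v
    unfolding M1_eq [OF l] using Mt_linear(1) [OF l M2] by simp
  have two_one: "M2 v (M1 u \<phi>) l = VQ v * (F u * Mt2 (Mt1 \<phi>) l) + (- GH v) * (F u * Mt1 \<phi> l)" for u v
    unfolding M2 [OF l] using Mt_linear(2) [OF l, of "M1 u \<phi>" "F u" "Mt1 \<phi>" 0 "\<lambda>_. 0"] by (simp add: M1_eq l)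
  have mixed: "M1 u (M2 v \<phi>) l = M2 v (M1 u \<phi>) l" for u v
    unfolding one_two two_one Mt_commute [OF l] by algebra
  have two: "M2 u (M2 v \<phi>) l = VQ u * (VQ v * Mt2 (Mt2 \<phi>) l + (- GH v) * Mt2 \<phi> l)
      + (- GH u) * (VQ v * Mt2 \<phi> l + (- GH v) * \<phi> l)" for u v
    unfolding M2 [OF l] using Mt_linear(2) [OF l M2] by simp
  have "M2 u (M2 v \<phi>) l = M2 v (M2 u \<phi>) l" for u v
    unfolding two by algebra
  moreover have "M1 u (M1 v \<phi>) l = M1 v (M1 u \<phi>) l" for u v
    unfolding one by algebra
  ultimately show ?thesis
    using assms(2,3) mixed by (auto simp: M_def)
qed

end

theorem theorem1:
  fixes \<tau> h :: complex
  assumes "Im \<tau> > 0"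
    and "h \<noteq> 0"
    and "\<And>m::int. m \<noteq> 0 \<Longrightarrow> theta \<tau> (of_int m * h) \<noteq> 0"
  shows
    "(\<forall>d\<in>{1,2}. \<forall>d'\<in>{1,2}. \<forall>u v \<phi>. \<forall>l\<in>C2_face.generic \<tau> h.
        C2_face.M \<tau> h d u (C2_face.M \<tau> h d' v \<phi>) l =
        C2_face.M \<tau> h d' v (C2_face.M \<tau> h d u \<phi>) l)
     \<and> (\<forall>u \<phi>. \<forall>l\<in>C2_face.generic \<tau> h.
        C2_face.M \<tau> h 1 u \<phi> l = C2_face.F \<tau> h u * C2_face.Mt1 \<tau> h \<phi> l)
     \<and> (\<forall>u \<phi>. theta \<tau> u \<noteq> 0 \<and> theta \<tau> (u + 3 * h) \<noteq> 0 \<longrightarrow>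
        (\<forall>l\<in>C2_face.generic \<tau> h.
          C2_face.M \<tau> h 2 u \<phi> l =
          C2_face.G \<tau> h u * (C2_face.Mt2 \<tau> h \<phi> l - C2_face.H \<tau> h u * \<phi> l)))"
proof -
  interpret generic_face \<tau> h
    using assms by unfold_locales
  show ?thesis
    using M_commute M1_eq M2_eq GH_eq G_eq_VQ
    by (auto simp: M_def right_diff_distrib simp flip: mult.assoc)
qed

end
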